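(* Let $\rho\in\mathcal{P}(\Omega)$ and assume $\rho\ll\mathcal{L}^d\llcorner\Omega$ with $d\rho/d\mathcal{L}^d\in L^2(\Omega)$. Let $C_d:=\|\mathrm{Cos}^2(|\cdot|)\|_{L^1(\mathbb{R}^d)}$. For any $\kappa\in(0,\infty)$, let $(\nu_\kappa,\psi_\kappa)\in\mathcal{M}_+(\Omega)\times C(\Omega)$ be an optimal pair for $(\mathcal P_{\rho,\kappa})$ and $(\mathcal D_{\rho,\kappa})$. Then $\nu_\kappa$ converges weak* to $0$ as $\kappa\to0$, with $$\|\nu_\kappa\|\le4\,C_d\,\Big\|\frac{d\rho}{d\mathcal{L}^d}\Big\|_{L^2(\Omega)}^2\cdot\kappa^d .$$ In particular, $\nu_\kappa/(C_d\kappa^d)$ converges weak* to $\big(\frac{d\rho}{d\mathcal{L}^d}\big)^2\cdot\mathcal{L}^d$ and $\|1-\psi_\kappa\|_\infty=O(\kappa^{d/2})$ as $\kappa\to0$.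
   Context: $\Omega \subset \mathbb{R}^d$ is a compact convex set with non-empty interior, $\mathcal{L}^d$ is Lebesgue measure. $C(\Omega)$ denotes the continuous real functions on $\Omega$ with sup-norm $\|\cdot\|_\infty$, $\mathcal{M}_+(\Omega)$ and $\mathcal{P}(\Omega)$ the non-negative Radon measures and the probability measures on $\Omega$, $\|\mu\| = \mu(\Omega)$ for $\mu\in\mathcal{M}_+(\Omega)$; weak* convergence is by duality with $C(\Omega)$. $\mathrm{Cos}(s):=\cos(\min\{|s|,\pi/2\})$. For $\kappa\in(0,\infty)$ and $\mu,\nu\in\mathcal{M}_+(\Omega)$ the Hellinger--Kantorovich distance is $$\mathrm{HK}_\kappa^2(\mu,\nu) := \inf_{\gamma\in\mathcal{M}_+(\Omega\times\Omega)} \int \hat c_\kappa\,d\gamma + \mathrm{KL}(P_1\gamma|\mu)+\mathrm{KL}(P_2\gamma|\nu),$$ where $P_1\gamma,P_2\gamma$ are the two marginals of $\gamma$, $\hat c_\kappa(x,y) = -2\log\cos(|x-y|/\kappa)$ if $|x-y|\le\kappa\pi/2$ (with $-\log 0=+\infty$) and $+\infty$ otherwise, and $\mathrm{KL}(\mu|\nu)=\int\varphi(d\mu/d\nu)\,d\nu$ if $\mu\ll\nu$, $\mu\ge0$, and $+\infty$ otherwise, with $\varphi(s)=s\log s-s+1$ for $s>0$, $\varphi(0)=1$, $\varphi(s)=+\infty$ for $s<0$. Primal problem $(\mathcal P_{\rho,\kappa})$: minimize $\int_\Omega\mathrm{HK}_\kappa^2(\delta_x,\nu)\,d\rho(x)$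 over $\nu\in\mathcal{M}_+(\Omega)$. Dual problem $(\mathcal D_{\rho,\kappa})$: maximize $\int_\Omega\psi\,d\rho$ over $\psi\in C(\Omega)$ with $\psi<1$ and $\int_\Omega\frac{\mathrm{Cos}^2(|x-y|/\kappa)}{1-\psi(x)}\,d\rho(x)\le1$ for all $y\in\Omega$. An optimal pair $(\nu,\psi)$ consists of a minimizer $\nu$ of $(\mathcal P_{\rho,\kappa})$ and a maximizer $\psi$ of $(\mathcal D_{\rho,\kappa})$.
   Formalization: As maximizers are arbitrary off spt(ρ), the bound ‖1−ψ_κ‖_∞ = O(κ^{d/2}) can fail on Ω; it is stated with the sup over spt(ρ) for every maximizer, and over all of Ω for some maximizers agreeing with ψ_κ on spt(ρ). *)

theory Defs
  imports "HOL-Probability.Probability" "HOL-Library.Landau_Symbols"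
begin

text \<open>Elements of \<open>C(\<Omega>)\<close> are represented by total functions that are \<open>continuous_on \<Omega>\<close>; their values
  outside \<open>\<Omega>\<close> never matter.  Measures on \<open>\<Omega>\<close> live on the Borel sigma-algebra of the subspace \<open>\<Omega>\<close>;
  for compact \<open>\<Omega>\<close> in a Euclidean space the finite ones are exactly the non-negative Radon measures.\<close>

definition nonneg_measures :: "'a::topological_space set \<Rightarrow> 'a measure set" where
  "nonneg_measures \<Omega> = {\<mu>. sets \<mu> = sets (restrict_space borel \<Omega>) \<and> finite_measure \<mu>}"

definition prob_measures :: "'a::topological_space set \<Rightarrow> 'a measure set" where
  "prob_measures \<Omega> = {\<mu>. sets \<mu> = sets (restrict_space borel \<Omega>) \<and> prob_space \<mu>}"

definition dirac :: "'a::topological_space set \<Rightarrow> 'a \<Rightarrow> 'a measure" where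
  "dirac \<Omega> x = return (restrict_space borel \<Omega>) x"

definition leb_on :: "'a::euclidean_space set \<Rightarrow> 'a measure" where
  "leb_on \<Omega> = restrict_space lborel \<Omega>"

text \<open>The topological support.  Both the objective and the constraint of the dual problem below see a
  continuous \<open>\<psi>\<close> only through its restriction to the support of \<open>\<rho>\<close>, so the values of a maximizer off
  the support are not determined by optimality.\<close>

definition measure_support :: "'a::topological_space set \<Rightarrow> 'a measure \<Rightarrow> 'a set" where
  "measure_support \<Omega> \<mu> = {x \<in> \<Omega>. \<forall>U. open U \<longrightarrow> x \<in> U \<longrightarrow> emeasure \<mu> (U \<inter> \<Omega>) > 0}"

definition weak_star_tendsto ::
  "'a::topological_space set \<Rightarrow> ('i \<Rightarrow> 'a measure) \<Rightarrow> 'a measure \<Rightarrow> 'i filter \<Rightarrow> bool" where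
  "weak_star_tendsto \<Omega> \<mu> \<mu>\<^sub>0 F \<longleftrightarrow>
     (\<forall>g::'a \<Rightarrow> real. continuous_on \<Omega> g \<longrightarrow>
        ((\<lambda>i. \<integral>x. g x \<partial>\<mu> i) \<longlongrightarrow> (\<integral>x. g x \<partial>\<mu>\<^sub>0)) F)"

text \<open>Only meaningful where \<open>g\<close> is bounded on the nonempty set \<open>A\<close>, e.g. \<open>A\<close> compact and \<open>g\<close> continuous.\<close>

definition sup_norm_on :: "'a set \<Rightarrow> ('a \<Rightarrow> real) \<Rightarrow> real" where
  "sup_norm_on A g = (SUP x\<in>A. \<bar>g x\<bar>)"

definition square_integrable :: "'a measure \<Rightarrow> ('a \<Rightarrow> real) \<Rightarrow> bool" where
  "square_integrable M f \<longleftrightarrow> f \<in> borel_measurable M \<and> integrable M (\<lambda>x. (f x)\<^sup>2)"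

definition L2_norm :: "'a measure \<Rightarrow> ('a \<Rightarrow> real) \<Rightarrow> real" where
  "L2_norm M f = sqrt (\<integral>x. (f x)\<^sup>2 \<partial>M)"

definition L1_norm :: "'a measure \<Rightarrow> ('a \<Rightarrow> real) \<Rightarrow> real" where
  "L1_norm M f = (\<integral>x. \<bar>f x\<bar> \<partial>M)"

text \<open>The Radon-Nikodym derivative of a finite measure is finite almost everywhere, so \<open>enn2real\<close>
  changes it only on a null set.\<close>

definition rn_density :: "'a measure \<Rightarrow> 'a measure \<Rightarrow> 'a \<Rightarrow> real" where
  "rn_density M \<mu> x = enn2real (RN_deriv M \<mu> x)"

definition Cos :: "real \<Rightarrow> real" where
  "Cos s = cos (min \<bar>s\<bar> (pi / 2))"

definition Cos_const :: "'a::euclidean_space itself \<Rightarrow> real" where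
  "Cos_const _ = L1_norm (lborel :: 'a measure) (\<lambda>x. (Cos (norm x))\<^sup>2)"

text \<open>On \<open>[0, \<infinity>)\<close> the function \<open>s ln s - s + 1\<close> is non-negative, so nothing is truncated by \<open>ennreal\<close>.\<close>

definition entropy_fun :: "real \<Rightarrow> ennreal" where
  "entropy_fun s = (if s > 0 then ennreal (s * ln s - s + 1) else if s = 0 then 1 else \<infinity>)"

definition KL :: "'a measure \<Rightarrow> 'a measure \<Rightarrow> ennreal" where
  "KL \<mu> \<nu> = (if absolutely_continuous \<nu> \<mu>
               then \<integral>\<^sup>+x. entropy_fun (rn_density \<nu> \<mu> x) \<partial>\<nu> else \<infinity>)"

text \<open>The boundary case \<open>dist x y = \<kappa> pi / 2\<close> has cost \<open>-2 log 0 = \<infinity>\<close>; it is put into the second branch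
  because \<open>ln 0 = 0\<close> in the library.\<close>

definition HK_cost :: "real \<Rightarrow> 'a::metric_space \<Rightarrow> 'a \<Rightarrow> ennreal" where
  "HK_cost \<kappa> x y =
     (if dist x y < \<kappa> * pi / 2 then ennreal (- 2 * ln (cos (dist x y / \<kappa>))) else \<infinity>)"

definition HK_sq :: "'a::metric_space set \<Rightarrow> real \<Rightarrow> 'a measure \<Rightarrow> 'a measure \<Rightarrow> ennreal" where
  "HK_sq \<Omega> \<kappa> \<mu> \<nu> =
     (INF \<gamma> \<in> nonneg_measures (\<Omega> \<times> \<Omega>).
        (\<integral>\<^sup>+z. HK_cost \<kappa> (fst z) (snd z) \<partial>\<gamma>)
        + KL (distr \<gamma> (restrict_space borel \<Omega>) fst) \<mu>
        + KL (distr \<gamma> (restrict_space borel \<Omega>) snd) \<nu>)"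

definition primal_objective :: "'a::metric_space set \<Rightarrow> 'a measure \<Rightarrow> real \<Rightarrow> 'a measure \<Rightarrow> ennreal" where
  "primal_objective \<Omega> \<rho> \<kappa> \<nu> = (\<integral>\<^sup>+x. HK_sq \<Omega> \<kappa> (dirac \<Omega> x) \<nu> \<partial>\<rho>)"

definition primal_minimizer :: "'a::metric_space set \<Rightarrow> 'a measure \<Rightarrow> real \<Rightarrow> 'a measure \<Rightarrow> bool" where
  "primal_minimizer \<Omega> \<rho> \<kappa> \<nu> \<longleftrightarrow>
     \<nu> \<in> nonneg_measures \<Omega> \<and>
     (\<forall>\<nu>' \<in> nonneg_measures \<Omega>. primal_objective \<Omega> \<rho> \<kappa> \<nu> \<le> primal_objective \<Omega> \<rho> \<kappa> \<nu>')"

definition dual_feasible :: "'a::metric_space set \<Rightarrow> 'a measure \<Rightarrow> real \<Rightarrow> ('a \<Rightarrow> real) \<Rightarrow> bool" where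
  "dual_feasible \<Omega> \<rho> \<kappa> \<psi> \<longleftrightarrow>
     continuous_on \<Omega> \<psi> \<and> (\<forall>x\<in>\<Omega>. \<psi> x < 1) \<and>
     (\<forall>y\<in>\<Omega>. (\<integral>x. (Cos (dist x y / \<kappa>))\<^sup>2 / (1 - \<psi> x) \<partial>\<rho>) \<le> 1)"

definition dual_maximizer :: "'a::metric_space set \<Rightarrow> 'a measure \<Rightarrow> real \<Rightarrow> ('a \<Rightarrow> real) \<Rightarrow> bool" where
  "dual_maximizer \<Omega> \<rho> \<kappa> \<psi> \<longleftrightarrow>
     dual_feasible \<Omega> \<rho> \<kappa> \<psi> \<and>
     (\<forall>\<psi>'. dual_feasible \<Omega> \<rho> \<kappa> \<psi>' \<longrightarrow> (\<integral>x. \<psi>' x \<partial>\<rho>) \<le> (\<integral>x. \<psi> x \<partial>\<rho>))"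

definition optimal_pair ::
  "'a::metric_space set \<Rightarrow> 'a measure \<Rightarrow> real \<Rightarrow> 'a measure \<Rightarrow> ('a \<Rightarrow> real) \<Rightarrow> bool" where
  "optimal_pair \<Omega> \<rho> \<kappa> \<nu> \<psi> \<longleftrightarrow> primal_minimizer \<Omega> \<rho> \<kappa> \<nu> \<and> dual_maximizer \<Omega> \<rho> \<kappa> \<psi>"

end

theory Submission
  imports Defs
begin

text \<open>
  Write \<open>k(x,y) = Cos(|x - y|/\<kappa>)\<^sup>2\<close>, \<open>m(x) = (\<integral> k(x,y) d\<nu>(y))\<^bsup>1/2\<^esup>\<close> and \<open>W = C\<^sub>d \<kappa>\<^sup>d\<close>.
  Minimising the entropy functional over plans with first marginal a multiple of \<open>\<delta>\<^sub>x\<close> gives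
  \<open>HK\<^sup>2(\<delta>\<^sub>x, \<nu>) = 1 + \<parallel>\<nu>\<parallel> - 2 m(x)\<close>, so the primal problem is to minimise
  \<open>\<parallel>\<nu>\<parallel> - 2 \<integral> m d\<rho>\<close>.  Scaling a minimiser yields \<open>\<parallel>\<nu>\<parallel> = \<integral> m d\<rho>\<close>; adding small Dirac masses
  shows that \<open>1 - m - \<epsilon>\<close> is dual feasible for every \<open>\<epsilon> > 0\<close>.  Together with the dual constraint
  integrated against \<open>\<nu>\<close> this forces \<open>\<integral> (1 - \<psi> - m)\<^sup>2 / (1 - \<psi>) d\<rho> \<le> 0\<close>, hence \<open>1 - \<psi> = m\<close> on the
  support of \<open>\<rho>\<close>.  Completing the square, with \<open>r\<close> the density of \<open>\<rho>\<close>, the primal objective is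
  \<open>W (\<parallel>m/W - r\<parallel>\<^sup>2 - \<parallel>r\<parallel>\<^sup>2)\<close> with norms in \<open>L\<^sup>2(\<real>\<^sup>d)\<close>.  This bounds the mass of \<open>\<nu>\<close>, and comparison with
  \<open>W g\<^sup>2 dx\<close> for continuous \<open>g\<close> near \<open>r\<close> gives \<open>m/W \<rightarrow> r\<close> in \<open>L\<^sup>2\<close>.  Finally \<open>m\<^sup>2/W\<^sup>2\<close> is a
  mollification of \<open>\<nu>/W\<close>.
\<close>

section \<open>The kernel and the entropy\<close>

text \<open>Duality is extracted from the primal minimiser itself rather than from a minimax
  theorem. The natural dual candidate \<open>1 - m\<close> may be inadmissible: m can vanish, and
  there both the strict inequality \<psi> < 1 and the quotient k / m break down. The shift by
  \<epsilon> repairs this and is let go only after integration. The square is completed on the whole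
  space because m is spread over a neighbourhood of \<Omega> of width \<kappa> pi / 2; only there
  does m^2 integrate exactly to W times the mass of \<nu>, with no loss at the boundary. The price
  is an extension off \<Omega>: r by zero, test functions through the nearest-point projection onto
  the convex set \<Omega>, which preserves their modulus of continuity. Since r is merely square
  integrable, the competitors use bounded continuous g in its place, so that kernel averages
  converge at every interior point under a fixed bound; the frontier of a convex set is Lebesgue
  null. The square yields the mass bound with constant 1, hence also with 4.\<close>

lemma Cos_nonneg: "0 \<le> Cos s"
  unfolding Cos_def by (rule cos_ge_zero) (auto simp: min_def)

lemma Cos_le_1: "Cos s \<le> 1"
  unfolding Cos_def by simp

lemma Cos_eq_0: "pi / 2 \<le> \<bar>s\<bar> \<Longrightarrow> Cos s = 0"
  unfolding Cos_def by (simp only: min_absorb2 cos_pi_half)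

lemma Cos_eq_cos: "\<bar>s\<bar> < pi / 2 \<Longrightarrow> Cos s = cos s"
  unfolding Cos_def by (simp add: min_def)

lemma continuous_on_Cos [continuous_intros]:
  "continuous_on A f \<Longrightarrow> continuous_on A (\<lambda>x. Cos (f x))"
  unfolding Cos_def
  by (rule continuous_on_compose2[of UNIV cos]) (intro continuous_intros | simp)+

lemma borel_measurable_Cos [measurable]: "Cos \<in> borel_measurable borel"
  by (intro borel_measurable_continuous_onI continuous_intros)

text \<open>For \<kappa> > 0 this is exp(-c) for the transport cost c: the exponential turns 2 log
  cos into cos^2, and the cutoff in \<open>Cos\<close> gives 0 exactly where c is infinite.\<close>

definition hk_kernel :: "real \<Rightarrow> 'a::metric_space \<Rightarrow> 'a \<Rightarrow> real" where
  "hk_kernel \<kappa> x y = (Cos (dist x y / \<kappa>))\<^sup>2"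

lemma hk_kernel_nonneg: "0 \<le> hk_kernel \<kappa> x y"
  by (simp add: hk_kernel_def)

lemma hk_kernel_le_1: "hk_kernel \<kappa> x y \<le> 1"
  by (simp add: hk_kernel_def Cos_nonneg Cos_le_1 power_le_one)

lemma hk_kernel_commute: "hk_kernel \<kappa> x y = hk_kernel \<kappa> y x"
  by (simp add: hk_kernel_def dist_commute)

lemma hk_kernel_eq_0: "\<kappa> > 0 \<Longrightarrow> \<kappa> * pi / 2 \<le> dist x y \<Longrightarrow> hk_kernel \<kappa> x y = 0"
  by (simp add: hk_kernel_def Cos_eq_0 field_simps)

lemma continuous_on_hk_kernel [continuous_intros]:
  "continuous_on A f \<Longrightarrow> continuous_on A g \<Longrightarrow> continuous_on A (\<lambda>z. hk_kernel \<kappa> (f z) (g z))"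
  unfolding hk_kernel_def divide_inverse by (intro continuous_intros)

lemma borel_measurable_hk_kernel [measurable]:
  fixes f g :: "'b \<Rightarrow> 'a::{second_countable_topology, metric_space}"
  assumes [measurable]: "f \<in> borel_measurable M" "g \<in> borel_measurable M"
  shows "(\<lambda>z. hk_kernel \<kappa> (f z) (g z)) \<in> borel_measurable M"
  unfolding hk_kernel_def by measurable

text \<open>The library value \<open>ln 0 = 0\<close> makes the formula equal to 1 at s = 0, so one
  expression covers both finite branches.\<close>

lemma entropy_fun_eq: "0 \<le> s \<Longrightarrow> entropy_fun s = ennreal (s * ln s - s + 1)"
  by (auto simp: entropy_fun_def)

text \<open>Young's inequality for f ln f - f + 1, whose convex conjugate is exp(p) - 1, taken at p
  = -s. It is ln u \<le> u - 1 at u = exp(-s) / f, multiplied by f. Equality holds at f = exp(-s),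
  which later dictates the optimal plan.\<close>

lemma entropy_ge:
  assumes "0 \<le> (f::real)"
  shows "1 - exp (- s) \<le> f * ln f - f + 1 + f * s"
proof (cases "f = 0")
  case False
  with assms have f: "f > 0" by simp
  define u where "u = exp (- s) / f"
  have u: "u > 0" using f by (simp add: u_def)
  have "ln u \<le> u - 1" using u by (rule ln_le_minus_one)
  moreover have "ln u = - s - ln f" using f by (simp add: u_def ln_div)
  ultimately have "f * (- s - ln f) \<le> f * (u - 1)" using f by (intro mult_left_mono) auto
  moreover have "f * u = exp (- s)" using f by (simp add: u_def)
  ultimately show ?thesis by (simp add: algebra_simps)
qed simp

lemma entropy_nonneg: "0 \<le> (f::real) \<Longrightarrow> 0 \<le> f * ln f - f + 1"
  using entropy_ge[of f 0] by simp

lemma borel_measurable_entropy_fun [measurable]: "entropy_fun \<in> borel_measurable borel"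
  unfolding entropy_fun_def[abs_def] by measurable

lemma borel_measurable_HK_cost [measurable]:
  fixes f g :: "'b \<Rightarrow> 'a::{second_countable_topology, metric_space}"
  assumes [measurable]: "f \<in> borel_measurable M" "g \<in> borel_measurable M"
  shows "(\<lambda>z. HK_cost \<kappa> (f z) (g z)) \<in> borel_measurable M"
  unfolding HK_cost_def by measurable

text \<open>Fenchel's inequality at slope \<open>c + ln t\<close>, with the positive and negative parts of \<open>ln t\<close> on different
  sides so that nothing is subtracted in \<open>ennreal\<close>.\<close>

lemma HK_cost_pointwise_ge:
  assumes f: "0 \<le> (f::real)" and t: "t > 0" and k: "\<kappa> > 0"
  shows "1 + ennreal (f * max (- ln t) 0)
    \<le> entropy_fun f + ennreal f * HK_cost \<kappa> x y + ennreal (hk_kernel \<kappa> x y / t) + ennreal (f * max (ln t) 0)"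
proof (cases "dist x y < \<kappa> * pi / 2")
  case True
  define c where "c = cos (dist x y / \<kappa>)"
  have lt: "dist x y / \<kappa> < pi / 2" using True k by (simp add: field_simps)
  have "0 \<le> dist x y / \<kappa>" using k by simp
  then have c: "c > 0" unfolding c_def using lt by (intro cos_gt_zero_pi) auto
  have c1: "c \<le> 1" by (simp add: c_def)
  have ker: "hk_kernel \<kappa> x y = c\<^sup>2"
    unfolding hk_kernel_def c_def using lt k by (subst Cos_eq_cos) auto
  have cost: "HK_cost \<kappa> x y = ennreal (- 2 * ln c)" using True by (simp add: HK_cost_def c_def)
  have lnc: "ln c \<le> 0" using c c1 by simp
  \<comment> \<open>At the slope cost + ln t the exponential in \<open>entropy_ge\<close> is
    exp(-cost) / t; this is where the kernel enters.\<close>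
  have "exp (- (- 2 * ln c + ln t)) = exp (ln c + ln c) / t"
    using t by (simp add: exp_diff algebra_simps)
  also have "\<dots> = c\<^sup>2 / t" using c by (simp only: exp_add exp_ln power2_eq_square)
  finally have "exp (- (- 2 * ln c + ln t)) = c\<^sup>2 / t" .
  then have "1 - c\<^sup>2 / t \<le> f * ln f - f + 1 + f * (- 2 * ln c + ln t)"
    using entropy_ge[OF f, of "- 2 * ln c + ln t"] by simp
  moreover have "f * ln t = f * max (ln t) 0 - f * max (- ln t) 0"
    by (auto simp: max_def)
  ultimately have *: "1 + f * max (- ln t) 0
      \<le> (f * ln f - f + 1) + f * (- 2 * ln c) + c\<^sup>2 / t + f * max (ln t) 0"
    by (simp add: algebra_simps)
  have "1 + ennreal (f * max (- ln t) 0) = ennreal (1 + f * max (- ln t) 0)"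
    using f by (subst ennreal_plus) auto
  also have "\<dots> \<le> ennreal ((f * ln f - f + 1) + f * (- 2 * ln c) + c\<^sup>2 / t + f * max (ln t) 0)"
    using * by (rule ennreal_leI)
  also have "\<dots> = entropy_fun f + ennreal f * HK_cost \<kappa> x y + ennreal (hk_kernel \<kappa> x y / t) + ennreal (f * max (ln t) 0)"
  proof -
    have "0 \<le> f * (- 2 * ln c)" using f lnc by (simp add: mult_nonneg_nonpos)
    then show ?thesis
      unfolding entropy_fun_eq[OF f] cost ker
      using f lnc t entropy_nonneg[OF f] by (simp add: ennreal_plus ennreal_mult flip: ennreal_mult del: ennreal_plus)
        (simp flip: ennreal_plus)
  qed
  finally show ?thesis .
next
  case False
  then have cost: "HK_cost \<kappa> x y = \<infinity>" by (simp add: HK_cost_def)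
  show ?thesis
  \<comment> \<open>If f = 0, the infinite cost has weight 0 and the entropy alone supplies the 1 on
    the left; if f > 0, the right side is infinite.\<close>
  proof (cases "f = 0")
    case True
    then show ?thesis by (simp add: entropy_fun_def)
  next
    case False
    then show ?thesis using f by (simp add: cost ennreal_mult_top)
  qed
qed

text \<open>The square of the function m of the overview. The root is left to the places of use, so
  that linearity in \<nu> stays available when \<nu> is scaled or a point mass is added.\<close>

definition kernel_mass :: "real \<Rightarrow> 'a::metric_space measure \<Rightarrow> 'a \<Rightarrow> real" where
  "kernel_mass \<kappa> \<nu> x = (\<integral>y. hk_kernel \<kappa> x y \<partial>\<nu>)"

section \<open>Measures on the subspace, their marginals and Radon-Nikodym densities\<close>

lemma space_eq_of_nonneg_measures:
  "\<nu> \<in> nonneg_measures \<Omega> \<Longrightarrow> space \<nu> = \<Omega>"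
  unfolding nonneg_measures_def by (auto dest: sets_eq_imp_space_eq simp: space_restrict_space)

lemma sets_of_nonneg_measures:
  "\<nu> \<in> nonneg_measures \<Omega> \<Longrightarrow> sets \<nu> = sets (restrict_space borel \<Omega>)"
  unfolding nonneg_measures_def by simp

lemma finite_measure_of_nonneg_measures:
  "\<nu> \<in> nonneg_measures \<Omega> \<Longrightarrow> finite_measure \<nu>"
  unfolding nonneg_measures_def by simp

lemma nonneg_measures_measurable_id:
  "\<nu> \<in> nonneg_measures \<Omega> \<Longrightarrow> (\<lambda>x. x) \<in> borel_measurable \<nu>"
  by (subst measurable_cong_sets[OF sets_of_nonneg_measures refl])
     (auto intro: measurable_restrict_space1)

lemma integrable_hk_kernel:
  fixes \<nu> :: "'a::{second_countable_topology, metric_space} measure"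
  assumes "\<nu> \<in> nonneg_measures \<Omega>"
  shows "integrable \<nu> (hk_kernel \<kappa> x)"
proof -
  interpret finite_measure \<nu> by (rule finite_measure_of_nonneg_measures[OF assms])
  note [measurable] = nonneg_measures_measurable_id[OF assms]
  show ?thesis
    by (rule integrable_const_bound[of _ 1]) (auto simp: hk_kernel_nonneg hk_kernel_le_1)
qed

lemma kernel_mass_nonneg: "0 \<le> kernel_mass \<kappa> \<nu> x"
  unfolding kernel_mass_def by (rule integral_nonneg_AE) (simp add: hk_kernel_nonneg)

lemma kernel_mass_le:
  fixes \<nu> :: "'a::{second_countable_topology, metric_space} measure"
  assumes "\<nu> \<in> nonneg_measures \<Omega>"
  shows "kernel_mass \<kappa> \<nu> x \<le> measure \<nu> \<Omega>"
proof -
  interpret finite_measure \<nu> by (rule finite_measure_of_nonneg_measures[OF assms])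
  have "kernel_mass \<kappa> \<nu> x \<le> (\<integral>y. 1 \<partial>\<nu>)"
    unfolding kernel_mass_def
    by (intro integral_mono integrable_hk_kernel[OF assms]) (auto simp: hk_kernel_le_1)
  then show ?thesis by (simp add: space_eq_of_nonneg_measures[OF assms])
qed

lemma nn_integral_hk_kernel:
  fixes \<nu> :: "'a::{second_countable_topology, metric_space} measure"
  assumes "\<nu> \<in> nonneg_measures \<Omega>"
  shows "(\<integral>\<^sup>+y. ennreal (hk_kernel \<kappa> x y) \<partial>\<nu>) = ennreal (kernel_mass \<kappa> \<nu> x)"
  unfolding kernel_mass_def
  by (rule nn_integral_eq_integral) (auto simp: hk_kernel_nonneg integrable_hk_kernel[OF assms])

lemma measurable_projections_nonneg_measures:
  fixes \<gamma> :: "('a::second_countable_topology \<times> 'a) measure"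
  assumes "\<gamma> \<in> nonneg_measures (\<Omega> \<times> \<Omega>)"
  shows "fst \<in> \<gamma> \<rightarrow>\<^sub>M restrict_space borel \<Omega>" "snd \<in> \<gamma> \<rightarrow>\<^sub>M restrict_space borel \<Omega>"
proof -
  have "fst \<in> borel_measurable \<gamma>" "snd \<in> borel_measurable \<gamma>"
    using nonneg_measures_measurable_id[OF assms]
    by (auto simp flip: borel_prod dest: measurable_compose[OF _ measurable_fst] measurable_compose[OF _ measurable_snd])
  then show "fst \<in> \<gamma> \<rightarrow>\<^sub>M restrict_space borel \<Omega>" "snd \<in> \<gamma> \<rightarrow>\<^sub>M restrict_space borel \<Omega>"
    by (auto intro!: measurable_restrict_space2 simp: space_eq_of_nonneg_measures[OF assms])
qed

lemma nonneg_measures_distr: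
  assumes "finite_measure \<mu>" "f \<in> \<mu> \<rightarrow>\<^sub>M restrict_space borel \<Omega>"
  shows "distr \<mu> (restrict_space borel \<Omega>) f \<in> nonneg_measures \<Omega>"
  unfolding nonneg_measures_def using finite_measure.finite_measure_distr[OF assms] by simp

lemma density_rn_density:
  assumes "sigma_finite_measure M" "finite_measure N" "absolutely_continuous M N" "sets N = sets M"
  shows "density M (\<lambda>x. ennreal (rn_density M N x)) = N"
proof -
  interpret M: sigma_finite_measure M by fact
  interpret N: finite_measure N by fact
  have "density M (\<lambda>x. ennreal (rn_density M N x)) = density M (RN_deriv M N)"
  proof (rule density_cong)
    show "AE x in M. ennreal (rn_density M N x) = RN_deriv M N x"
      using M.RN_deriv_finite[OF N.sigma_finite_measure_axioms assms(3,4)]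
      by eventually_elim (auto simp: rn_density_def less_top)
  qed (simp_all add: rn_density_def)
  also have "\<dots> = N" by (rule M.density_RN_deriv[OF assms(3,4)])
  finally show ?thesis .
qed

lemma rn_density_nonneg: "0 \<le> rn_density M N x"
  by (simp add: rn_density_def)

lemma borel_measurable_rn_density [measurable]: "rn_density M N \<in> borel_measurable M"
  unfolding rn_density_def[abs_def] by measurable

lemma rn_density_density:
  assumes "sigma_finite_measure M" and [measurable]: "f \<in> borel_measurable M" and "\<And>x. 0 \<le> f x"
  shows "AE x in M. rn_density M (density M (\<lambda>x. ennreal (f x))) x = f x"
proof -
  interpret M: sigma_finite_measure M by fact
  have "AE x in M. ennreal (f x) = RN_deriv M (density M (\<lambda>x. ennreal (f x))) x"
    by (rule M.RN_deriv_unique) auto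
  then show ?thesis
    by eventually_elim (metis assms(3) enn2real_ennreal rn_density_def)
qed

text \<open>Absolute continuity with respect to a point mass forces \<mu> to be a multiple of it,
  and the density at x is the factor, that is, the total mass. The penalty on the first marginal of
  a plan therefore depends only on the mass of the plan.\<close>

lemma KL_dirac:
  fixes \<mu> :: "'a::{second_countable_topology, metric_space} measure"
  assumes \<mu>: "\<mu> \<in> nonneg_measures \<Omega>" and x: "x \<in> \<Omega>" and ac: "absolutely_continuous (dirac \<Omega> x) \<mu>"
  shows "KL \<mu> (dirac \<Omega> x) = entropy_fun (measure \<mu> \<Omega>)"
proof -
  interpret finite_measure \<mu> by (rule finite_measure_of_nonneg_measures[OF \<mu>])
  let ?D = "dirac \<Omega> x" and ?f = "rn_density (dirac \<Omega> x) \<mu>"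
  have sD: "sets ?D = sets \<mu>" by (simp add: dirac_def sets_of_nonneg_measures[OF \<mu>])
  have xs: "x \<in> space (restrict_space borel \<Omega>)" using x by (simp add: space_restrict_space)
  interpret D: prob_space ?D unfolding dirac_def by (rule prob_space_return[OF xs])
  have meas: "(\<lambda>y. ennreal (?f y)) \<in> borel_measurable (restrict_space borel \<Omega>)"
    using borel_measurable_rn_density[of ?D \<mu>] by (simp add: dirac_def cong: measurable_cong_sets)
  have "emeasure \<mu> \<Omega> = emeasure (density ?D (\<lambda>y. ennreal (?f y))) \<Omega>"
    by (subst density_rn_density[OF D.sigma_finite_measure_axioms finite_measure_axioms ac]) (simp_all add: sD)
  also have "\<dots> = (\<integral>\<^sup>+y. ennreal (?f y) \<partial>?D)"
    using sets.top[of ?D] by (subst emeasure_density) (auto simp: sets_eq_imp_space_eq[OF sD] space_eq_of_nonneg_measures[OF \<mu>] intro!: nn_integral_cong)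
  also have "\<dots> = ennreal (?f x)"
    unfolding dirac_def by (rule nn_integral_return[OF xs]) (use meas in \<open>simp add: dirac_def\<close>)
  finally have "measure \<mu> \<Omega> = ?f x"
    by (simp add: measure_def rn_density_nonneg)
  moreover have "(\<integral>\<^sup>+y. entropy_fun (?f y) \<partial>?D) = entropy_fun (?f x)"
    unfolding dirac_def
    by (rule nn_integral_return[OF xs])
       (use borel_measurable_rn_density[of ?D \<mu>] in \<open>auto simp: dirac_def intro!: measurable_compose[OF _ borel_measurable_entropy_fun] cong: measurable_cong_sets\<close>)
  ultimately show ?thesis using ac by (simp add: KL_def)
qed

section \<open>The Hellinger--Kantorovich distance to a Dirac mass\<close>

text \<open>The number t acts as a multiplier for the mass m of the plan. With K the kernel mass at
  x, the pointwise inequality integrated in y bounds cost plus second penalty below by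
  \<open>measure \<nu> \<Omega>\<close> - K / t - m ln t, while the first penalty is at least 1 - t
  + m ln t. The terms m ln t cancel, so the unknown mass of the plan drops out.\<close>

lemma HK_sq_dirac_ge:
  fixes \<nu> :: "'a::{second_countable_topology, metric_space} measure"
  assumes \<nu>: "\<nu> \<in> nonneg_measures \<Omega>" and x: "x \<in> \<Omega>" and \<kappa>: "\<kappa> > 0" and t: "t > 0"
  shows "ennreal (1 + measure \<nu> \<Omega> - kernel_mass \<kappa> \<nu> x / t - t) \<le> HK_sq \<Omega> \<kappa> (dirac \<Omega> x) \<nu>"
  unfolding HK_sq_def
proof (rule INF_greatest)
  fix \<gamma> :: "('a \<times> 'a) measure" assume \<gamma>: "\<gamma> \<in> nonneg_measures (\<Omega> \<times> \<Omega>)"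
  let ?P1 = "distr \<gamma> (restrict_space borel \<Omega>) fst" and ?P2 = "distr \<gamma> (restrict_space borel \<Omega>) snd"
  interpret G: finite_measure \<gamma> by (rule finite_measure_of_nonneg_measures[OF \<gamma>])
  interpret N: finite_measure \<nu> by (rule finite_measure_of_nonneg_measures[OF \<nu>])
  note fst_meas = measurable_projections_nonneg_measures(1)[OF \<gamma>] and snd_meas = measurable_projections_nonneg_measures(2)[OF \<gamma>]
  have P1: "?P1 \<in> nonneg_measures \<Omega>" and P2: "?P2 \<in> nonneg_measures \<Omega>"
    by (intro nonneg_measures_distr fst_meas snd_meas G.finite_measure_axioms)+
  interpret P2: finite_measure ?P2 by (rule finite_measure_of_nonneg_measures[OF P2])
  have sp\<gamma>: "space \<gamma> = \<Omega> \<times> \<Omega>" and sp\<nu>: "space \<nu> = \<Omega>"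
    using space_eq_of_nonneg_measures \<gamma> \<nu> by auto
  have s\<nu>: "sets \<nu> = sets (restrict_space borel \<Omega>)" by (rule sets_of_nonneg_measures[OF \<nu>])
  define m where "m = measure \<gamma> (\<Omega> \<times> \<Omega>)"
  have m0: "0 \<le> m" by (simp add: m_def)
  have \<Omega>set: "\<Omega> \<in> sets (restrict_space borel \<Omega>)"
    using sets.top[of \<nu>] s\<nu> sp\<nu> by simp
  have m1: "measure ?P1 \<Omega> = m" and m2: "emeasure ?P2 \<Omega> = ennreal m"
    using fst_meas snd_meas \<Omega>set
    by (auto simp: measure_distr emeasure_distr m_def G.emeasure_eq_measure sp\<gamma> intro!: arg_cong[where f="measure \<gamma>"])
  show "ennreal (1 + measure \<nu> \<Omega> - kernel_mass \<kappa> \<nu> x / t - t)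
    \<le> (\<integral>\<^sup>+z. HK_cost \<kappa> (fst z) (snd z) \<partial>\<gamma>) + KL ?P1 (dirac \<Omega> x) + KL ?P2 \<nu>"
  proof (cases "absolutely_continuous (dirac \<Omega> x) ?P1 \<and> absolutely_continuous \<nu> ?P2")
    case False
    then show ?thesis by (auto simp: KL_def)
  next
    case True
    then have ac1: "absolutely_continuous (dirac \<Omega> x) ?P1" and ac2: "absolutely_continuous \<nu> ?P2" by auto
    define f where "f = rn_density \<nu> ?P2"
    have f0: "0 \<le> f y" for y by (simp add: f_def rn_density_nonneg)
    have f_meas [measurable]: "f \<in> borel_measurable \<nu>" by (simp add: f_def)
    note [measurable] = nonneg_measures_measurable_id[OF \<nu>]
    have dens: "density \<nu> (\<lambda>y. ennreal (f y)) = ?P2"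
      unfolding f_def
      by (rule density_rn_density[OF N.sigma_finite_measure_axioms P2.finite_measure_axioms ac2]) (simp add: s\<nu>)
    have fint: "(\<integral>\<^sup>+y. ennreal (f y) \<partial>\<nu>) = ennreal m"
    proof -
      have "emeasure (density \<nu> (\<lambda>y. ennreal (f y))) \<Omega> = (\<integral>\<^sup>+y. ennreal (f y) \<partial>\<nu>)"
        using sets.top[of \<nu>] sp\<nu> by (subst emeasure_density) (auto intro!: nn_integral_cong)
      with dens m2 show ?thesis by simp
    qed
    \<comment> \<open>Absolute continuity of the first marginal concentrates the plan on {x}
      \<times> \<Omega>. The cost then depends on the second coordinate only and becomes an integral
      against \<nu> with weight f.\<close>
    have one: "AE z in \<gamma>. fst z = x"
    proof -
      have "\<Omega> - {x} \<in> sets (restrict_space borel \<Omega>)"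
        by (auto simp: sets_restrict_space intro!: image_eqI[of _ _ "- {x}"])
      then have "\<Omega> - {x} \<in> null_sets (dirac \<Omega> x)"
        by (simp add: dirac_def null_sets_def)
      then have N1: "\<Omega> - {x} \<in> null_sets ?P1" using ac1 by (auto simp: absolutely_continuous_def)
      then have "AE y in ?P1. y = x"
        using AE_I'[OF N1, of "\<lambda>y. y = x"] by (auto simp: space_restrict_space)
      then show ?thesis
        using AE_distrD[OF fst_meas] by auto
    qed
    have cost: "(\<integral>\<^sup>+z. HK_cost \<kappa> (fst z) (snd z) \<partial>\<gamma>) = (\<integral>\<^sup>+y. ennreal (f y) * HK_cost \<kappa> x y \<partial>\<nu>)"
    proof -
      have [measurable]: "(\<lambda>y. y) \<in> borel_measurable (restrict_space borel \<Omega>)"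
        by (auto intro: measurable_restrict_space1)
      have "(\<integral>\<^sup>+z. HK_cost \<kappa> (fst z) (snd z) \<partial>\<gamma>) = (\<integral>\<^sup>+z. HK_cost \<kappa> x (snd z) \<partial>\<gamma>)"
        by (rule nn_integral_cong_AE) (use one in eventually_elim, auto)
      also have "\<dots> = (\<integral>\<^sup>+y. HK_cost \<kappa> x y \<partial>?P2)"
        by (rule nn_integral_distr[symmetric, OF snd_meas]) measurable
      also have "\<dots> = (\<integral>\<^sup>+y. HK_cost \<kappa> x y \<partial>(density \<nu> (\<lambda>y. ennreal (f y))))"
        by (simp add: dens)
      also have "\<dots> = (\<integral>\<^sup>+y. ennreal (f y) * HK_cost \<kappa> x y \<partial>\<nu>)"
        by (rule nn_integral_density) measurable
      finally show ?thesis .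
    qed
    define A where "A = (\<integral>\<^sup>+y. entropy_fun (f y) + ennreal (f y) * HK_cost \<kappa> x y \<partial>\<nu>)"
    have total: "(\<integral>\<^sup>+z. HK_cost \<kappa> (fst z) (snd z) \<partial>\<gamma>) + KL ?P1 (dirac \<Omega> x) + KL ?P2 \<nu>
        = A + entropy_fun m"
    proof -
      have "KL ?P2 \<nu> = (\<integral>\<^sup>+y. entropy_fun (f y) \<partial>\<nu>)" using ac2 by (simp add: KL_def f_def)
      then show ?thesis
        unfolding A_def cost KL_dirac[OF P1 x ac1] m1
        by (subst nn_integral_add) (simp_all add: ac_simps)
    qed
    let ?b = "max (- ln t) 0" and ?a = "max (ln t) 0"
    have fmul: "(\<integral>\<^sup>+y. ennreal (f y * c) \<partial>\<nu>) = ennreal (m * c)" if "0 \<le> c" for c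
    proof -
      have "(\<integral>\<^sup>+y. ennreal (f y * c) \<partial>\<nu>) = (\<integral>\<^sup>+y. ennreal (f y) * ennreal c \<partial>\<nu>)"
        using that f0 by (simp add: ennreal_mult)
      also have "\<dots> = ennreal m * ennreal c" by (subst nn_integral_multc) (simp_all add: fint)
      finally show ?thesis using that m0 by (simp add: ennreal_mult)
    qed
    have "(\<integral>\<^sup>+y. 1 + ennreal (f y * ?b) \<partial>\<nu>)
        \<le> (\<integral>\<^sup>+y. entropy_fun (f y) + ennreal (f y) * HK_cost \<kappa> x y + ennreal (hk_kernel \<kappa> x y / t) + ennreal (f y * ?a) \<partial>\<nu>)"
      by (intro nn_integral_mono HK_cost_pointwise_ge f0 t \<kappa>)
    also have "(\<integral>\<^sup>+y. 1 + ennreal (f y * ?b) \<partial>\<nu>) = ennreal (measure \<nu> \<Omega> + m * ?b)"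
      using m0 by (subst nn_integral_add) (simp_all add: fmul N.emeasure_eq_measure sp\<nu>)
    also have "(\<integral>\<^sup>+y. entropy_fun (f y) + ennreal (f y) * HK_cost \<kappa> x y + ennreal (hk_kernel \<kappa> x y / t) + ennreal (f y * ?a) \<partial>\<nu>)
        = A + (\<integral>\<^sup>+y. ennreal (hk_kernel \<kappa> x y / t) \<partial>\<nu>) + (\<integral>\<^sup>+y. ennreal (f y * ?a) \<partial>\<nu>)"
      unfolding A_def by (subst nn_integral_add[where f="\<lambda>y. _ y + ennreal (hk_kernel \<kappa> x y / t)"], measurable)
        (subst nn_integral_add[where g="\<lambda>y. ennreal (hk_kernel \<kappa> x y / t)"], measurable)
    also have "(\<integral>\<^sup>+y. ennreal (hk_kernel \<kappa> x y / t) \<partial>\<nu>) = ennreal (kernel_mass \<kappa> \<nu> x / t)"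
      using t by (subst nn_integral_eq_integral)
        (auto simp: hk_kernel_nonneg kernel_mass_def integrable_hk_kernel[OF \<nu>])
    also have "(\<integral>\<^sup>+y. ennreal (f y * ?a) \<partial>\<nu>) = ennreal (m * ?a)"
      by (simp add: fmul)
    finally have 1: "ennreal (measure \<nu> \<Omega> + m * ?b) \<le> A + ennreal (kernel_mass \<kappa> \<nu> x / t) + ennreal (m * ?a)" .
    show ?thesis
    proof (cases "A = \<infinity>")
      case True
      then show ?thesis unfolding total by simp
    next
      case False
      then obtain a where a: "A = ennreal a" "0 \<le> a" by (cases A) auto
      have k0: "0 \<le> kernel_mass \<kappa> \<nu> x / t" using t kernel_mass_nonneg[of \<kappa> \<nu> x] by simp
      have "measure \<nu> \<Omega> + m * ?b \<le> a + kernel_mass \<kappa> \<nu> x / t + m * ?a"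
        using 1 a k0 m0 by (simp add: ennreal_le_iff flip: ennreal_plus)
      moreover have "m * ?a - m * ?b = m * ln t" by (auto simp: max_def)
      \<comment> \<open>The first marginal uses Young's inequality at the opposite slope, -ln t, to
        produce the cancellation.\<close>
      moreover have "1 - t \<le> m * ln m - m + 1 + m * (- ln t)"
        using entropy_ge[OF m0, of "- ln t"] t by simp
      ultimately have "1 + measure \<nu> \<Omega> - kernel_mass \<kappa> \<nu> x / t - t \<le> a + (m * ln m - m + 1)"
        by (simp add: algebra_simps)
      then show ?thesis
        unfolding total a entropy_fun_eq[OF m0]
        using a entropy_nonneg[OF m0] by (simp add: ennreal_leI flip: ennreal_plus)
    qed
  qed
qed

text \<open>The competitor is the equality case of the lower bound at t = M: the product of the
  point mass at x with the measure of density k(x,y) / M against \<nu>. Its mass is M^2 / M = M, so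
  all three terms of the functional can be evaluated.\<close>

lemma HK_sq_dirac_le:
  fixes \<nu> :: "'a::{second_countable_topology, metric_space} measure"
  assumes \<nu>: "\<nu> \<in> nonneg_measures \<Omega>" and x: "x \<in> \<Omega>" and \<kappa>: "\<kappa> > 0"
  shows "HK_sq \<Omega> \<kappa> (dirac \<Omega> x) \<nu> \<le> ennreal (1 + measure \<nu> \<Omega> - 2 * sqrt (kernel_mass \<kappa> \<nu> x))"
proof -
  define M where "M = sqrt (kernel_mass \<kappa> \<nu> x)"
  have M0: "0 \<le> M" and M2: "kernel_mass \<kappa> \<nu> x = M\<^sup>2"
    by (auto simp: M_def kernel_mass_nonneg)
  \<comment> \<open>For M = 0 the convention a / 0 = 0 makes f vanish, and the competitor is the
    zero plan.\<close>
  define f where "f y = hk_kernel \<kappa> x y / M" for y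
  have f0: "0 \<le> f y" for y using M0 by (simp add: f_def hk_kernel_nonneg)
  interpret N: finite_measure \<nu> by (rule finite_measure_of_nonneg_measures[OF \<nu>])
  note [measurable] = nonneg_measures_measurable_id[OF \<nu>]
  have f_meas [measurable]: "f \<in> borel_measurable \<nu>" unfolding f_def[abs_def] by measurable
  have sp\<nu>: "space \<nu> = \<Omega>" using space_eq_of_nonneg_measures \<nu> by auto
  have s\<nu>: "sets \<nu> = sets (restrict_space borel \<Omega>)" by (rule sets_of_nonneg_measures[OF \<nu>])
  have int_f: "integrable \<nu> f" "(\<integral>y. f y \<partial>\<nu>) = M"
    using integrable_hk_kernel[OF \<nu>] M0 M2
    by (auto simp: f_def[abs_def] kernel_mass_def[symmetric] power2_eq_square)
  define \<mu> where "\<mu> = density \<nu> (\<lambda>y. ennreal (f y))"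
  have mass: "emeasure \<mu> (space \<mu>) = ennreal M"
    unfolding \<mu>_def using int_f f0
    by (subst emeasure_density) (auto simp: nn_integral_eq_integral[symmetric] intro!: nn_integral_cong)
  have fin\<mu>: "finite_measure \<mu>" by (rule finite_measureI) (simp add: mass)
  have s\<mu>: "sets \<mu> = sets (restrict_space borel \<Omega>)" by (simp add: \<mu>_def s\<nu>)
  have \<mu>: "\<mu> \<in> nonneg_measures \<Omega>" using fin\<mu> s\<mu> by (simp add: nonneg_measures_def)
  have sp\<mu>: "space \<mu> = \<Omega>" by (rule space_eq_of_nonneg_measures[OF \<mu>])
  define \<gamma> where "\<gamma> = distr \<mu> (restrict_space borel (\<Omega> \<times> \<Omega>)) (Pair x)"
  have Pm: "Pair x \<in> \<mu> \<rightarrow>\<^sub>M restrict_space borel (\<Omega> \<times> \<Omega>)"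
  proof (rule measurable_restrict_space2)
    show "Pair x \<in> space \<mu> \<rightarrow> \<Omega> \<times> \<Omega>" using x sp\<mu> by auto
    have "Pair x \<in> \<mu> \<rightarrow>\<^sub>M borel \<Otimes>\<^sub>M borel"
      using nonneg_measures_measurable_id[OF \<mu>] by measurable
    then show "Pair x \<in> borel_measurable \<mu>" by (simp add: borel_prod)
  qed
  have \<gamma>: "\<gamma> \<in> nonneg_measures (\<Omega> \<times> \<Omega>)"
    unfolding \<gamma>_def by (rule nonneg_measures_distr[OF fin\<mu> Pm])
  have fs: "fst \<in> restrict_space borel (\<Omega> \<times> \<Omega>) \<rightarrow>\<^sub>M restrict_space borel \<Omega>"
    "snd \<in> restrict_space borel (\<Omega> \<times> \<Omega>) \<rightarrow>\<^sub>M restrict_space borel \<Omega>"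
    using measurable_projections_nonneg_measures[OF \<gamma>] by (simp_all add: \<gamma>_def)
  have P1: "distr \<gamma> (restrict_space borel \<Omega>) fst = distr \<mu> (restrict_space borel \<Omega>) (\<lambda>_. x)"
    unfolding \<gamma>_def by (subst distr_distr[OF fs(1) Pm]) (simp add: o_def)
  have P2: "distr \<gamma> (restrict_space borel \<Omega>) snd = \<mu>"
    unfolding \<gamma>_def by (subst distr_distr[OF fs(2) Pm]) (simp add: o_def distr_id2 s\<mu>)
  have xm: "(\<lambda>_. x) \<in> \<mu> \<rightarrow>\<^sub>M restrict_space borel \<Omega>" using x by (simp add: space_restrict_space)
  have ac1: "absolutely_continuous (dirac \<Omega> x) (distr \<gamma> (restrict_space borel \<Omega>) fst)"
    unfolding absolutely_continuous_def P1
    by (auto simp: dirac_def null_sets_def emeasure_distr[OF xm] indicator_def)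
  have P1n: "distr \<gamma> (restrict_space borel \<Omega>) fst \<in> nonneg_measures \<Omega>"
    unfolding P1 by (rule nonneg_measures_distr[OF fin\<mu> xm])
  have m1: "measure (distr \<gamma> (restrict_space borel \<Omega>) fst) \<Omega> = M"
    unfolding P1 using sets.top[of \<mu>] s\<mu> sp\<mu> mass M0 x
    by (subst measure_distr[OF xm]) (auto simp: measure_def)
  have KL1: "KL (distr \<gamma> (restrict_space borel \<Omega>) fst) (dirac \<Omega> x) = ennreal (M * ln M - M + 1)"
    using KL_dirac[OF P1n x ac1] by (simp add: m1 entropy_fun_eq M0)
  have ac2: "absolutely_continuous \<nu> \<mu>"
    unfolding \<mu>_def by (rule absolutely_continuousI_density) measurable
  have KL2: "KL \<mu> \<nu> = (\<integral>\<^sup>+y. entropy_fun (f y) \<partial>\<nu>)"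
    unfolding KL_def using ac2
    by (auto intro!: nn_integral_cong_AE) (use rn_density_density[OF N.sigma_finite_measure_axioms f_meas f0] in
      \<open>simp add: \<mu>_def; eventually_elim; simp\<close>)
  have cost: "(\<integral>\<^sup>+z. HK_cost \<kappa> (fst z) (snd z) \<partial>\<gamma>) = (\<integral>\<^sup>+y. ennreal (f y) * HK_cost \<kappa> x y \<partial>\<nu>)"
  proof -
    have "(\<lambda>z. HK_cost \<kappa> (fst z) (snd z)) \<in> borel_measurable (restrict_space borel (\<Omega> \<times> \<Omega>))"
      by (intro borel_measurable_HK_cost measurable_compose[OF fs(1) measurable_restrict_space1]
          measurable_compose[OF fs(2) measurable_restrict_space1]) auto
    then have "(\<integral>\<^sup>+z. HK_cost \<kappa> (fst z) (snd z) \<partial>\<gamma>) = (\<integral>\<^sup>+y. HK_cost \<kappa> x y \<partial>\<mu>)"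
      unfolding \<gamma>_def by (subst nn_integral_distr[OF Pm]) auto
    also have "\<dots> = (\<integral>\<^sup>+y. ennreal (f y) * HK_cost \<kappa> x y \<partial>\<nu>)"
      unfolding \<mu>_def by (rule nn_integral_density) measurable
    finally show ?thesis .
  qed
  \<comment> \<open>Where f is positive, ln f = ln k - ln M while the cost is -ln k, so cost and
    logarithm combine to -f ln M.\<close>
  have pointwise: "ennreal (f y) * HK_cost \<kappa> x y + entropy_fun (f y) = ennreal (1 - f y * ln M - f y)"
    if "M > 0 \<or> hk_kernel \<kappa> x y = 0" for y
  proof (cases "f y = 0")
    case True
    then show ?thesis by (simp add: entropy_fun_def)
  next
    case False
    then have kp: "hk_kernel \<kappa> x y > 0" "M > 0" using hk_kernel_nonneg[of \<kappa> x y] that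
      by (auto simp: f_def)
    then have lt: "dist x y < \<kappa> * pi / 2"
      using hk_kernel_eq_0[OF \<kappa>, of x y] by linarith
    define c where "c = cos (dist x y / \<kappa>)"
    have lt': "dist x y / \<kappa> < pi / 2" using lt \<kappa> by (simp add: field_simps)
    have "0 \<le> dist x y / \<kappa>" using \<kappa> by simp
    then have c: "c > 0" unfolding c_def using lt' by (intro cos_gt_zero_pi) auto
    have lnc: "ln c \<le> 0" using c by (simp add: c_def)
    have ker: "hk_kernel \<kappa> x y = c\<^sup>2"
      unfolding hk_kernel_def c_def using lt' \<kappa> by (subst Cos_eq_cos) auto
    have cost: "HK_cost \<kappa> x y = ennreal (- 2 * ln c)" using lt by (simp add: HK_cost_def c_def)
    have lnf: "ln (f y) = 2 * ln c - ln M"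
      using c kp by (simp add: f_def ker ln_div ln_realpow)
    have "0 \<le> f y * (- 2 * ln c)" using f0[of y] lnc by (simp add: mult_nonneg_nonpos)
    then have "ennreal (f y) * HK_cost \<kappa> x y + entropy_fun (f y)
        = ennreal (f y * (- 2 * ln c) + (f y * ln (f y) - f y + 1))"
      unfolding cost entropy_fun_eq[OF f0]
      using f0[of y] lnc entropy_nonneg[OF f0[of y]]
      by (subst ennreal_plus) (auto simp: ennreal_mult[symmetric])
    also have "f y * (- 2 * ln c) + (f y * ln (f y) - f y + 1) = 1 - f y * ln M - f y"
      by (simp add: lnf algebra_simps)
    finally show ?thesis .
  qed
  have ae: "AE y in \<nu>. M > 0 \<or> hk_kernel \<kappa> x y = 0"
  proof (cases "M > 0")
    case False
    then have "(\<integral>y. hk_kernel \<kappa> x y \<partial>\<nu>) = 0" using M0 M2 by (simp add: kernel_mass_def)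
    then have "AE y in \<nu>. hk_kernel \<kappa> x y = 0"
      by (subst (asm) integral_nonneg_eq_0_iff_AE) (auto simp: integrable_hk_kernel[OF \<nu>] hk_kernel_nonneg)
    then show ?thesis by eventually_elim auto
  qed auto
  \<comment> \<open>This sign is needed to turn the nonnegative integral into a real one. Since k
    \<le> 1, ln f is at most -ln M, so the integrand dominates f ln f - f + 1.\<close>
  have nonneg: "AE y in \<nu>. 0 \<le> 1 - f y * ln M - f y"
    using ae
  proof eventually_elim
    case (elim y)
    show ?case
    proof (cases "f y = 0")
      case False
      then have fp: "f y > 0" and Mp: "M > 0" using f0[of y] elim by (auto simp: f_def less_le)
      then have le: "ln (f y) \<le> - ln M"
        using hk_kernel_le_1[of \<kappa> x y] hk_kernel_nonneg[of \<kappa> x y] by (auto simp: f_def ln_div)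
      have "0 \<le> f y * ln (f y) - f y + 1" by (rule entropy_nonneg[OF f0])
      also have "\<dots> \<le> f y * (- ln M) - f y + 1" using mult_left_mono[OF le, of "f y"] fp by simp
      finally show ?thesis by simp
    qed auto
  qed
  have "(\<integral>\<^sup>+z. HK_cost \<kappa> (fst z) (snd z) \<partial>\<gamma>) + KL \<mu> \<nu>
      = (\<integral>\<^sup>+y. ennreal (f y) * HK_cost \<kappa> x y + entropy_fun (f y) \<partial>\<nu>)"
    unfolding cost KL2 by (rule nn_integral_add[symmetric]) measurable
  also have "\<dots> = (\<integral>\<^sup>+y. ennreal (1 - f y * ln M - f y) \<partial>\<nu>)"
    by (rule nn_integral_cong_AE, rule AE_mp[OF ae], rule AE_I2) (auto intro: pointwise)
  also have "\<dots> = ennreal (\<integral>y. 1 - f y * ln M - f y \<partial>\<nu>)"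
    by (rule nn_integral_eq_integral) (use int_f nonneg in auto)
  also have "(\<integral>y. 1 - f y * ln M - f y \<partial>\<nu>) = measure \<nu> \<Omega> - M * ln M - M"
    using int_f by (simp add: sp\<nu>)
  finally have *: "(\<integral>\<^sup>+z. HK_cost \<kappa> (fst z) (snd z) \<partial>\<gamma>) + KL \<mu> \<nu> = ennreal (measure \<nu> \<Omega> - M * ln M - M)" .
  have "0 \<le> measure \<nu> \<Omega> - M * ln M - M"
  proof -
    have "0 \<le> (\<integral>y. 1 - f y * ln M - f y \<partial>\<nu>)" using nonneg by (rule integral_nonneg_AE)
    also have "\<dots> = measure \<nu> \<Omega> - M * ln M - M" using int_f by (simp add: sp\<nu>)
    finally show ?thesis .
  qed
  \<comment> \<open>The contributions M ln M of the two marginals cancel and leave -2 M.\<close>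
  then have "ennreal (measure \<nu> \<Omega> - M * ln M - M) + ennreal (M * ln M - M + 1) = ennreal (1 + measure \<nu> \<Omega> - 2 * M)"
    using entropy_nonneg[OF M0] by (subst ennreal_plus[symmetric]) auto
  then have "(\<integral>\<^sup>+z. HK_cost \<kappa> (fst z) (snd z) \<partial>\<gamma>)
      + KL (distr \<gamma> (restrict_space borel \<Omega>) fst) (dirac \<Omega> x)
      + KL (distr \<gamma> (restrict_space borel \<Omega>) snd) \<nu> = ennreal (1 + measure \<nu> \<Omega> - 2 * M)"
    unfolding P2 KL1 *[symmetric] by (simp add: ac_simps)
  then show ?thesis
    unfolding HK_sq_def M_def[symmetric] by (intro INF_lower2[OF \<gamma>]) simp
qed

text \<open>With K the kernel mass at x, the lower bound 1 + \<open>measure \<nu> \<Omega>\<close> -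
  K / t - t is largest at t = sqrt K, where it meets the upper bound. For K = 0 no positive t is
  optimal, and the bounds are combined by letting t tend to 0.\<close>

theorem HK_sq_dirac:
  fixes \<nu> :: "'a::{second_countable_topology, metric_space} measure"
  assumes \<nu>: "\<nu> \<in> nonneg_measures \<Omega>" and x: "x \<in> \<Omega>" and \<kappa>: "\<kappa> > 0"
  shows "HK_sq \<Omega> \<kappa> (dirac \<Omega> x) \<nu> = ennreal (1 + measure \<nu> \<Omega> - 2 * sqrt (kernel_mass \<kappa> \<nu> x))"
proof (rule antisym[OF HK_sq_dirac_le[OF assms]])
  let ?k = "kernel_mass \<kappa> \<nu> x"
  show "ennreal (1 + measure \<nu> \<Omega> - 2 * sqrt ?k) \<le> HK_sq \<Omega> \<kappa> (dirac \<Omega> x) \<nu>"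
  proof (cases "?k = 0")
    case False
    then have "?k > 0" using kernel_mass_nonneg[of \<kappa> \<nu> x] by simp
    then have "?k / sqrt ?k = sqrt ?k" "sqrt ?k > 0" by (auto simp: real_div_sqrt)
    with HK_sq_dirac_ge[OF assms, of "sqrt ?k"] show ?thesis by simp
  next
    case True
    have "((\<lambda>t. ennreal (1 + measure \<nu> \<Omega> - t)) \<longlongrightarrow> ennreal (1 + measure \<nu> \<Omega> - 0)) (at_right 0)"
      by (intro tendsto_intros)
    moreover have "eventually (\<lambda>t. ennreal (1 + measure \<nu> \<Omega> - t) \<le> HK_sq \<Omega> \<kappa> (dirac \<Omega> x) \<nu>) (at_right 0)"
      using HK_sq_dirac_ge[OF assms] True by (auto simp: eventually_at_right_less eventually_at_filter)
    ultimately show ?thesis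
      using True tendsto_upperbound by fastforce
  qed
qed

section \<open>First-order optimality\<close>

lemma prob_measures_nonneg: "\<rho> \<in> prob_measures \<Omega> \<Longrightarrow> \<rho> \<in> nonneg_measures \<Omega>"
  by (auto simp: prob_measures_def nonneg_measures_def prob_space_def)

lemma prob_space_of_prob_measures: "\<rho> \<in> prob_measures \<Omega> \<Longrightarrow> prob_space \<rho>"
  by (auto simp: prob_measures_def)

lemma borel_measurable_kernel_mass:
  fixes \<nu> :: "'a::{second_countable_topology, metric_space} measure"
  assumes \<nu>: "\<nu> \<in> nonneg_measures \<Omega>" and [measurable]: "f \<in> borel_measurable M"
  shows "(\<lambda>x. kernel_mass \<kappa> \<nu> (f x)) \<in> borel_measurable M"
proof -
  interpret finite_measure \<nu> by (rule finite_measure_of_nonneg_measures[OF \<nu>])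
  note [measurable] = nonneg_measures_measurable_id[OF \<nu>]
  show ?thesis unfolding kernel_mass_def by measurable
qed

lemma integrable_sqrt_kernel_mass:
  fixes \<nu> :: "'a::{second_countable_topology, metric_space} measure"
  assumes \<nu>: "\<nu> \<in> nonneg_measures \<Omega>" and \<rho>: "\<rho> \<in> nonneg_measures \<Omega>'"
  shows "integrable \<rho> (\<lambda>x. sqrt (kernel_mass \<kappa> \<nu> x))"
proof -
  interpret finite_measure \<rho> by (rule finite_measure_of_nonneg_measures[OF \<rho>])
  note [measurable] = nonneg_measures_measurable_id[OF \<rho>] borel_measurable_kernel_mass[OF \<nu>]
  show ?thesis
    by (rule integrable_const_bound[of _ "sqrt (measure \<nu> \<Omega>)"])
       (auto simp: kernel_mass_nonneg kernel_mass_le[OF \<nu>])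
qed

text \<open>The primal objective without its constant 1, as a real number. Differences of
  objectives, on which all variations rest, make sense only in the reals.\<close>

definition reduced_objective :: "'a::metric_space set \<Rightarrow> 'a measure \<Rightarrow> real \<Rightarrow> 'a measure \<Rightarrow> real" where
  "reduced_objective \<Omega> \<rho> \<kappa> \<nu> = measure \<nu> \<Omega> - 2 * (\<integral>x. sqrt (kernel_mass \<kappa> \<nu> x) \<partial>\<rho>)"

lemma integral_sqrt_kernel_mass_le:
  fixes \<nu> :: "'a::{second_countable_topology, metric_space} measure"
  assumes \<nu>: "\<nu> \<in> nonneg_measures \<Omega>" and \<rho>: "\<rho> \<in> prob_measures \<Omega>"
  shows "(\<integral>x. sqrt (kernel_mass \<kappa> \<nu> x) \<partial>\<rho>) \<le> sqrt (measure \<nu> \<Omega>)"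
proof -
  interpret prob_space \<rho> by (rule prob_space_of_prob_measures[OF \<rho>])
  show ?thesis
    using integrable_sqrt_kernel_mass[OF \<nu> prob_measures_nonneg[OF \<rho>]]
    by (intro integral_le_const) (auto simp: kernel_mass_le[OF \<nu>])
qed

text \<open>The extremal case s = sqrt a is the square (sqrt a - 1)^2. It guarantees that
  \<open>ennreal\<close> truncates nothing, both pointwise with a root of the kernel mass and after
  integration over \<rho>.\<close>

lemma one_plus_sub_sqrt_nonneg: "0 \<le> a \<Longrightarrow> s \<le> sqrt a \<Longrightarrow> 0 \<le> 1 + a - 2 * s"
  using zero_le_power2[of "sqrt a - 1"] by (simp add: power2_diff)

lemma primal_objective_eq:
  fixes \<nu> :: "'a::{second_countable_topology, metric_space} measure"
  assumes \<nu>: "\<nu> \<in> nonneg_measures \<Omega>" and \<rho>: "\<rho> \<in> prob_measures \<Omega>" and \<kappa>: "\<kappa> > 0"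
  shows "primal_objective \<Omega> \<rho> \<kappa> \<nu> = ennreal (1 + reduced_objective \<Omega> \<rho> \<kappa> \<nu>)"
proof -
  interpret prob_space \<rho> by (rule prob_space_of_prob_measures[OF \<rho>])
  note int = integrable_sqrt_kernel_mass[OF \<nu> prob_measures_nonneg[OF \<rho>], of \<kappa>]
  have "primal_objective \<Omega> \<rho> \<kappa> \<nu> = (\<integral>\<^sup>+x. ennreal (1 + measure \<nu> \<Omega> - 2 * sqrt (kernel_mass \<kappa> \<nu> x)) \<partial>\<rho>)"
    unfolding primal_objective_def
    by (rule nn_integral_cong) (simp add: HK_sq_dirac[OF \<nu> _ \<kappa>] space_eq_of_nonneg_measures[OF prob_measures_nonneg[OF \<rho>]])
  also have "\<dots> = ennreal (\<integral>x. 1 + measure \<nu> \<Omega> - 2 * sqrt (kernel_mass \<kappa> \<nu> x) \<partial>\<rho>)"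
    using int one_plus_sub_sqrt_nonneg[OF measure_nonneg real_sqrt_le_mono[OF kernel_mass_le[OF \<nu>]]]
    by (intro nn_integral_eq_integral) auto
  also have "(\<integral>x. 1 + measure \<nu> \<Omega> - 2 * sqrt (kernel_mass \<kappa> \<nu> x) \<partial>\<rho>) = 1 + reduced_objective \<Omega> \<rho> \<kappa> \<nu>"
    using int by (simp add: reduced_objective_def prob_space)
  finally show ?thesis .
qed

lemma primal_minimizer_reduced_le:
  fixes \<nu> :: "'a::{second_countable_topology, metric_space} measure"
  assumes min: "primal_minimizer \<Omega> \<rho> \<kappa> \<nu>" and \<rho>: "\<rho> \<in> prob_measures \<Omega>" and \<kappa>: "\<kappa> > 0"
    and \<nu>': "\<nu>' \<in> nonneg_measures \<Omega>"
  shows "reduced_objective \<Omega> \<rho> \<kappa> \<nu> \<le> reduced_objective \<Omega> \<rho> \<kappa> \<nu>'"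
proof -
  have \<nu>: "\<nu> \<in> nonneg_measures \<Omega>" using min by (simp add: primal_minimizer_def)
  \<comment> \<open>\<open>ennreal\<close> cuts off negative numbers, so the right side must be
    nonnegative before the inequality can be pulled back to the reals.\<close>
  have "0 \<le> 1 + reduced_objective \<Omega> \<rho> \<kappa> \<nu>'"
    using one_plus_sub_sqrt_nonneg[OF _ integral_sqrt_kernel_mass_le[OF \<nu>' \<rho>, of \<kappa>]]
    by (simp add: reduced_objective_def algebra_simps)
  moreover have "primal_objective \<Omega> \<rho> \<kappa> \<nu> \<le> primal_objective \<Omega> \<rho> \<kappa> \<nu>'"
    using min \<nu>' by (simp add: primal_minimizer_def)
  ultimately show ?thesis
    by (simp add: primal_objective_eq[OF \<nu> \<rho> \<kappa>] primal_objective_eq[OF \<nu>' \<rho> \<kappa>] ennreal_le_iff)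
qed

section \<open>Variations of a minimiser: scaling it and adding point masses\<close>

lemma integral_scale_measure:
  fixes f :: "'a \<Rightarrow> real"
  assumes "0 \<le> c" "f \<in> borel_measurable M"
  shows "integral\<^sup>L (scale_measure (ennreal c) M) f = c * integral\<^sup>L M f"
proof -
  have "scale_measure (ennreal c) M = density M (\<lambda>_. ennreal c)"
    by (rule measure_eqI) (auto simp: emeasure_density nn_integral_cmult_indicator)
  then show ?thesis using assms by (simp add: integral_density)
qed

text \<open>Carried by the \<sigma>-algebra of M, hence a genuine sum under
  \<open>sets N = sets M\<close>, which the lemmas on its values assume. It serves to perturb \<nu>
  by a point mass.\<close>

definition sum_of_measures :: "'a measure \<Rightarrow> 'a measure \<Rightarrow> 'a measure" where
  "sum_of_measures M N = measure_of (space M) (sets M) (\<lambda>A. emeasure M A + emeasure N A)"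

lemma sets_sum_of_measures [simp, measurable_cong]: "sets (sum_of_measures M N) = sets M"
  by (simp add: sum_of_measures_def)

lemma space_sum_of_measures: "space (sum_of_measures M N) = space M"
  by (simp add: sum_of_measures_def)

lemma emeasure_sum_of_measures:
  assumes N: "sets N = sets M"
  shows "emeasure (sum_of_measures M N) A = emeasure M A + emeasure N A"
proof (cases "A \<in> sets M")
  case True
  show ?thesis unfolding sum_of_measures_def
  proof (rule emeasure_measure_of_sigma)
    show "sigma_algebra (space M) (sets M)" ..
    show "positive (sets M) (\<lambda>A. emeasure M A + emeasure N A)" by (simp add: positive_def)
    show "countably_additive (sets M) (\<lambda>A. emeasure M A + emeasure N A)"
      by (rule countably_additiveI) (simp add: N suminf_add[symmetric] suminf_emeasure)
  qed (fact True)
qed (simp add: emeasure_notin_sets N)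

lemma nn_integral_sum_of_measures:
  assumes N: "sets N = sets M" and f: "f \<in> borel_measurable M"
  shows "(\<integral>\<^sup>+x. f x \<partial>sum_of_measures M N) = (\<integral>\<^sup>+x. f x \<partial>M) + (\<integral>\<^sup>+x. f x \<partial>N)"
  using f
proof induction
  case (cong f g)
  then show ?case
    by (simp add: cong.hyps space_sum_of_measures sets_eq_imp_space_eq[OF N] cong: nn_integral_cong_simp)
next
  case (set A)
  then show ?case by (simp add: N emeasure_sum_of_measures[OF N])
next
  case (mult f c)
  then show ?case by (simp add: nn_integral_cmult distrib_left measurable_cong_sets[OF N refl])
next
  case (add f g)
  then show ?case by (simp add: nn_integral_add ac_simps measurable_cong_sets[OF N refl])
next
  case (seq U)
  have "(\<lambda>i. (\<integral>\<^sup>+x. U i x \<partial>M) + (\<integral>\<^sup>+x. U i x \<partial>N)) = (\<lambda>i. \<integral>\<^sup>+x. U i x \<partial>sum_of_measures M N)"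
    using seq by auto
  moreover have "(SUP i. (\<integral>\<^sup>+x. U i x \<partial>M) + (\<integral>\<^sup>+x. U i x \<partial>N))
      = (SUP i. \<integral>\<^sup>+x. U i x \<partial>M) + (SUP i. \<integral>\<^sup>+x. U i x \<partial>N)"
    using seq by (intro ennreal_SUP_add) (auto simp: incseq_def le_fun_def intro!: nn_integral_mono)
  ultimately show ?case
    using seq by (simp add: nn_integral_monotone_convergence_SUP image_comp measurable_cong_sets[OF N refl])
qed

lemma add_dirac:
  fixes \<nu> :: "'a::{second_countable_topology, metric_space} measure"
  assumes \<nu>: "\<nu> \<in> nonneg_measures \<Omega>" and y: "y \<in> \<Omega>" and t: "0 \<le> t"
  defines "\<nu>' \<equiv> sum_of_measures \<nu> (scale_measure (ennreal t) (dirac \<Omega> y))"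
  shows "\<nu>' \<in> nonneg_measures \<Omega>" "measure \<nu>' \<Omega> = measure \<nu> \<Omega> + t"
    "kernel_mass \<kappa> \<nu>' x = kernel_mass \<kappa> \<nu> x + t * hk_kernel \<kappa> x y"
proof -
  interpret N: finite_measure \<nu> by (rule finite_measure_of_nonneg_measures[OF \<nu>])
  note sp\<nu> = space_eq_of_nonneg_measures[OF \<nu>]
  have se: "sets (scale_measure (ennreal t) (dirac \<Omega> y)) = sets \<nu>"
    by (simp add: dirac_def sets_of_nonneg_measures[OF \<nu>])
  have \<Omega>s: "\<Omega> \<in> sets (restrict_space borel \<Omega>)"
    using sets.top[of \<nu>] sets_of_nonneg_measures[OF \<nu>] sp\<nu> by simp
  have em: "emeasure \<nu>' \<Omega> = ennreal (measure \<nu> \<Omega> + t)"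
    unfolding \<nu>'_def emeasure_sum_of_measures[OF se]
    using y t \<Omega>s by (simp add: dirac_def N.emeasure_eq_measure)
  show \<nu>': "\<nu>' \<in> nonneg_measures \<Omega>"
    unfolding nonneg_measures_def
    by (auto intro!: finite_measureI simp: \<nu>'_def space_sum_of_measures sp\<nu> sets_of_nonneg_measures[OF \<nu>] em[unfolded \<nu>'_def])
  show "measure \<nu>' \<Omega> = measure \<nu> \<Omega> + t"
    using em t by (intro measure_eq_emeasure_eq_ennreal) auto
  note [measurable] = nonneg_measures_measurable_id[OF \<nu>]
  have ys: "y \<in> space (restrict_space borel \<Omega>)" using y by (simp add: space_restrict_space)
  have [measurable]: "(\<lambda>y. y) \<in> borel_measurable (restrict_space borel \<Omega>)"
    by (auto intro: measurable_restrict_space1)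
  have "ennreal (kernel_mass \<kappa> \<nu>' x) = (\<integral>\<^sup>+z. ennreal (hk_kernel \<kappa> x z) \<partial>\<nu>')"
    by (rule nn_integral_hk_kernel[OF \<nu>', symmetric])
  also have "\<dots> = (\<integral>\<^sup>+z. ennreal (hk_kernel \<kappa> x z) \<partial>\<nu>) + (\<integral>\<^sup>+z. ennreal (hk_kernel \<kappa> x z) \<partial>scale_measure (ennreal t) (dirac \<Omega> y))"
    unfolding \<nu>'_def by (rule nn_integral_sum_of_measures[OF se]) measurable
  also have "(\<integral>\<^sup>+z. ennreal (hk_kernel \<kappa> x z) \<partial>scale_measure (ennreal t) (dirac \<Omega> y)) = ennreal t * ennreal (hk_kernel \<kappa> x y)"
    unfolding dirac_def by (subst nn_integral_scale_measure) (auto simp: nn_integral_return[OF ys])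
  also have "(\<integral>\<^sup>+z. ennreal (hk_kernel \<kappa> x z) \<partial>\<nu>) = ennreal (kernel_mass \<kappa> \<nu> x)"
    by (rule nn_integral_hk_kernel[OF \<nu>])
  finally show "kernel_mass \<kappa> \<nu>' x = kernel_mass \<kappa> \<nu> x + t * hk_kernel \<kappa> x y"
    using t hk_kernel_nonneg[of \<kappa> x y] kernel_mass_nonneg[of \<kappa> \<nu> x] kernel_mass_nonneg[of \<kappa> \<nu>' x]
    by (simp add: ennreal_inj flip: ennreal_mult ennreal_plus)
qed

text \<open>Along the ray s \<nu> the reduced objective is s N - 2 sqrt(s) A, a parabola in sqrt s
  with vertex at A / N and minimal value -A^2 / N. Since \<nu> itself, at s = 1, cannot exceed this
  value, (N - A)^2 \<le> 0.\<close>

lemma minimizer_mass: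
  fixes \<nu> :: "'a::{second_countable_topology, metric_space} measure"
  assumes min: "primal_minimizer \<Omega> \<rho> \<kappa> \<nu>" and \<rho>: "\<rho> \<in> prob_measures \<Omega>" and \<kappa>: "\<kappa> > 0"
  shows "(\<integral>x. sqrt (kernel_mass \<kappa> \<nu> x) \<partial>\<rho>) = measure \<nu> \<Omega>"
proof -
  define N where "N = measure \<nu> \<Omega>"
  define A where "A = (\<integral>x. sqrt (kernel_mass \<kappa> \<nu> x) \<partial>\<rho>)"
  have \<nu>: "\<nu> \<in> nonneg_measures \<Omega>" using min by (simp add: primal_minimizer_def)
  interpret finite_measure \<nu> by (rule finite_measure_of_nonneg_measures[OF \<nu>])
  have A0: "0 \<le> A" unfolding A_def by (rule integral_nonneg_AE) (simp add: kernel_mass_nonneg)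
  have AN: "A \<le> sqrt N" unfolding A_def N_def by (rule integral_sqrt_kernel_mass_le[OF \<nu> \<rho>])
  have N0: "0 \<le> N" by (simp add: N_def)
  show ?thesis
  proof (cases "N = 0")
    case True
    then show ?thesis using A0 AN by (simp add: A_def N_def)
  next
    case False
    then have N: "N > 0" using N0 by simp
    define t where "t = (A / N)\<^sup>2"
    let ?\<nu>' = "scale_measure (ennreal t) \<nu>"
    have t0: "0 \<le> t" by (simp add: t_def)
    have \<nu>': "?\<nu>' \<in> nonneg_measures \<Omega>"
      using sets_of_nonneg_measures[OF \<nu>]
      by (auto simp: nonneg_measures_def space_scale_measure ennreal_mult_eq_top_iff intro!: finite_measureI)
    have km: "kernel_mass \<kappa> ?\<nu>' x = t * kernel_mass \<kappa> \<nu> x" for x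
      unfolding kernel_mass_def using integrable_hk_kernel[OF \<nu>]
      by (intro integral_scale_measure) (auto simp: t0)
    have "sqrt t = A / N" using A0 N by (simp add: t_def)
    then have "(\<integral>x. sqrt (kernel_mass \<kappa> ?\<nu>' x) \<partial>\<rho>) = (A / N) * A"
      by (simp only: km real_sqrt_mult A_def integral_mult_right_zero)
    moreover have "measure ?\<nu>' \<Omega> = t * N" using t0 by (simp add: N_def)
    ultimately have "reduced_objective \<Omega> \<rho> \<kappa> ?\<nu>' = t * N - 2 * ((A / N) * A)"
      by (simp only: reduced_objective_def)
    also have "\<dots> = - (A\<^sup>2 / N)" using N by (simp add: t_def field_simps power2_eq_square)
    finally have "N - 2 * A \<le> - (A\<^sup>2 / N)"
      using primal_minimizer_reduced_le[OF min \<rho> \<kappa> \<nu>'] by (simp add: reduced_objective_def N_def A_def)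
    then have "N * (N - 2 * A) \<le> N * (- (A\<^sup>2 / N))" using N by (intro mult_left_mono) auto
    then have "(N - A)\<^sup>2 \<le> 0" using N by (simp add: power2_diff power2_eq_square algebra_simps)
    then show ?thesis by (simp add: A_def N_def)
  qed
qed

lemma integrable_kernel_quotient:
  fixes \<rho> :: "'a::{second_countable_topology, metric_space} measure"
  assumes \<rho>: "\<rho> \<in> nonneg_measures \<Omega>" and c: "c > 0" and [measurable]: "u \<in> borel_measurable \<rho>"
    and u: "\<And>x. x \<in> \<Omega> \<Longrightarrow> c \<le> u x"
  shows "integrable \<rho> (\<lambda>x. hk_kernel \<kappa> x y / u x)"
proof -
  interpret finite_measure \<rho> by (rule finite_measure_of_nonneg_measures[OF \<rho>])
  note [measurable] = nonneg_measures_measurable_id[OF \<rho>]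
  have "hk_kernel \<kappa> x y / u x \<le> 1 / c" if "x \<in> \<Omega>" for x
    using u[OF that] c by (intro frac_le) (auto simp: hk_kernel_le_1)
  moreover have "0 \<le> hk_kernel \<kappa> x y / u x" if "x \<in> \<Omega>" for x
    using u[OF that] c by (simp add: hk_kernel_nonneg)
  ultimately have "norm (hk_kernel \<kappa> x y / u x) \<le> 1 / c" if "x \<in> \<Omega>" for x
    using that by (simp only: real_norm_def abs_of_nonneg)
  then show ?thesis
    by (intro integrable_const_bound[of _ "1 / c"] AE_I2)
       (simp_all add: space_eq_of_nonneg_measures[OF \<rho>])
qed

text \<open>Formally this is the derivative of the objective in the direction of a point mass at y,
  with k / m in the integrand; as m may vanish, a finite step is taken instead. Adding mass t =
  (2\<epsilon>)^2 raises m to m' \<le> m + 2\<epsilon>, because k \<le> 1. Then m' + m \<le> 2 (m +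
  \<epsilon>), and (m' - m) (m' + m) = t k gives m' - m \<ge> (t / 2) k / (m + \<epsilon>).
  Minimality bounds the integral of m' - m by t / 2.\<close>

lemma minimizer_dual_constraint:
  fixes \<nu> :: "'a::{second_countable_topology, metric_space} measure"
  assumes min: "primal_minimizer \<Omega> \<rho> \<kappa> \<nu>" and \<rho>: "\<rho> \<in> prob_measures \<Omega>" and \<kappa>: "\<kappa> > 0"
    and y: "y \<in> \<Omega>" and \<epsilon>: "\<epsilon> > 0"
  shows "(\<integral>x. hk_kernel \<kappa> x y / (sqrt (kernel_mass \<kappa> \<nu> x) + \<epsilon>) \<partial>\<rho>) \<le> 1"
proof -
  define t where "t = (2 * \<epsilon>)\<^sup>2"
  have t: "t > 0" "sqrt t = 2 * \<epsilon>" using \<epsilon> by (simp_all only: t_def real_sqrt_abs) simp_all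
  have \<nu>: "\<nu> \<in> nonneg_measures \<Omega>" using min by (simp add: primal_minimizer_def)
  note \<rho>' = prob_measures_nonneg[OF \<rho>]
  note [measurable] = nonneg_measures_measurable_id[OF \<rho>'] borel_measurable_kernel_mass[OF \<nu>]
  define \<nu>' where "\<nu>' = sum_of_measures \<nu> (scale_measure (ennreal t) (dirac \<Omega> y))"
  note ad = add_dirac[OF \<nu> y, of t, folded \<nu>'_def]
  define m where "m x = sqrt (kernel_mass \<kappa> \<nu> x)" for x
  define m' where "m' x = sqrt (kernel_mass \<kappa> \<nu>' x)" for x
  have m0: "0 \<le> m x" for x by (simp add: m_def kernel_mass_nonneg)
  have int_m: "integrable \<rho> m" "integrable \<rho> m'"
    using integrable_sqrt_kernel_mass[OF _ \<rho>'] \<nu> ad(1) t by (auto simp: m_def[abs_def] m'_def[abs_def])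
  have "(\<integral>x. m' x \<partial>\<rho>) - (\<integral>x. m x \<partial>\<rho>) \<le> t / 2"
    using primal_minimizer_reduced_le[OF min \<rho> \<kappa> ad(1)] t ad(2)
    by (simp add: reduced_objective_def m_def m'_def)
  then have *: "(\<integral>x. m' x - m x \<partial>\<rho>) \<le> t / 2" using int_m by simp
  have pw: "t / 2 * (hk_kernel \<kappa> x y / (m x + \<epsilon>)) \<le> m' x - m x" for x
  proof -
    let ?k = "hk_kernel \<kappa> x y"
    have k: "0 \<le> ?k" "?k \<le> 1" by (auto simp: hk_kernel_nonneg hk_kernel_le_1)
    have sq: "(m x)\<^sup>2 = kernel_mass \<kappa> \<nu> x" "(m' x)\<^sup>2 = kernel_mass \<kappa> \<nu> x + t * ?k"
      using kernel_mass_nonneg[of \<kappa> \<nu> x] kernel_mass_nonneg[of \<kappa> \<nu>' x] t(1) ad(3)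
      by (simp_all add: m_def m'_def)
    have m'0: "0 \<le> m' x" by (simp add: m'_def kernel_mass_nonneg)
    have "(m' x)\<^sup>2 \<le> (m x + 2 * \<epsilon>)\<^sup>2"
    proof -
      have "t * ?k \<le> t" using t(1) k by simp
      moreover have "0 \<le> 4 * m x * \<epsilon>" using m0 \<epsilon> by simp
      moreover have "(m x + 2 * \<epsilon>)\<^sup>2 = (m x)\<^sup>2 + 4 * m x * \<epsilon> + t"
        by (simp add: t_def power2_eq_square algebra_simps)
      ultimately show ?thesis unfolding sq(2) sq(1)[symmetric] by linarith
    qed
    then have up: "m' x \<le> m x + 2 * \<epsilon>" by (rule power2_le_imp_le) (use m0[of x] \<epsilon> in linarith)
    have pos: "0 < 2 * (m x + \<epsilon>)" using m0[of x] \<epsilon> by simp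
    have diff: "(m' x - m x) * (m' x + m x) = t * ?k"
    proof -
      have "(m' x - m x) * (m' x + m x) = (m' x)\<^sup>2 - (m x)\<^sup>2"
        by (simp add: power2_eq_square algebra_simps)
      then show ?thesis unfolding sq by linarith
    qed
    have ge: "0 \<le> m' x - m x"
      using t(1) k by (simp add: m_def m'_def ad(3))
    have "m' x + m x \<le> 2 * (m x + \<epsilon>)" using up by (simp add: distrib_left)
    with ge have "t * ?k \<le> (m' x - m x) * (2 * (m x + \<epsilon>))"
      unfolding diff[symmetric] by (intro mult_left_mono)
    then have "t * ?k / (2 * (m x + \<epsilon>)) \<le> m' x - m x" by (simp only: pos_divide_le_eq[OF pos])
    then show ?thesis by (simp only: times_divide_times_eq)
  qed
  have int_q: "integrable \<rho> (\<lambda>x. hk_kernel \<kappa> x y / (m x + \<epsilon>))"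
  proof (rule integrable_kernel_quotient[OF \<rho>' \<epsilon>])
    show "(\<lambda>x. m x + \<epsilon>) \<in> borel_measurable \<rho>"
      using borel_measurable_integrable[OF int_m(1)] by (rule borel_measurable_add) simp
    show "\<epsilon> \<le> m x + \<epsilon>" for x using m0[of x] by simp
  qed
  have "t / 2 * (\<integral>x. hk_kernel \<kappa> x y / (m x + \<epsilon>) \<partial>\<rho>) = (\<integral>x. t / 2 * (hk_kernel \<kappa> x y / (m x + \<epsilon>)) \<partial>\<rho>)"
    by (rule integral_mult_right_zero[symmetric])
  also have "\<dots> \<le> (\<integral>x. m' x - m x \<partial>\<rho>)"
    using int_m by (intro integral_mono pw integrable_mult_right int_q) auto
  also have "\<dots> \<le> t / 2" by (rule *)
  finally have "t / 2 * (\<integral>x. hk_kernel \<kappa> x y / (m x + \<epsilon>) \<partial>\<rho>) \<le> t / 2 * 1" by simp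
  then have "(\<integral>x. hk_kernel \<kappa> x y / (m x + \<epsilon>) \<partial>\<rho>) \<le> 1"
    using t(1) by (subst (asm) mult_le_cancel_left_pos) auto
  then show ?thesis by (simp add: m_def)
qed

section \<open>Strong duality\<close>

text \<open>Dominated convergence with the constant bound 1, integrable because \<nu> is finite.
  Continuity of m makes it usable in dual functions and allows comparison with \<psi> at every point
  of the support.\<close>

lemma continuous_on_kernel_mass:
  fixes \<nu> :: "'a::{second_countable_topology, metric_space} measure"
  assumes \<nu>: "\<nu> \<in> nonneg_measures \<Omega>"
  shows "continuous_on A (kernel_mass \<kappa> \<nu>)"
  unfolding continuous_on_sequentially o_def
proof (intro allI ballI impI, elim conjE)
  interpret finite_measure \<nu> by (rule finite_measure_of_nonneg_measures[OF \<nu>])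
  note [measurable] = nonneg_measures_measurable_id[OF \<nu>]
  fix X :: "nat \<Rightarrow> 'a" and x assume X: "X \<longlonglongrightarrow> x"
  show "(\<lambda>n. kernel_mass \<kappa> \<nu> (X n)) \<longlonglongrightarrow> kernel_mass \<kappa> \<nu> x"
    unfolding kernel_mass_def
  proof (rule integral_dominated_convergence[where w="\<lambda>_. 1"])
    show "AE y in \<nu>. (\<lambda>n. hk_kernel \<kappa> (X n) y) \<longlonglongrightarrow> hk_kernel \<kappa> x y"
    proof (rule AE_I2)
      fix y :: 'a
      have "continuous_on UNIV (\<lambda>x. hk_kernel \<kappa> x y)" by (intro continuous_intros)
      then show "(\<lambda>n. hk_kernel \<kappa> (X n) y) \<longlonglongrightarrow> hk_kernel \<kappa> x y"
        by (rule continuous_on_tendsto_compose[OF _ X]) auto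
    qed
  qed (auto simp: hk_kernel_nonneg hk_kernel_le_1)
qed

lemma measurable_continuous_on_nonneg_measures:
  assumes "\<nu> \<in> nonneg_measures \<Omega>" "continuous_on \<Omega> f"
  shows "f \<in> borel_measurable \<nu>"
  using borel_measurable_continuous_on_restrict[OF assms(2)]
  by (simp add: measurable_cong_sets[OF sets_of_nonneg_measures[OF assms(1)] refl])

lemma integrable_continuous_on_nonneg_measures:
  fixes f :: "'a::topological_space \<Rightarrow> real"
  assumes \<nu>: "\<nu> \<in> nonneg_measures \<Omega>" and f: "continuous_on \<Omega> f" and \<Omega>: "compact \<Omega>"
  shows "integrable \<nu> f"
proof -
  interpret finite_measure \<nu> by (rule finite_measure_of_nonneg_measures[OF \<nu>])
  obtain B where "\<And>x. x \<in> \<Omega> \<Longrightarrow> norm (f x) \<le> B"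
    using compact_imp_bounded[OF compact_continuous_image[OF f \<Omega>]] unfolding bounded_iff by auto
  then show ?thesis
    by (intro integrable_const_bound[of _ B] measurable_continuous_on_nonneg_measures[OF \<nu> f])
       (auto simp: space_eq_of_nonneg_measures[OF \<nu>])
qed

text \<open>The positive \<epsilon> keeps the bound by 1 strict even at points where m vanishes
  because \<nu> puts no mass within reach of the kernel.\<close>

lemma dual_feasible_of_minimizer:
  fixes \<nu> :: "'a::{second_countable_topology, metric_space} measure"
  assumes min: "primal_minimizer \<Omega> \<rho> \<kappa> \<nu>" and \<rho>: "\<rho> \<in> prob_measures \<Omega>" and \<kappa>: "\<kappa> > 0"
    and \<epsilon>: "\<epsilon> > 0"
  shows "dual_feasible \<Omega> \<rho> \<kappa> (\<lambda>x. 1 - (sqrt (kernel_mass \<kappa> \<nu> x) + \<epsilon>))"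
proof -
  have \<nu>: "\<nu> \<in> nonneg_measures \<Omega>" using min by (simp add: primal_minimizer_def)
  have "- sqrt (kernel_mass \<kappa> \<nu> x) < \<epsilon>" for x
    using \<epsilon> kernel_mass_nonneg[of \<kappa> \<nu> x] real_sqrt_ge_zero[of "kernel_mass \<kappa> \<nu> x"] by linarith
  then show ?thesis
    unfolding dual_feasible_def
    using minimizer_dual_constraint[OF min \<rho> \<kappa> _ \<epsilon>]
    by (auto intro!: continuous_intros continuous_on_kernel_mass[OF \<nu>] simp: hk_kernel_def)
qed

text \<open>Write u = 1 - \<psi> and N for the mass of \<nu>. Three facts meet: m integrates to N by
  scaling, u integrates to at most N by maximality of \<psi>, and m^2 / u integrates to at most N by
  feasibility of \<psi>. Since (u - m)^2 / u = u - 2 m + m^2 / u, its integral is at most N - 2 N +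
  N = 0.\<close>

lemma optimal_pair_AE:
  fixes \<nu> :: "'a::{second_countable_topology, metric_space} measure"
  assumes opt: "optimal_pair \<Omega> \<rho> \<kappa> \<nu> \<psi>" and \<rho>: "\<rho> \<in> prob_measures \<Omega>" and \<kappa>: "\<kappa> > 0"
    and \<Omega>: "compact \<Omega>"
  shows "AE x in \<rho>. 1 - \<psi> x = sqrt (kernel_mass \<kappa> \<nu> x)"
proof -
  define m where "m x = sqrt (kernel_mass \<kappa> \<nu> x)" for x
  define u where "u x = 1 - \<psi> x" for x
  define N where "N = measure \<nu> \<Omega>"
  have min: "primal_minimizer \<Omega> \<rho> \<kappa> \<nu>" and feas: "dual_feasible \<Omega> \<rho> \<kappa> \<psi>"
    using opt by (auto simp: optimal_pair_def dual_maximizer_def)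
  have \<nu>: "\<nu> \<in> nonneg_measures \<Omega>" using min by (simp add: primal_minimizer_def)
  note \<rho>' = prob_measures_nonneg[OF \<rho>]
  interpret R: prob_space \<rho> by (rule prob_space_of_prob_measures[OF \<rho>])
  interpret N: finite_measure \<nu> by (rule finite_measure_of_nonneg_measures[OF \<nu>])
  interpret pair_sigma_finite \<nu> \<rho> ..
  have sp\<rho>: "space \<rho> = \<Omega>" and sp\<nu>: "space \<nu> = \<Omega>"
    using space_eq_of_nonneg_measures \<rho>' \<nu> by auto
  have ne: "\<Omega> \<noteq> {}" using R.not_empty sp\<rho> by simp
  have c\<psi>: "continuous_on \<Omega> \<psi>" and cu: "continuous_on \<Omega> u"
    using feas by (auto simp: dual_feasible_def u_def[abs_def] intro!: continuous_intros)
  \<comment> \<open>By compactness u has a positive lower bound, so all quotients are bounded and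
    Fubini applies on a finite product measure.\<close>
  obtain x0 where x0: "x0 \<in> \<Omega>" "\<And>x. x \<in> \<Omega> \<Longrightarrow> u x0 \<le> u x"
    using continuous_attains_inf[OF \<Omega> ne cu] by auto
  define c where "c = u x0"
  have c: "c > 0" "\<And>x. x \<in> \<Omega> \<Longrightarrow> c \<le> u x"
    using x0 feas by (auto simp: c_def u_def dual_feasible_def)
  have int_u: "integrable \<rho> u" and int_\<psi>: "integrable \<rho> \<psi>"
    using integrable_continuous_on_nonneg_measures[OF \<rho>' _ \<Omega>] cu c\<psi> by auto
  have int_m: "integrable \<rho> m"
    unfolding m_def[abs_def] by (rule integrable_sqrt_kernel_mass[OF \<nu> \<rho>'])
  note [measurable] = nonneg_measures_measurable_id[OF \<nu>] nonneg_measures_measurable_id[OF \<rho>']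
    borel_measurable_integrable[OF int_u] borel_measurable_integrable[OF int_m]
  have mass: "(\<integral>x. m x \<partial>\<rho>) = N" unfolding m_def N_def by (rule minimizer_mass[OF min \<rho> \<kappa>])
  \<comment> \<open>Maximality of \<psi> is tested against the feasible functions 1 - (m +
    \<epsilon>); at the level of integrals \<epsilon> can be removed.\<close>
  have u_le: "(\<integral>x. u x \<partial>\<rho>) \<le> N"
  proof (rule field_le_epsilon)
    fix \<epsilon> :: real assume \<epsilon>: "\<epsilon> > 0"
    have "(\<integral>x. 1 - (m x + \<epsilon>) \<partial>\<rho>) \<le> (\<integral>x. \<psi> x \<partial>\<rho>)"
      using opt dual_feasible_of_minimizer[OF min \<rho> \<kappa> \<epsilon>]
      by (simp add: optimal_pair_def dual_maximizer_def m_def)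
    moreover have "(\<integral>x. 1 - (m x + \<epsilon>) \<partial>\<rho>) = 1 - (N + \<epsilon>)"
      using int_m by (simp add: mass R.prob_space)
    moreover have "(\<integral>x. u x \<partial>\<rho>) = 1 - (\<integral>x. \<psi> x \<partial>\<rho>)"
      using int_\<psi> by (simp add: u_def R.prob_space)
    ultimately show "(\<integral>x. u x \<partial>\<rho>) \<le> N + \<epsilon>" by simp
  qed
  let ?f = "\<lambda>y x. hk_kernel \<kappa> x y / u x"
  have f_bound: "norm (?f y x) \<le> 1 / c" if "x \<in> \<Omega>" for x y
  proof -
    have "?f y x \<le> 1 / c" using c that by (intro frac_le) (auto simp: hk_kernel_le_1)
    moreover have "0 \<le> ?f y x" using c(1) c(2)[OF that] by (simp add: hk_kernel_nonneg)
    ultimately show ?thesis by (simp only: real_norm_def abs_of_nonneg)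
  qed
  have int_f: "integrable (\<nu> \<Otimes>\<^sub>M \<rho>) (case_prod ?f)"
  proof (rule finite_measure.integrable_const_bound[of _ _ "1 / c"])
    show "finite_measure (\<nu> \<Otimes>\<^sub>M \<rho>)"
      by (rule finite_measure_pair_measure) (rule R.finite_measure_axioms N.finite_measure_axioms)+
    show "AE p in \<nu> \<Otimes>\<^sub>M \<rho>. norm (case_prod ?f p) \<le> 1 / c"
      by (rule AE_I2) (use f_bound in \<open>auto simp: space_pair_measure sp\<nu> sp\<rho>\<close>)
  qed measurable
  have m2: "(m x)\<^sup>2 = kernel_mass \<kappa> \<nu> x" for x
    by (simp add: m_def kernel_mass_nonneg)
  have inner: "(\<integral>y. ?f y x \<partial>\<nu>) = (m x)\<^sup>2 / u x" for x
    unfolding m2 kernel_mass_def by (rule integral_divide_zero)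
  have "(\<integral>x. (m x)\<^sup>2 / u x \<partial>\<rho>) = (\<integral>x. (\<integral>y. ?f y x \<partial>\<nu>) \<partial>\<rho>)" by (simp only: inner)
  also have "\<dots> = (\<integral>y. (\<integral>x. ?f y x \<partial>\<rho>) \<partial>\<nu>)" by (rule Fubini_integral[OF int_f])
  \<comment> \<open>The dual constraint at y, integrated against \<nu>.\<close>
  also have "\<dots> \<le> (\<integral>y. 1 \<partial>\<nu>)"
  proof (rule integral_mono_AE)
    show "integrable \<nu> (\<lambda>y. \<integral>x. ?f y x \<partial>\<rho>)"
      using integrable_fst[OF int_f] .
    show "AE y in \<nu>. (\<integral>x. ?f y x \<partial>\<rho>) \<le> 1"
      using feas by (intro AE_I2) (auto simp: sp\<nu> dual_feasible_def u_def hk_kernel_def)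
  qed simp
  also have "\<dots> = N" by (simp add: N_def sp\<nu>)
  finally have quot: "(\<integral>x. (m x)\<^sup>2 / u x \<partial>\<rho>) \<le> N" .
  have int_q: "integrable \<rho> (\<lambda>x. (m x)\<^sup>2 / u x)"
    using integrable_snd[OF int_f] by (simp only: inner)
  have pw: "u x - 2 * m x + (m x)\<^sup>2 / u x = (u x - m x)\<^sup>2 / u x" if "x \<in> \<Omega>" for x
    using c(1) c(2)[OF that] by (simp add: field_simps power2_eq_square)
  have int_s: "integrable \<rho> (\<lambda>x. (u x - m x)\<^sup>2 / u x)"
  proof (subst Bochner_Integration.integrable_cong[OF refl])
    show "integrable \<rho> (\<lambda>x. u x - 2 * m x + (m x)\<^sup>2 / u x)"
      using int_u int_m int_q by auto
  qed (simp add: pw sp\<rho>)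
  have s0: "AE x in \<rho>. 0 \<le> (u x - m x)\<^sup>2 / u x"
    using c by (intro AE_I2) (force simp: sp\<rho> intro!: divide_nonneg_nonneg)
  have "(\<integral>x. (u x - m x)\<^sup>2 / u x \<partial>\<rho>) = (\<integral>x. u x - 2 * m x + (m x)\<^sup>2 / u x \<partial>\<rho>)"
    by (rule Bochner_Integration.integral_cong) (simp_all add: pw sp\<rho>)
  also have "\<dots> = (\<integral>x. u x \<partial>\<rho>) - 2 * N + (\<integral>x. (m x)\<^sup>2 / u x \<partial>\<rho>)"
    using int_u int_m int_q by (simp add: mass)
  also have "\<dots> \<le> 0" using u_le quot by simp
  finally have "(\<integral>x. (u x - m x)\<^sup>2 / u x \<partial>\<rho>) = 0"
    using integral_nonneg_AE[OF s0] by simp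
  then have "AE x in \<rho>. (u x - m x)\<^sup>2 / u x = 0"
    using integral_nonneg_eq_0_iff_AE[OF int_s s0] by simp
  then show ?thesis
  proof (rule AE_mp, intro AE_I2 impI)
    fix x assume "x \<in> space \<rho>" "(u x - m x)\<^sup>2 / u x = 0"
    then show "1 - \<psi> x = sqrt (kernel_mass \<kappa> \<nu> x)"
      using c(1) c(2)[of x] by (auto simp: sp\<rho> u_def m_def)
  qed
qed

text \<open>The set where two continuous functions differ is relatively open; being null, it cannot
  contain a point of the support.\<close>

lemma AE_eq_imp_eq_on_support:
  fixes f g :: "'a::topological_space \<Rightarrow> real"
  assumes \<mu>: "\<mu> \<in> nonneg_measures \<Omega>" and f: "continuous_on \<Omega> f" and g: "continuous_on \<Omega> g"
    and ae: "AE x in \<mu>. f x = g x" and x: "x \<in> measure_support \<Omega> \<mu>"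
  shows "f x = g x"
proof (rule ccontr)
  assume neq: "f x \<noteq> g x"
  have "continuous_on \<Omega> (\<lambda>x. f x - g x)" using f g by (intro continuous_intros)
  then obtain U where U: "open U" "(\<lambda>x. f x - g x) -` (- {0}) \<inter> \<Omega> = U \<inter> \<Omega>"
    using continuous_on_open_invariant[of \<Omega> "\<lambda>x. f x - g x"] open_Compl[OF closed_singleton[of "0::real"]] by metis
  have "x \<in> \<Omega>" using x by (simp add: measure_support_def)
  then have "x \<in> U" using U(2) neq by auto
  then have pos: "emeasure \<mu> (U \<inter> \<Omega>) > 0" using x U(1) by (simp add: measure_support_def)
  have "AE x in \<mu>. x \<notin> U \<inter> \<Omega>" using ae by eventually_elim (use U(2) in auto)
  moreover have "U \<inter> \<Omega> \<in> sets \<mu>"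
    using U(1) by (auto simp: sets_of_nonneg_measures[OF \<mu>] sets_restrict_space)
  ultimately have "emeasure \<mu> (U \<inter> \<Omega>) = 0"
    by (metis AE_iff_null_sets null_setsD1)
  then show False using pos by simp
qed

text \<open>Otherwise every point has a null neighbourhood, and by compactness finitely many of them
  cover \<Omega>, which has measure 1. Nonemptiness is what makes the supremum over the support
  meaningful.\<close>

lemma measure_support_nonempty:
  fixes \<rho> :: "'a::topological_space measure"
  assumes \<rho>: "\<rho> \<in> prob_measures \<Omega>" and \<Omega>: "compact \<Omega>"
  shows "measure_support \<Omega> \<rho> \<noteq> {}"
proof
  interpret R: prob_space \<rho> by (rule prob_space_of_prob_measures[OF \<rho>])
  note \<rho>' = prob_measures_nonneg[OF \<rho>]
  assume "measure_support \<Omega> \<rho> = {}"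
  then have "\<forall>x\<in>\<Omega>. \<exists>U. open U \<and> x \<in> U \<and> emeasure \<rho> (U \<inter> \<Omega>) = 0"
    by (auto simp: measure_support_def)
  then obtain U where U: "\<And>x. x \<in> \<Omega> \<Longrightarrow> open (U x) \<and> x \<in> U x \<and> emeasure \<rho> (U x \<inter> \<Omega>) = 0"
    by metis
  have U': "open (U x)" "x \<in> U x" if "x \<in> \<Omega>" for x using U[OF that] by simp_all
  have cover: "\<Omega> \<subseteq> (\<Union>x\<in>\<Omega>. U x)"
  proof
    fix x assume x: "x \<in> \<Omega>"
    show "x \<in> (\<Union>x\<in>\<Omega>. U x)" using U'(2)[OF x] x by (intro UN_I[where a=x])
  qed
  obtain C where C: "C \<subseteq> \<Omega>" "finite C" "\<Omega> \<subseteq> (\<Union>x\<in>C. U x)"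
  proof (rule compactE_image[of \<Omega> \<Omega> U])
    fix C assume "C \<subseteq> \<Omega>" "finite C" "\<Omega> \<subseteq> (\<Union>x\<in>C. U x)"
    then show thesis by (rule that)
  next
    show "compact \<Omega>" by (rule \<Omega>)
    show "open (U x)" if "x \<in> \<Omega>" for x by (rule U'(1)[OF that])
    show "\<Omega> \<subseteq> (\<Union>x\<in>\<Omega>. U x)" by (rule cover)
  qed
  have "(\<Union>x\<in>C. U x \<inter> \<Omega>) \<in> null_sets \<rho>"
  proof (rule null_sets.finite_UN[OF C(2)])
    fix x assume "x \<in> C"
    then have x: "x \<in> \<Omega>" using C(1) by blast
    have "\<Omega> \<inter> U x \<in> sets \<rho>"
      unfolding sets_of_nonneg_measures[OF \<rho>'] sets_restrict_space
      by (rule imageI) (simp add: U'(1)[OF x])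
    then show "U x \<inter> \<Omega> \<in> null_sets \<rho>"
      using U[OF x] by (simp add: null_sets_def Int_commute)
  qed
  moreover have "(\<Union>x\<in>C. U x \<inter> \<Omega>) = \<Omega>" using C(3) by auto
  ultimately show False
    using R.emeasure_space_1 space_eq_of_nonneg_measures[OF \<rho>'] by (auto simp: null_sets_def)
qed

section \<open>The kernel under Lebesgue measure\<close>

lemma integrable_hk_kernel_lborel:
  fixes y :: "'a::euclidean_space"
  assumes \<kappa>: "\<kappa> > 0"
  shows "integrable lborel (\<lambda>x. hk_kernel \<kappa> x y)"
proof (rule Bochner_Integration.integrable_bound)
  show "integrable lborel (indicator (cball y (\<kappa> * pi / 2)) :: 'a \<Rightarrow> real)"
    using emeasure_lborel_cball_finite by (intro integrable_real_indicator) auto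
  show "AE x in lborel. norm (hk_kernel \<kappa> x y) \<le> norm (indicator (cball y (\<kappa> * pi / 2)) x :: real)"
    using hk_kernel_eq_0[OF \<kappa>, of y] by (intro AE_I2)
      (auto simp: indicator_def hk_kernel_nonneg hk_kernel_le_1 hk_kernel_commute[of _ _ y])
qed measurable

text \<open>The substitution x = y + \<kappa> z extracts the power of \<kappa> and leaves the
  constant; integrating over the whole space makes the result independent of y.\<close>

lemma integral_hk_kernel_lborel:
  fixes y :: "'a::euclidean_space"
  assumes \<kappa>: "\<kappa> > 0"
  shows "(\<integral>x. hk_kernel \<kappa> x y \<partial>lborel) = Cos_const TYPE('a) * \<kappa> ^ DIM('a)"
proof -
  have "(\<integral>x. hk_kernel \<kappa> x y \<partial>lborel) = (\<integral>x. \<kappa> ^ DIM('a) *\<^sub>R hk_kernel \<kappa> x y \<partial>distr lborel borel (\<lambda>x. y + \<kappa> *\<^sub>R x))"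
    using \<kappa> by (subst lborel_affine[of \<kappa> y]) (simp_all add: integral_density)
  also have "\<dots> = (\<integral>x. \<kappa> ^ DIM('a) * hk_kernel \<kappa> (y + \<kappa> *\<^sub>R x) y \<partial>lborel)"
    by (subst integral_distr) simp_all
  also have "\<dots> = (\<integral>x. \<kappa> ^ DIM('a) * \<bar>(Cos (norm (x::'a)))\<^sup>2\<bar> \<partial>lborel)"
  proof (rule Bochner_Integration.integral_cong[OF refl])
    fix x :: 'a
    have "dist (y + \<kappa> *\<^sub>R x) y = \<kappa> * norm x" using \<kappa> by (simp add: dist_norm)
    then show "\<kappa> ^ DIM('a) * hk_kernel \<kappa> (y + \<kappa> *\<^sub>R x) y = \<kappa> ^ DIM('a) * \<bar>(Cos (norm x))\<^sup>2\<bar>"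
      using \<kappa> by (simp add: hk_kernel_def)
  qed
  also have "\<dots> = \<kappa> ^ DIM('a) * Cos_const TYPE('a)"
    unfolding Cos_const_def L1_norm_def by (rule integral_mult_right_zero)
  finally show ?thesis by (simp add: mult.commute)
qed

text \<open>Positivity is needed in order to divide by W. As 1 < pi / 2, the integrand is at least
  (cos 1)^2 on the unit ball.\<close>

lemma Cos_const_pos: "Cos_const TYPE('a::euclidean_space) > 0"
proof -
  have "(cos 1)\<^sup>2 * measure lborel (ball (0::'a) 1) = (\<integral>x. (cos 1)\<^sup>2 * indicator (ball (0::'a) 1) x \<partial>lborel)"
    by (subst integral_mult_right_zero) simp
  also have "\<dots> \<le> (\<integral>x. hk_kernel 1 x (0::'a) \<partial>lborel)"
  proof (rule integral_mono)
    show "integrable lborel (\<lambda>x. (cos 1)\<^sup>2 * indicator (ball (0::'a) 1) x :: real)"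
      using emeasure_bounded_finite[OF bounded_ball[of "0::'a" 1]]
      by (intro integrable_mult_right integrable_real_indicator) auto
    show "integrable lborel (\<lambda>x::'a. hk_kernel 1 x 0)" by (rule integrable_hk_kernel_lborel) simp
    fix x :: 'a
    show "(cos 1)\<^sup>2 * indicator (ball 0 1) x \<le> hk_kernel 1 x 0"
    proof (cases "x \<in> ball 0 1")
      case True
      then have n: "norm x < 1" by simp
      then have "cos 1 \<le> cos (norm x)" using pi_gt3 by (intro cos_monotone_0_pi_le) auto
      moreover have "0 \<le> cos (1::real)" using pi_gt3 by (intro cos_ge_zero) auto
      ultimately have "(cos 1)\<^sup>2 \<le> (cos (norm x))\<^sup>2" by (intro power_mono)
      moreover have "Cos (norm x) = cos (norm x)" using n pi_gt3 by (intro Cos_eq_cos) auto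
      ultimately show ?thesis using True by (simp add: hk_kernel_def)
    qed (simp add: hk_kernel_nonneg)
  qed
  also have "\<dots> = Cos_const TYPE('a)" by (subst integral_hk_kernel_lborel) auto
  finally have "(cos 1)\<^sup>2 * measure lborel (ball (0::'a) 1) \<le> Cos_const TYPE('a)" .
  moreover have "0 < (cos 1)\<^sup>2 * measure lborel (ball (0::'a) 1)"
    using cos_gt_zero_pi[of 1] pi_gt3 content_ball_pos[of 1 "0::'a"]
    by (intro mult_pos_pos) (auto simp: measure_completion)
  ultimately show ?thesis by linarith
qed

text \<open>Divided by its integral the kernel is an approximate identity: it is supported within
  distance \<kappa> pi / 2 of y, so F has to be close to c only there. The global bound B serves
  integrability alone.\<close>

lemma integral_mult_hk_kernel_approx:
  fixes y :: "'a::euclidean_space" and F :: "'a \<Rightarrow> real"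
  assumes \<kappa>: "\<kappa> > 0" and [measurable]: "F \<in> borel_measurable borel" and b: "\<And>x. \<bar>F x\<bar> \<le> B"
  shows "integrable lborel (\<lambda>x. F x * hk_kernel \<kappa> x y)"
    and "\<lbrakk>\<And>x. dist x y < \<kappa> * pi / 2 \<Longrightarrow> \<bar>F x - c\<bar> \<le> \<epsilon>\<rbrakk>
      \<Longrightarrow> \<bar>(\<integral>x. F x * hk_kernel \<kappa> x y \<partial>lborel) - c * (Cos_const TYPE('a) * \<kappa> ^ DIM('a))\<bar>
        \<le> \<epsilon> * (Cos_const TYPE('a) * \<kappa> ^ DIM('a))"
proof -
  note int = integrable_hk_kernel_lborel[OF \<kappa>, of y]
  show int_F: "integrable lborel (\<lambda>x. F x * hk_kernel \<kappa> x y)"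
  proof (rule Bochner_Integration.integrable_bound)
    show "integrable lborel (\<lambda>x. B * hk_kernel \<kappa> x y)" using int by (rule integrable_mult_right)
    show "AE x in lborel. norm (F x * hk_kernel \<kappa> x y) \<le> norm (B * hk_kernel \<kappa> x y)"
    proof (rule AE_I2)
      fix x
      have "\<bar>F x\<bar> \<le> \<bar>B\<bar>" using b[of x] by linarith
      then show "norm (F x * hk_kernel \<kappa> x y) \<le> norm (B * hk_kernel \<kappa> x y)"
        by (simp add: abs_mult hk_kernel_nonneg mult_right_mono)
    qed
  qed measurable
  assume c: "\<And>x. dist x y < \<kappa> * pi / 2 \<Longrightarrow> \<bar>F x - c\<bar> \<le> \<epsilon>"
  have "(\<integral>x. F x * hk_kernel \<kappa> x y \<partial>lborel) - c * (Cos_const TYPE('a) * \<kappa> ^ DIM('a))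
      = (\<integral>x. (F x - c) * hk_kernel \<kappa> x y \<partial>lborel)"
    unfolding integral_hk_kernel_lborel[OF \<kappa>, of y, symmetric] using int int_F
    by (simp add: left_diff_distrib)
  also have "\<bar>\<dots>\<bar> \<le> (\<integral>x. \<bar>(F x - c) * hk_kernel \<kappa> x y\<bar> \<partial>lborel)"
    by (rule integral_abs_bound)
  also have "\<dots> \<le> (\<integral>x. \<epsilon> * hk_kernel \<kappa> x y \<partial>lborel)"
  proof (rule integral_mono)
    show "integrable lborel (\<lambda>x. \<bar>(F x - c) * hk_kernel \<kappa> x y\<bar>)"
      using int int_F by (simp add: left_diff_distrib)
    show "integrable lborel (\<lambda>x. \<epsilon> * hk_kernel \<kappa> x y)" using int by simp
    show "\<bar>(F x - c) * hk_kernel \<kappa> x y\<bar> \<le> \<epsilon> * hk_kernel \<kappa> x y" for x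
      using c[of x] hk_kernel_eq_0[OF \<kappa>, of x y]
      by (cases "dist x y < \<kappa> * pi / 2") (auto simp: abs_mult hk_kernel_nonneg intro!: mult_right_mono)
  qed
  also have "\<dots> = \<epsilon> * (Cos_const TYPE('a) * \<kappa> ^ DIM('a))"
    by (simp add: integral_hk_kernel_lborel[OF \<kappa>])
  finally show "\<bar>(\<integral>x. F x * hk_kernel \<kappa> x y \<partial>lborel) - c * (Cos_const TYPE('a) * \<kappa> ^ DIM('a))\<bar>
        \<le> \<epsilon> * (Cos_const TYPE('a) * \<kappa> ^ DIM('a))" .
qed

text \<open>Fubini moves the averaging from \<nu> to the test function F. Lebesgue measure is
  infinite and F only bounded, so integrability on the product is obtained by integrating in x
  first, where each kernel section has the same finite integral.\<close>

lemma integral_mult_kernel_mass: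
  fixes \<nu> :: "'a::euclidean_space measure" and F :: "'a \<Rightarrow> real"
  assumes \<kappa>: "\<kappa> > 0" and \<nu>: "\<nu> \<in> nonneg_measures \<Omega>"
    and F [measurable]: "F \<in> borel_measurable borel" and b: "\<And>x. \<bar>F x\<bar> \<le> B"
  shows "integrable lborel (\<lambda>x. F x * kernel_mass \<kappa> \<nu> x)"
    and "integrable \<nu> (\<lambda>y. \<integral>x. F x * hk_kernel \<kappa> x y \<partial>lborel)"
    and "(\<integral>x. F x * kernel_mass \<kappa> \<nu> x \<partial>lborel) = (\<integral>y. (\<integral>x. F x * hk_kernel \<kappa> x y \<partial>lborel) \<partial>\<nu>)"
proof -
  interpret N: finite_measure \<nu> by (rule finite_measure_of_nonneg_measures[OF \<nu>])
  interpret pair_sigma_finite \<nu> lborel ..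
  note [measurable] = nonneg_measures_measurable_id[OF \<nu>]
  note int = integral_mult_hk_kernel_approx(1)[OF \<kappa> F b]
  have F': "(\<lambda>x. \<bar>F x\<bar>) \<in> borel_measurable borel" by measurable
  have bound: "\<bar>\<integral>x. \<bar>F x * hk_kernel \<kappa> x y\<bar> \<partial>lborel\<bar> \<le> B * (Cos_const TYPE('a) * \<kappa> ^ DIM('a))" for y
  proof -
    have "(\<integral>x. \<bar>F x * hk_kernel \<kappa> x y\<bar> \<partial>lborel) \<le> (\<integral>x. B * hk_kernel \<kappa> x y \<partial>lborel)"
    proof (rule integral_mono)
      show "integrable lborel (\<lambda>x. \<bar>F x * hk_kernel \<kappa> x y\<bar>)" by (rule integrable_abs[OF int])
      show "integrable lborel (\<lambda>x. B * hk_kernel \<kappa> x y)"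
        by (rule integrable_mult_right[OF integrable_hk_kernel_lborel[OF \<kappa>]])
      show "\<bar>F x * hk_kernel \<kappa> x y\<bar> \<le> B * hk_kernel \<kappa> x y" for x
        using b by (simp add: abs_mult hk_kernel_nonneg mult_right_mono)
    qed
    also have "\<dots> = B * (Cos_const TYPE('a) * \<kappa> ^ DIM('a))"
      by (simp add: integral_hk_kernel_lborel[OF \<kappa>])
    finally show ?thesis by (simp add: abs_of_nonneg integral_nonneg_AE)
  qed
  have int_p: "integrable (\<nu> \<Otimes>\<^sub>M lborel) (\<lambda>(y, x). F x * hk_kernel \<kappa> x y)"
  proof (rule Fubini_integrable)
    show "integrable \<nu> (\<lambda>y. \<integral>x. norm (case (y, x) of (y, x) \<Rightarrow> F x * hk_kernel \<kappa> x y) \<partial>lborel)"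
      using bound by (intro N.integrable_const_bound[of _ "B * (Cos_const TYPE('a) * \<kappa> ^ DIM('a))"]) auto
    show "AE y in \<nu>. integrable lborel (\<lambda>x. case (y, x) of (y, x) \<Rightarrow> F x * hk_kernel \<kappa> x y)"
      using int by (intro AE_I2) simp
  qed measurable
  have inner: "(\<integral>y. F x * hk_kernel \<kappa> x y \<partial>\<nu>) = F x * kernel_mass \<kappa> \<nu> x" for x
    unfolding kernel_mass_def by (rule integral_mult_right_zero)
  show "integrable lborel (\<lambda>x. F x * kernel_mass \<kappa> \<nu> x)"
    using integrable_snd[OF int_p] by (simp only: inner)
  show "integrable \<nu> (\<lambda>y. \<integral>x. F x * hk_kernel \<kappa> x y \<partial>lborel)"
    by (rule integrable_fst[OF int_p])
  show "(\<integral>x. F x * kernel_mass \<kappa> \<nu> x \<partial>lborel) = (\<integral>y. (\<integral>x. F x * hk_kernel \<kappa> x y \<partial>lborel) \<partial>\<nu>)"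
    using Fubini_integral[OF int_p] by (simp only: inner)
qed

section \<open>Approximation of square-integrable densities by continuous functions\<close>

lemma leb_on_nonneg_measures:
  fixes \<Omega> :: "'a::euclidean_space set"
  assumes "compact \<Omega>"
  shows "leb_on \<Omega> \<in> nonneg_measures \<Omega>"
proof -
  have "\<Omega> \<in> sets borel" using assms by (simp add: borel_compact)
  then have "emeasure (leb_on \<Omega>) (space (leb_on \<Omega>)) < \<infinity>"
    using emeasure_compact_finite[OF assms]
    by (simp add: leb_on_def emeasure_restrict_space space_restrict_space)
  then show ?thesis
    unfolding nonneg_measures_def leb_on_def
    by (auto intro!: finite_measureI sets_restrict_space_cong)
qed

text \<open>Truncation at a level k is followed by continuous approximation of the truncated
  function, both limits by dominated convergence. The bounds on g are part of the result because g^2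
  will be the density of a competitor and must have g as its root.\<close>

lemma L2_approx_continuous:
  fixes f :: "'a::euclidean_space \<Rightarrow> real"
  assumes \<Omega>: "compact \<Omega>" and f: "f \<in> borel_measurable (leb_on \<Omega>)" and nn: "\<And>x. 0 \<le> f x"
    and int: "integrable (leb_on \<Omega>) (\<lambda>x. (f x)\<^sup>2)" and \<epsilon>: "\<epsilon> > 0"
  obtains g B where "continuous_on UNIV g" "\<And>x. 0 \<le> g x" "\<And>x. g x \<le> B"
    "(\<integral>x. (g x - f x)\<^sup>2 \<partial>leb_on \<Omega>) < \<epsilon>"
proof -
  let ?L = "leb_on \<Omega>"
  note L = leb_on_nonneg_measures[OF \<Omega>]
  interpret finite_measure ?L by (rule finite_measure_of_nonneg_measures[OF L])
  note spL = space_eq_of_nonneg_measures[OF L]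
  have \<Omega>b: "\<Omega> \<in> sets borel" using \<Omega> by (simp add: borel_compact)
  note [measurable] = f
  have lim1: "(\<lambda>k::nat. \<integral>x. (min (f x) k - f x)\<^sup>2 \<partial>?L) \<longlonglongrightarrow> (\<integral>x. 0 \<partial>?L)"
  proof (rule integral_dominated_convergence[OF _ _ int])
    show "AE x in ?L. (\<lambda>k::nat. (min (f x) k - f x)\<^sup>2) \<longlonglongrightarrow> 0"
    proof (rule AE_I2)
      fix x
      obtain n :: nat where "f x \<le> n" using real_arch_simple by blast
      then have "eventually (\<lambda>k. (min (f x) (real k) - f x)\<^sup>2 = 0) sequentially"
        unfolding eventually_sequentially by (intro exI[of _ n]) auto
      then show "(\<lambda>k::nat. (min (f x) k - f x)\<^sup>2) \<longlonglongrightarrow> 0" by (rule tendsto_eventually)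
    qed
    fix k :: nat
    show "AE x in ?L. norm ((min (f x) k - f x)\<^sup>2) \<le> (f x)\<^sup>2"
      using nn by (intro AE_I2) (auto simp: min_def abs_le_square_iff[symmetric] abs_le_iff)
  qed measurable
  then have "eventually (\<lambda>k::nat. (\<integral>x. (min (f x) k - f x)\<^sup>2 \<partial>?L) < \<epsilon> / 4) sequentially"
    using \<epsilon> by (intro order_tendstoD) auto
  then obtain k :: nat where k: "(\<integral>x. (min (f x) k - f x)\<^sup>2 \<partial>?L) < \<epsilon> / 4"
    by (auto simp: eventually_sequentially)
  have "(\<lambda>x. indicator \<Omega> x * min (f x) k) \<in> borel_measurable lborel"
  proof -
    have "(\<lambda>x. min (f x) (real k)) \<in> borel_measurable ?L" by measurable
    then show ?thesis
      unfolding leb_on_def using \<Omega>b by (subst (asm) borel_measurable_restrict_space_iff) auto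
  qed
  then have "(\<lambda>x. indicator \<Omega> x * min (f x) k) \<in> borel_measurable lebesgue"
    by (rule measurable_completion)
  \<comment> \<open>\<open>measurable_on\<close> means being a limit of continuous functions off a
    negligible set; it is the source of the approximants h.\<close>
  then have "(\<lambda>x. indicator \<Omega> x * min (f x) k) measurable_on UNIV"
    by (rule lebesgue_measurable_imp_measurable_on_real) auto
  then obtain N h where N: "negligible N" and h: "\<And>n. continuous_on UNIV (h n)"
    and lim: "\<And>x. x \<notin> N \<Longrightarrow> (\<lambda>n::nat. h n x) \<longlonglongrightarrow> indicator \<Omega> x * min (f x) k"
    unfolding measurable_on_def by auto
  have "AE x in lebesgue. x \<notin> N"
    using N by (intro AE_not_in) (simp add: negligible_iff_null_sets)
  then have "AE x in lborel. x \<notin> N" by (simp only: AE_completion_iff)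
  then have NL: "AE x in ?L. x \<notin> N"
    unfolding leb_on_def using \<Omega>b by (subst AE_restrict_space_iff) (auto elim: eventually_mono)
  \<comment> \<open>Clamping to [0, k] keeps continuity, supplies the dominating constant, and does
    not disturb the limit, which already lies in [0, k].\<close>
  define g where "g n x = max 0 (min (h n x) k)" for n x
  have g: "continuous_on UNIV (g n)" for n
    unfolding g_def by (intro continuous_intros h)
  have gb: "0 \<le> g n x" "g n x \<le> k" for n x by (auto simp: g_def)
  have g_meas [measurable]: "g n \<in> borel_measurable ?L" for n
    by (rule measurable_continuous_on_nonneg_measures[OF L continuous_on_subset[OF g]]) simp
  have lim2: "(\<lambda>n. \<integral>x. (g n x - min (f x) k)\<^sup>2 \<partial>?L) \<longlonglongrightarrow> (\<integral>x. 0 \<partial>?L)"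
  proof (rule integral_dominated_convergence[where w="\<lambda>_. (real k)\<^sup>2"])
    show "AE x in ?L. (\<lambda>n. (g n x - min (f x) k)\<^sup>2) \<longlonglongrightarrow> 0"
      using NL AE_space
    proof eventually_elim
      case (elim x)
      have "(\<lambda>n. h n x) \<longlonglongrightarrow> min (f x) k"
        using lim[of x] elim by (simp add: spL)
      then have "(\<lambda>n. (max 0 (min (h n x) k) - min (f x) k)\<^sup>2) \<longlonglongrightarrow> (max 0 (min (min (f x) k) k) - min (f x) k)\<^sup>2"
        by (intro tendsto_intros)
      then show ?case using nn[of x] by (simp add: g_def)
    qed
    fix n
    show "AE x in ?L. norm ((g n x - min (f x) k)\<^sup>2) \<le> (real k)\<^sup>2"
    proof (rule AE_I2)
      fix x
      have "\<bar>g n x - min (f x) k\<bar> \<le> real k" using gb[of n x] nn[of x] by (auto simp: abs_le_iff min_def)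
      then show "norm ((g n x - min (f x) k)\<^sup>2) \<le> (real k)\<^sup>2" by (simp add: abs_le_square_iff[symmetric])
    qed
  qed simp_all
  then have "eventually (\<lambda>n. (\<integral>x. (g n x - min (f x) k)\<^sup>2 \<partial>?L) < \<epsilon> / 4) sequentially"
    using \<epsilon> by (intro order_tendstoD) auto
  then obtain n where n: "(\<integral>x. (g n x - min (f x) k)\<^sup>2 \<partial>?L) < \<epsilon> / 4"
    by (auto simp: eventually_sequentially)
  have int1: "integrable ?L (\<lambda>x. (g n x - min (f x) k)\<^sup>2)"
  proof (rule integrable_const_bound[of _ "(real k)\<^sup>2"])
    show "AE x in ?L. norm ((g n x - min (f x) k)\<^sup>2) \<le> (real k)\<^sup>2"
    proof (rule AE_I2)
      fix x
      have "\<bar>g n x - min (f x) k\<bar> \<le> real k" using gb[of n x] nn[of x] by (auto simp: abs_le_iff min_def)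
      then show "norm ((g n x - min (f x) k)\<^sup>2) \<le> (real k)\<^sup>2" by (simp add: abs_le_square_iff[symmetric])
    qed
  qed measurable
  have int2: "integrable ?L (\<lambda>x. (min (f x) k - f x)\<^sup>2)"
  proof (rule Bochner_Integration.integrable_bound[OF int])
    show "AE x in ?L. norm ((min (f x) k - f x)\<^sup>2) \<le> norm ((f x)\<^sup>2)"
      using nn by (intro AE_I2) (auto simp: min_def abs_le_square_iff[symmetric] abs_le_iff)
  qed measurable
  \<comment> \<open>The factor 2 in (a + b)^2 \<le> 2 a^2 + 2 b^2 is why each of the two errors was
    made smaller than \<epsilon> / 4.\<close>
  have pw: "(g n x - f x)\<^sup>2 \<le> 2 * (g n x - min (f x) k)\<^sup>2 + 2 * (min (f x) k - f x)\<^sup>2" for x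
    using zero_le_power2[of "(g n x - min (f x) k) - (min (f x) k - f x)"]
    by (simp add: power2_eq_square algebra_simps)
  have int3: "integrable ?L (\<lambda>x. (g n x - f x)\<^sup>2)"
  proof (rule Bochner_Integration.integrable_bound)
    show "integrable ?L (\<lambda>x. 2 * (g n x - min (f x) k)\<^sup>2 + 2 * (min (f x) k - f x)\<^sup>2)"
      using int1 int2 by auto
    show "AE x in ?L. norm ((g n x - f x)\<^sup>2) \<le> norm (2 * (g n x - min (f x) k)\<^sup>2 + 2 * (min (f x) k - f x)\<^sup>2)"
      using pw by (intro AE_I2) (auto intro: order_trans)
  qed measurable
  have "(\<integral>x. (g n x - f x)\<^sup>2 \<partial>?L) \<le> (\<integral>x. 2 * (g n x - min (f x) k)\<^sup>2 + 2 * (min (f x) k - f x)\<^sup>2 \<partial>?L)"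
    using int1 int2 int3 by (intro integral_mono pw) auto
  also have "\<dots> = 2 * (\<integral>x. (g n x - min (f x) k)\<^sup>2 \<partial>?L) + 2 * (\<integral>x. (min (f x) k - f x)\<^sup>2 \<partial>?L)"
    using int1 int2 by simp
  also have "\<dots> < \<epsilon>" using n k by simp
  finally show ?thesis using that g gb by blast
qed

section \<open>The small-scale limit\<close>

locale square_integrable_density =
  fixes \<Omega> :: "'a::euclidean_space set" and \<rho> :: "'a measure" and W :: "real \<Rightarrow> real"
  defines W_def: "W \<equiv> \<lambda>\<kappa>. Cos_const TYPE('a) * \<kappa> ^ DIM('a)"
  assumes compact: "compact \<Omega>" and convex: "convex \<Omega>"
    and prob: "\<rho> \<in> prob_measures \<Omega>"
    and ac: "absolutely_continuous (leb_on \<Omega>) \<rho>"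
    and sq: "square_integrable (leb_on \<Omega>) (rn_density (leb_on \<Omega>) \<rho>)"
begin

abbreviation "L \<equiv> leb_on \<Omega>"
abbreviation "r \<equiv> rn_density L \<rho>"
text \<open>Extension by zero, so that r can be compared with m, which need not vanish outside
  \<Omega>.\<close>

abbreviation "R x \<equiv> indicator \<Omega> x * r x"

definition l2_defect :: "real \<Rightarrow> 'a measure \<Rightarrow> real" where
  "l2_defect \<kappa> \<nu> = (\<integral>x. (sqrt (kernel_mass \<kappa> \<nu> x) / W \<kappa> - R x)\<^sup>2 \<partial>lborel)"

lemmas \<rho>_nonneg = prob_measures_nonneg[OF prob]
lemmas L_nonneg = leb_on_nonneg_measures[OF compact]

sublocale R: prob_space \<rho> by (rule prob_space_of_prob_measures[OF prob])
sublocale L: finite_measure L by (rule finite_measure_of_nonneg_measures[OF L_nonneg])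

lemma \<Omega>_borel [measurable]: "\<Omega> \<in> sets borel"
  using compact by (simp add: borel_compact)

lemma space_L: "space L = \<Omega>" by (rule space_eq_of_nonneg_measures[OF L_nonneg])
lemma space_\<rho>: "space \<rho> = \<Omega>" by (rule space_eq_of_nonneg_measures[OF \<rho>_nonneg])

lemma W_pos: "\<kappa> > 0 \<Longrightarrow> W \<kappa> > 0"
  unfolding W_def using Cos_const_pos[where 'a='a] by simp

lemma integral_hk_kernel_W: "\<kappa> > 0 \<Longrightarrow> (\<integral>x. hk_kernel \<kappa> x y \<partial>lborel) = W \<kappa>" for y :: 'a
  unfolding W_def by (rule integral_hk_kernel_lborel)

lemma integral_mult_hk_kernel_approx_W:
  fixes y :: 'a and F :: "'a \<Rightarrow> real"
  assumes "\<kappa> > 0" "F \<in> borel_measurable borel" "\<And>x. \<bar>F x\<bar> \<le> B"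
    and "\<And>x. dist x y < \<kappa> * pi / 2 \<Longrightarrow> \<bar>F x - c\<bar> \<le> \<epsilon>"
  shows "\<bar>(\<integral>x. F x * hk_kernel \<kappa> x y \<partial>lborel) - c * W \<kappa>\<bar> \<le> \<epsilon> * W \<kappa>"
  unfolding W_def using assms by (rule integral_mult_hk_kernel_approx(2))

lemma integral_L: "integral\<^sup>L L f = (\<integral>x. indicator \<Omega> x * f x \<partial>lborel)" for f :: "'a \<Rightarrow> real"
  unfolding leb_on_def by (subst integral_restrict_space) auto

lemma integrable_L: "integrable L f \<longleftrightarrow> integrable lborel (\<lambda>x. indicator \<Omega> x * f x)" for f :: "'a \<Rightarrow> real"
  unfolding leb_on_def by (subst integrable_restrict_space) auto

lemma borel_measurable_R [measurable]: "R \<in> borel_measurable lborel"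
  using borel_measurable_rn_density[of L \<rho>] unfolding leb_on_def
  by (subst (asm) borel_measurable_restrict_space_iff) auto

lemma \<rho>_eq_density: "density L (\<lambda>x. ennreal (r x)) = \<rho>"
  by (rule density_rn_density[OF L.sigma_finite_measure_axioms R.finite_measure_axioms ac])
     (simp add: sets_of_nonneg_measures[OF \<rho>_nonneg] sets_of_nonneg_measures[OF L_nonneg])

lemma integral_\<rho>:
  fixes f :: "'a \<Rightarrow> real"
  assumes "f \<in> borel_measurable borel"
  shows "integral\<^sup>L \<rho> f = (\<integral>x. R x * f x \<partial>lborel)"
    and "integrable \<rho> f \<longleftrightarrow> integrable lborel (\<lambda>x. R x * f x)"
proof -
  have [measurable]: "f \<in> borel_measurable L"
    unfolding leb_on_def using assms by (intro measurable_restrict_space1) simp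
  show "integral\<^sup>L \<rho> f = (\<integral>x. R x * f x \<partial>lborel)"
    by (subst \<rho>_eq_density[symmetric], subst integral_density)
       (auto simp: rn_density_nonneg integral_L mult.assoc)
  show "integrable \<rho> f \<longleftrightarrow> integrable lborel (\<lambda>x. R x * f x)"
    by (subst \<rho>_eq_density[symmetric], subst integrable_density)
       (auto simp: rn_density_nonneg integrable_L mult.assoc)
qed

lemma R_square: "(R x)\<^sup>2 = indicator \<Omega> x * (r x)\<^sup>2"
  by (simp add: indicator_def)

lemma integrable_R_square: "integrable lborel (\<lambda>x. (R x)\<^sup>2)"
  using sq unfolding square_integrable_def R_square by (simp add: integrable_L)

lemma integral_R_square: "(\<integral>x. (R x)\<^sup>2 \<partial>lborel) = (L2_norm L r)\<^sup>2"
  unfolding R_square L2_norm_def by (simp add: integral_L[symmetric] integral_nonneg_AE)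

text \<open>This is the averaging identity for F = 1: each unit of mass of \<nu> contributes exactly
  W, even near the boundary of \<Omega>, because the integral runs over the whole space.\<close>

lemma integral_kernel_mass:
  assumes \<nu>: "\<nu> \<in> nonneg_measures \<Omega>" and \<kappa>: "\<kappa> > 0"
  shows "integrable lborel (kernel_mass \<kappa> \<nu>)"
    and "(\<integral>x. kernel_mass \<kappa> \<nu> x \<partial>lborel) = W \<kappa> * measure \<nu> \<Omega>"
  using integral_mult_kernel_mass(1,3)[OF \<kappa> \<nu>, of "\<lambda>_. 1" 1]
  by (simp_all add: integral_hk_kernel_W[OF \<kappa>] space_eq_of_nonneg_measures[OF \<nu>])

text \<open>In the expanded square, m^2 / W^2 integrates to
  \<open>measure \<nu> \<Omega> / W \<kappa>\<close> and the cross term R m integrates to the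
  integral of m over \<rho>. Minimising the primal objective is thus the same as bringing m / W
  close to r in the mean-square sense.\<close>

lemma l2_defect_eq:
  assumes \<nu>: "\<nu> \<in> nonneg_measures \<Omega>" and \<kappa>: "\<kappa> > 0"
  shows "l2_defect \<kappa> \<nu> = reduced_objective \<Omega> \<rho> \<kappa> \<nu> / W \<kappa> + (L2_norm L r)\<^sup>2"
    and "integrable lborel (\<lambda>x. (sqrt (kernel_mass \<kappa> \<nu> x) / W \<kappa> - R x)\<^sup>2)"
proof -
  define m where "m x = sqrt (kernel_mass \<kappa> \<nu> x)" for x
  have m_meas: "m \<in> borel_measurable borel"
    unfolding m_def using borel_measurable_kernel_mass[OF \<nu>, of "\<lambda>x. x" borel] by measurable
  have m2: "(m x)\<^sup>2 = kernel_mass \<kappa> \<nu> x" for x by (simp add: m_def kernel_mass_nonneg)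
  have intm: "integrable \<rho> m"
    unfolding m_def[abs_def] by (rule integrable_sqrt_kernel_mass[OF \<nu> \<rho>_nonneg])
  have int1: "integrable lborel (\<lambda>x. R x * m x)" using integral_\<rho>(2)[OF m_meas] intm by simp
  have int2: "integrable lborel (\<lambda>x. (m x)\<^sup>2)" unfolding m2 by (rule integral_kernel_mass[OF \<nu> \<kappa>])
  have exp: "(m x / W \<kappa> - R x)\<^sup>2 = (m x)\<^sup>2 * (1 / (W \<kappa>)\<^sup>2) - (R x * m x) * (2 / W \<kappa>) + (R x)\<^sup>2" for x
    by (simp only: power2_diff power_divide) simp
  show "integrable lborel (\<lambda>x. (sqrt (kernel_mass \<kappa> \<nu> x) / W \<kappa> - R x)\<^sup>2)"
    unfolding m_def[symmetric] exp
    by (intro Bochner_Integration.integrable_add Bochner_Integration.integrable_diff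
        integrable_mult_left int1 int2 integrable_R_square)
  have "l2_defect \<kappa> \<nu> = (\<integral>x. (m x)\<^sup>2 * (1 / (W \<kappa>)\<^sup>2) - (R x * m x) * (2 / W \<kappa>) + (R x)\<^sup>2 \<partial>lborel)"
    unfolding l2_defect_def m_def[symmetric] exp ..
  also have "\<dots> = (\<integral>x. (m x)\<^sup>2 \<partial>lborel) * (1 / (W \<kappa>)\<^sup>2) - (\<integral>x. R x * m x \<partial>lborel) * (2 / W \<kappa>) + (\<integral>x. (R x)\<^sup>2 \<partial>lborel)"
    by (simp only: Bochner_Integration.integral_add Bochner_Integration.integral_diff integral_mult_left_zero
        Bochner_Integration.integrable_diff integrable_mult_left int1 int2 integrable_R_square)
  also have "(\<integral>x. (m x)\<^sup>2 \<partial>lborel) = W \<kappa> * measure \<nu> \<Omega>"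
    unfolding m2 by (rule integral_kernel_mass[OF \<nu> \<kappa>])
  also have "(\<integral>x. R x * m x \<partial>lborel) = (\<integral>x. m x \<partial>\<rho>)" using integral_\<rho>(1)[OF m_meas] by simp
  also have "(\<integral>x. (R x)\<^sup>2 \<partial>lborel) = (L2_norm L r)\<^sup>2" by (rule integral_R_square)
  also have "W \<kappa> * measure \<nu> \<Omega> * (1 / (W \<kappa>)\<^sup>2) = measure \<nu> \<Omega> / W \<kappa>"
    using W_pos[OF \<kappa>] by (simp add: power2_eq_square)
  finally show "l2_defect \<kappa> \<nu> = reduced_objective \<Omega> \<rho> \<kappa> \<nu> / W \<kappa> + (L2_norm L r)\<^sup>2"
    by (simp add: reduced_objective_def m_def diff_divide_distrib)
qed

lemma l2_defect_nonneg: "0 \<le> l2_defect \<kappa> \<nu>"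
  unfolding l2_defect_def by (rule integral_nonneg_AE) simp

text \<open>At a minimiser the integral of m equals the mass, so the reduced objective is minus the
  mass; nonnegativity of the defect is then the claim.\<close>

lemma minimizer_mass_le:
  assumes min: "primal_minimizer \<Omega> \<rho> \<kappa> \<nu>" and \<kappa>: "\<kappa> > 0"
  shows "measure \<nu> \<Omega> \<le> W \<kappa> * (L2_norm L r)\<^sup>2"
proof -
  have \<nu>: "\<nu> \<in> nonneg_measures \<Omega>" using min by (simp add: primal_minimizer_def)
  have "0 \<le> - measure \<nu> \<Omega> / W \<kappa> + (L2_norm L r)\<^sup>2"
    using l2_defect_nonneg[of \<kappa> \<nu>] minimizer_mass[OF min prob \<kappa>]
    unfolding l2_defect_eq(1)[OF \<nu> \<kappa>] reduced_objective_def by simp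
  then have "measure \<nu> \<Omega> / W \<kappa> \<le> (L2_norm L r)\<^sup>2" by simp
  then show ?thesis by (simp only: pos_divide_le_eq[OF W_pos[OF \<kappa>]] mult.commute)
qed

text \<open>At an interior point the ball carrying the kernel eventually lies inside \<Omega>, so
  restricting the integral to \<Omega> loses nothing. At a boundary point part of the kernel would
  be cut off.\<close>

lemma kernel_average_tendsto:
  fixes h :: "'a \<Rightarrow> real"
  assumes h: "continuous_on UNIV h" and b: "\<And>x. \<bar>h x\<bar> \<le> B" and x: "x \<in> interior \<Omega>"
  shows "((\<lambda>\<kappa>. (\<integral>y. h y * hk_kernel \<kappa> x y \<partial>L) / W \<kappa>) \<longlongrightarrow> h x) (at_right 0)"
proof (rule tendstoI)
  fix e :: real assume e: "e > 0"
  have "isCont h x" using h by (simp add: continuous_on_eq_continuous_at)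
  then obtain d where d: "d > 0" "\<And>y. dist y x < d \<Longrightarrow> dist (h y) (h x) < e / 2"
    using e unfolding continuous_at_eps_delta by (meson half_gt_zero)
  obtain d' where d': "d' > 0" "ball x d' \<subseteq> \<Omega>" using x by (auto simp: mem_interior)
  have [measurable]: "h \<in> borel_measurable borel" by (rule borel_measurable_continuous_onI[OF h])
  have "eventually (\<lambda>\<kappa>. \<kappa> * pi / 2 < min d d') (at_right 0)"
    by (rule order_tendstoD(2)[of _ 0]) (use d d' in \<open>auto intro!: tendsto_eq_intros\<close>)
  moreover have "eventually (\<lambda>\<kappa>. \<kappa> > 0) (at_right (0::real))" by (rule eventually_at_right_less)
  ultimately show "eventually (\<lambda>\<kappa>. dist ((\<integral>y. h y * hk_kernel \<kappa> x y \<partial>L) / W \<kappa>) (h x) < e) (at_right 0)"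
  proof eventually_elim
    case (elim \<kappa>)
    have "\<bar>(\<integral>y. (indicator \<Omega> y * h y) * hk_kernel \<kappa> y x \<partial>lborel) - h x * W \<kappa>\<bar> \<le> e / 2 * W \<kappa>"
    proof (rule integral_mult_hk_kernel_approx_W[of _ _ B])
      show "\<bar>indicator \<Omega> y * h y\<bar> \<le> B" for y
        using b[of y] by (auto simp: indicator_def)
      fix y assume "dist y x < \<kappa> * pi / 2"
      then have "dist y x < d" "dist y x < d'" using elim by auto
      then have "y \<in> \<Omega>" "\<bar>h y - h x\<bar> < e / 2" using d(2)[of y] d'(2) by (auto simp: dist_real_def dist_commute)
      then show "\<bar>indicator \<Omega> y * h y - h x\<bar> \<le> e / 2" by simp
    qed (use elim in auto)
    also have "(\<integral>y. (indicator \<Omega> y * h y) * hk_kernel \<kappa> y x \<partial>lborel) = (\<integral>y. h y * hk_kernel \<kappa> x y \<partial>L)"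
      by (simp add: integral_L mult.assoc hk_kernel_commute[of \<kappa> x])
    finally have *: "\<bar>(\<integral>y. h y * hk_kernel \<kappa> x y \<partial>L) - h x * W \<kappa>\<bar> \<le> e / 2 * W \<kappa>" .
    have Wp: "W \<kappa> > 0" using elim by (intro W_pos)
    have "dist ((\<integral>y. h y * hk_kernel \<kappa> x y \<partial>L) / W \<kappa>) (h x) = \<bar>(\<integral>y. h y * hk_kernel \<kappa> x y \<partial>L) - h x * W \<kappa>\<bar> / W \<kappa>"
    proof -
      have "(\<integral>y. h y * hk_kernel \<kappa> x y \<partial>L) / W \<kappa> - h x = ((\<integral>y. h y * hk_kernel \<kappa> x y \<partial>L) - h x * W \<kappa>) / W \<kappa>"
        using Wp by (simp only: diff_divide_distrib nonzero_mult_div_cancel_right[OF less_imp_neq[symmetric, OF Wp]])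
      then show ?thesis using Wp by (simp only: dist_real_def abs_divide abs_of_pos)
    qed
    also have "\<dots> \<le> e / 2" using * by (simp only: pos_divide_le_eq[OF Wp])
    finally show ?case using e by linarith
  qed
qed

text \<open>Since \<rho> has density r, the middle term is -2 times the inner product of g and r.
  The left side is the limit of the rescaled objective along the competitors, so this identifies the
  limit as a squared distance.\<close>

lemma L2_sq_expand:
  fixes g :: "'a \<Rightarrow> real"
  assumes g: "g \<in> borel_measurable borel" and b: "\<And>x. \<bar>g x\<bar> \<le> B"
  shows "(\<integral>x. (g x)\<^sup>2 \<partial>L) - 2 * (\<integral>x. g x \<partial>\<rho>) + (L2_norm L r)\<^sup>2 = (\<integral>x. (g x - r x)\<^sup>2 \<partial>L)"
proof -
  have gL [measurable]: "g \<in> borel_measurable L"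
    unfolding leb_on_def using g by (intro measurable_restrict_space1) simp
  have int1: "integrable L (\<lambda>x. (g x)\<^sup>2)"
  proof (rule L.integrable_const_bound[of _ "B\<^sup>2"])
    show "AE x in L. norm ((g x)\<^sup>2) \<le> B\<^sup>2"
      using b by (intro AE_I2) (metis abs_ge_zero norm_power power_mono real_norm_def)
  qed measurable
  have int2: "integrable L (\<lambda>x. r x * g x)"
  proof -
    have [measurable]: "g \<in> borel_measurable \<rho>"
      using gL by (simp add: measurable_cong_sets[OF sets_of_nonneg_measures[OF \<rho>_nonneg] refl]
          measurable_cong_sets[OF sets_of_nonneg_measures[OF L_nonneg] refl])
    have "integrable \<rho> g"
      using b by (intro R.integrable_const_bound[of _ B]) auto
    then show ?thesis
      by (subst (asm) integral_\<rho>(2)[OF g]) (simp add: integrable_L mult.assoc)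
  qed
  have int3: "integrable L (\<lambda>x. (r x)\<^sup>2)" using sq by (simp add: square_integrable_def)
  have "(\<integral>x. (g x - r x)\<^sup>2 \<partial>L) = (\<integral>x. (g x)\<^sup>2 - 2 * (r x * g x) + (r x)\<^sup>2 \<partial>L)"
    by (rule Bochner_Integration.integral_cong[OF refl]) (simp add: power2_diff)
  also have "\<dots> = (\<integral>x. (g x)\<^sup>2 \<partial>L) - 2 * (\<integral>x. r x * g x \<partial>L) + (\<integral>x. (r x)\<^sup>2 \<partial>L)"
    using int1 int2 int3 by simp
  also have "(\<integral>x. r x * g x \<partial>L) = (\<integral>x. g x \<partial>\<rho>)"
    by (simp add: integral_\<rho>(1)[OF g] integral_L mult.assoc)
  also have "(\<integral>x. (r x)\<^sup>2 \<partial>L) = (L2_norm L r)\<^sup>2"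
    by (simp add: L2_norm_def integral_nonneg_AE)
  finally show ?thesis by simp
qed

text \<open>A minimiser has the smallest defect, so it suffices to find competitors whose defect
  tends to a number below a given \<epsilon>. For the competitor built from g, m / W equals a
  function s that stays below the bound of g and tends to g at interior points; its defect converges
  to the squared distance of g and r.\<close>

lemma l2_defect_minimizer_tendsto:
  assumes min_all: "\<And>\<kappa>. \<kappa> > 0 \<Longrightarrow> primal_minimizer \<Omega> \<rho> \<kappa> (\<nu> \<kappa>)"
  shows "((\<lambda>\<kappa>. l2_defect \<kappa> (\<nu> \<kappa>)) \<longlongrightarrow> 0) (at_right 0)"
proof (rule tendstoI)
  fix \<epsilon> :: real assume \<epsilon>: "\<epsilon> > 0"
  have r: "r \<in> borel_measurable L" "integrable L (\<lambda>x. (r x)\<^sup>2)"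
    using sq by (auto simp: square_integrable_def)
  obtain g B where g: "continuous_on UNIV g" "\<And>x. 0 \<le> g x" "\<And>x. g x \<le> B"
    and gr: "(\<integral>x. (g x - r x)\<^sup>2 \<partial>L) < \<epsilon>"
    by (rule L2_approx_continuous[OF compact r(1) rn_density_nonneg r(2) \<epsilon>]) (rule that)
  have g_meas [measurable]: "g \<in> borel_measurable borel" by (rule borel_measurable_continuous_onI[OF g(1)])
  have gL [measurable]: "g \<in> borel_measurable L"
    unfolding leb_on_def by (intro measurable_restrict_space1) simp
  have B0: "0 \<le> B" using g(2,3) order_trans by blast
  have g2: "continuous_on UNIV (\<lambda>x. (g x)\<^sup>2)" using g(1) by (intro continuous_intros)
  have g2b: "\<bar>(g x)\<^sup>2\<bar> \<le> B\<^sup>2" for x using g(2,3)[of x] by (simp add: power_mono)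
  have intg2: "integrable L (\<lambda>x. (g x)\<^sup>2)"
    using g2b by (intro L.integrable_const_bound[of _ "B\<^sup>2"]) auto
  \<comment> \<open>The factor W is dictated by the target m / W close to g: averaging with the
    kernel multiplies the density by about W, so m^2 is close to (W g)^2.\<close>
  define \<sigma> where "\<sigma> \<kappa> = density L (\<lambda>x. ennreal (W \<kappa> * (g x)\<^sup>2))" for \<kappa>
  define a where "a \<kappa> x = (\<integral>y. (g y)\<^sup>2 * hk_kernel \<kappa> x y \<partial>L)" for \<kappa> x
  have \<sigma>: "\<sigma> \<kappa> \<in> nonneg_measures \<Omega>" and \<sigma>_mass: "measure (\<sigma> \<kappa>) \<Omega> = W \<kappa> * (\<integral>x. (g x)\<^sup>2 \<partial>L)"
    and \<sigma>_km: "kernel_mass \<kappa> (\<sigma> \<kappa>) x = W \<kappa> * a \<kappa> x" if \<kappa>: "\<kappa> > 0" for \<kappa> x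
  proof -
    have W0: "0 \<le> W \<kappa>" using W_pos[OF \<kappa>] by simp
    have em: "emeasure (\<sigma> \<kappa>) \<Omega> = ennreal (W \<kappa> * (\<integral>x. (g x)\<^sup>2 \<partial>L))"
    proof -
      have "emeasure (\<sigma> \<kappa>) \<Omega> = (\<integral>\<^sup>+x. ennreal (W \<kappa> * (g x)\<^sup>2) \<partial>L)"
        unfolding \<sigma>_def using sets.top[of L] space_L
        by (subst emeasure_density) (auto intro!: nn_integral_cong)
      also have "\<dots> = ennreal (\<integral>x. W \<kappa> * (g x)\<^sup>2 \<partial>L)"
        using intg2 W0 by (intro nn_integral_eq_integral) auto
      finally show ?thesis by simp
    qed
    show "\<sigma> \<kappa> \<in> nonneg_measures \<Omega>"
      unfolding nonneg_measures_def using em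
      by (auto intro!: finite_measureI simp: \<sigma>_def space_L sets_of_nonneg_measures[OF L_nonneg])
    show "measure (\<sigma> \<kappa>) \<Omega> = W \<kappa> * (\<integral>x. (g x)\<^sup>2 \<partial>L)"
      by (rule measure_eq_emeasure_eq_ennreal[OF _ em]) (use W0 in \<open>simp add: integral_nonneg_AE\<close>)
    note [measurable] = nonneg_measures_measurable_id[OF L_nonneg]
    have "kernel_mass \<kappa> (\<sigma> \<kappa>) x = (\<integral>y. (W \<kappa> * (g y)\<^sup>2) *\<^sub>R hk_kernel \<kappa> x y \<partial>L)"
      unfolding kernel_mass_def \<sigma>_def using W0 by (subst integral_density) auto
    then show "kernel_mass \<kappa> (\<sigma> \<kappa>) x = W \<kappa> * a \<kappa> x"
      by (simp add: a_def mult.assoc)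
  qed
  define s where "s \<kappa> x = sqrt (a \<kappa> x / W \<kappa>)" for \<kappa> x
  have s_eq: "sqrt (kernel_mass \<kappa> (\<sigma> \<kappa>) x) = W \<kappa> * s \<kappa> x" if \<kappa>: "\<kappa> > 0" for \<kappa> x
  proof -
    have Wp: "W \<kappa> > 0" by (rule W_pos[OF \<kappa>])
    have "W \<kappa> * a \<kappa> x = (W \<kappa>)\<^sup>2 * (a \<kappa> x / W \<kappa>)" using Wp by (simp add: power2_eq_square)
    then show ?thesis
      using Wp by (simp only: \<sigma>_km[OF \<kappa>] s_def real_sqrt_mult real_sqrt_abs abs_of_pos)
  qed
  have s_meas: "s \<kappa> \<in> borel_measurable borel" if "\<kappa> > 0" for \<kappa>
  proof -
    have "(\<lambda>x. sqrt (kernel_mass \<kappa> (\<sigma> \<kappa>) x) / W \<kappa>) \<in> borel_measurable borel"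
      using borel_measurable_kernel_mass[OF \<sigma>[OF that], of "\<lambda>x. x" borel] by measurable
    then show ?thesis using W_pos[OF that] by (simp add: s_eq[OF that])
  qed
  have red: "reduced_objective \<Omega> \<rho> \<kappa> (\<sigma> \<kappa>) / W \<kappa> = (\<integral>x. (g x)\<^sup>2 \<partial>L) - 2 * (\<integral>x. s \<kappa> x \<partial>\<rho>)" if \<kappa>: "\<kappa> > 0" for \<kappa>
    using W_pos[OF \<kappa>] by (simp add: reduced_objective_def \<sigma>_mass[OF \<kappa>] s_eq[OF \<kappa>] diff_divide_distrib)
  have s_bound: "\<bar>s \<kappa> x\<bar> \<le> B" if \<kappa>: "\<kappa> > 0" for \<kappa> x
  proof -
    have Wp: "W \<kappa> > 0" by (rule W_pos[OF \<kappa>])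
    have "a \<kappa> x = (\<integral>y. (indicator \<Omega> y * (g y)\<^sup>2) * hk_kernel \<kappa> y x \<partial>lborel)"
      by (simp add: a_def integral_L mult.assoc hk_kernel_commute[of \<kappa> x])
    also have "\<dots> \<le> (\<integral>y. B\<^sup>2 * hk_kernel \<kappa> y x \<partial>lborel)"
    proof (rule integral_mono)
      show "integrable lborel (\<lambda>y. (indicator \<Omega> y * (g y)\<^sup>2) * hk_kernel \<kappa> y x)"
        by (rule integral_mult_hk_kernel_approx(1)[OF \<kappa>, of _ "B\<^sup>2"])
           (use g2b in \<open>auto simp: indicator_def\<close>)
      show "integrable lborel (\<lambda>y. B\<^sup>2 * hk_kernel \<kappa> y x)"
        by (rule integrable_mult_right[OF integrable_hk_kernel_lborel[OF \<kappa>]])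
      show "indicator \<Omega> y * (g y)\<^sup>2 * hk_kernel \<kappa> y x \<le> B\<^sup>2 * hk_kernel \<kappa> y x" for y
        using g2b[of y] by (intro mult_right_mono) (auto simp: indicator_def hk_kernel_nonneg)
    qed
    also have "\<dots> = B\<^sup>2 * W \<kappa>" by (simp add: integral_hk_kernel_W[OF \<kappa>])
    finally have "a \<kappa> x / W \<kappa> \<le> B\<^sup>2" by (simp only: pos_divide_le_eq[OF Wp])
    then have "s \<kappa> x \<le> B" unfolding s_def using B0 by (intro real_le_lsqrt) auto
    moreover have "0 \<le> a \<kappa> x / W \<kappa>"
      using Wp unfolding a_def by (intro divide_nonneg_pos integral_nonneg_AE) (auto simp: hk_kernel_nonneg)
    ultimately show ?thesis by (simp add: s_def)
  qed
  \<comment> \<open>Convexity makes the frontier negligible, and absolute continuity passes this on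
    to \<rho>.\<close>
  have "AE x in L. x \<in> interior \<Omega>"
  proof -
    have "negligible (frontier \<Omega>)" by (rule negligible_convex_frontier[OF convex])
    then have "AE x in lebesgue. x \<notin> frontier \<Omega>"
      by (intro AE_not_in) (simp add: negligible_iff_null_sets)
    then have "AE x in lborel. x \<notin> frontier \<Omega>" by (simp only: AE_completion_iff)
    then show ?thesis
      unfolding leb_on_def using compact_imp_closed[OF compact]
      by (subst AE_restrict_space_iff) (auto elim!: eventually_mono simp: frontier_def)
  qed
  then have "AE x in density L (\<lambda>x. ennreal (r x)). x \<in> interior \<Omega>"
    by (subst AE_density) (auto elim: eventually_mono)
  then have int_ae: "AE x in \<rho>. x \<in> interior \<Omega>" by (simp only: \<rho>_eq_density)
  have "((\<lambda>\<kappa>. \<integral>x. s \<kappa> x \<partial>\<rho>) \<longlongrightarrow> (\<integral>x. g x \<partial>\<rho>)) (at_right 0)"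
  \<comment> \<open>Dominated convergence is a statement about sequences, so the limit from the
    right is reduced to them; 1 is an arbitrary right endpoint.\<close>
  proof (rule tendsto_at_right_sequentially[of 0 1])
    fix S :: "nat \<Rightarrow> real" assume S: "\<And>n. 0 < S n" "S \<longlonglongrightarrow> 0"
    have Sr: "filterlim S (at_right 0) sequentially"
      using S by (intro tendsto_imp_filterlim_at_right) auto
    have \<rho>_meas: "f \<in> borel_measurable \<rho>" if "f \<in> borel_measurable borel" for f :: "'a \<Rightarrow> real"
      using that by (simp add: measurable_cong_sets[OF sets_of_nonneg_measures[OF \<rho>_nonneg] refl] measurable_restrict_space1)
    show "(\<lambda>n. \<integral>x. s (S n) x \<partial>\<rho>) \<longlonglongrightarrow> (\<integral>x. g x \<partial>\<rho>)"
    proof (rule integral_dominated_convergence[where w="\<lambda>_. B"])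
      show "AE x in \<rho>. (\<lambda>n. s (S n) x) \<longlonglongrightarrow> g x"
        using int_ae
      proof eventually_elim
        case (elim x)
        have "((\<lambda>\<kappa>. s \<kappa> x) \<longlongrightarrow> sqrt ((g x)\<^sup>2)) (at_right 0)"
          unfolding s_def a_def by (intro tendsto_real_sqrt kernel_average_tendsto[OF g2 g2b elim])
        then have "(\<lambda>n. s (S n) x) \<longlonglongrightarrow> sqrt ((g x)\<^sup>2)" using Sr by (rule filterlim_compose)
        then show ?case using g(2)[of x] by simp
      qed
      show "AE x in \<rho>. norm (s (S n) x) \<le> B" for n using s_bound[OF S(1)] by simp
    qed (use \<rho>_meas[OF g_meas] \<rho>_meas[OF s_meas[OF S(1)]] in auto)
  qed simp
  then have "((\<lambda>\<kappa>. (\<integral>x. (g x)\<^sup>2 \<partial>L) - 2 * (\<integral>x. s \<kappa> x \<partial>\<rho>) + (L2_norm L r)\<^sup>2) \<longlongrightarrow>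
      (\<integral>x. (g x)\<^sup>2 \<partial>L) - 2 * (\<integral>x. g x \<partial>\<rho>) + (L2_norm L r)\<^sup>2) (at_right 0)"
    by (intro tendsto_intros)
  moreover have "(\<integral>x. (g x)\<^sup>2 \<partial>L) - 2 * (\<integral>x. g x \<partial>\<rho>) + (L2_norm L r)\<^sup>2 < \<epsilon>"
    using gr g(2,3) by (subst L2_sq_expand[OF g_meas, of B]) auto
  ultimately have "eventually (\<lambda>\<kappa>. (\<integral>x. (g x)\<^sup>2 \<partial>L) - 2 * (\<integral>x. s \<kappa> x \<partial>\<rho>) + (L2_norm L r)\<^sup>2 < \<epsilon>) (at_right 0)"
    by (rule order_tendstoD(2))
  moreover have "eventually (\<lambda>\<kappa>. \<kappa> > 0) (at_right (0::real))" by (rule eventually_at_right_less)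
  ultimately show "eventually (\<lambda>\<kappa>. dist (l2_defect \<kappa> (\<nu> \<kappa>)) 0 < \<epsilon>) (at_right 0)"
  proof eventually_elim
    case (elim \<kappa>)
    have min: "primal_minimizer \<Omega> \<rho> \<kappa> (\<nu> \<kappa>)" using min_all elim by simp
    then have \<nu>: "\<nu> \<kappa> \<in> nonneg_measures \<Omega>" by (simp add: primal_minimizer_def)
    have "l2_defect \<kappa> (\<nu> \<kappa>) \<le> reduced_objective \<Omega> \<rho> \<kappa> (\<sigma> \<kappa>) / W \<kappa> + (L2_norm L r)\<^sup>2"
      unfolding l2_defect_eq(1)[OF \<nu> elim(2)]
      using primal_minimizer_reduced_le[OF min prob elim(2) \<sigma>[OF elim(2)]] W_pos[OF elim(2)]
      by (intro add_right_mono divide_right_mono) auto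
    also have "\<dots> < \<epsilon>" using elim(1) by (simp only: red[OF elim(2)])
    finally show ?case using l2_defect_nonneg[of \<kappa> "\<nu> \<kappa>"] by simp
  qed
qed

end

section \<open>Weak* limits of the minimisers\<close>

context square_integrable_density
begin

lemma W_tendsto: "(W \<longlongrightarrow> 0) (at_right 0)"
  unfolding W_def by (rule tendsto_eq_intros refl tendsto_ident_at | simp)+

text \<open>With w = m / W and h an extension of g, the integral of h w^2 is the intermediate
  quantity. It approaches the integral of h R^2 because the defect vanishes, and it approaches the
  rescaled integral of g because w^2 is the kernel average of \<nu> / W^2 and h is uniformly
  continuous.\<close>

lemma weak_star_rescaled:
  fixes g :: "'a \<Rightarrow> real"
  assumes min_all: "\<And>\<kappa>. \<kappa> > 0 \<Longrightarrow> primal_minimizer \<Omega> \<rho> \<kappa> (\<nu> \<kappa>)" and g: "continuous_on \<Omega> g"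
  shows "((\<lambda>\<kappa>. (\<integral>y. g y \<partial>\<nu> \<kappa>) / W \<kappa>) \<longlongrightarrow> (\<integral>x. (r x)\<^sup>2 * g x \<partial>L)) (at_right 0)"
proof -
  have \<Omega>: "\<Omega> \<noteq> {}" "closed \<Omega>"
    using R.not_empty space_\<rho> compact by (auto simp: compact_imp_closed)
  \<comment> \<open>The nearest-point map of a convex set is 1-Lipschitz, so g composed with it
    keeps both the bound and the modulus of continuity of g on the whole space.\<close>
  define P where "P = closest_point \<Omega>"
  have P: "P x \<in> \<Omega>" for x unfolding P_def by (rule closest_point_in_set[OF \<Omega>(2,1)])
  have P_id: "P x = x" if "x \<in> \<Omega>" for x unfolding P_def by (rule closest_point_self[OF that])
  have P_lip: "dist (P x) (P y) \<le> dist x y" for x y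
    unfolding P_def by (rule closest_point_lipschitz[OF convex \<Omega>(2,1)])
  define h where "h x = g (P x)" for x
  have h_eq: "h x = g x" if "x \<in> \<Omega>" for x using that by (simp add: h_def P_id)
  have hc: "continuous_on UNIV h"
    unfolding h_def P_def
    by (rule continuous_on_compose2[OF g continuous_on_closest_point[OF convex \<Omega>(2,1)]])
       (use P in \<open>auto simp: P_def\<close>)
  have h_meas [measurable]: "h \<in> borel_measurable borel" by (rule borel_measurable_continuous_onI[OF hc])
  obtain G where G: "\<And>x. x \<in> \<Omega> \<Longrightarrow> \<bar>g x\<bar> \<le> G"
    using compact_imp_bounded[OF compact_continuous_image[OF g compact]] unfolding bounded_iff by auto
  have hG: "\<bar>h x\<bar> \<le> G" for x unfolding h_def by (rule G[OF P])
  have G0: "0 \<le> G" using hG[of undefined] abs_ge_zero order_trans by blast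
  have unif: "\<exists>d>0. \<forall>x y. dist x y < d \<longrightarrow> \<bar>h x - h y\<bar> < e" if e: "e > 0" for e
  proof -
    have "uniformly_continuous_on \<Omega> g" by (rule compact_uniformly_continuous[OF g compact])
    then obtain d where d: "d > 0" "\<forall>x\<in>\<Omega>. \<forall>y\<in>\<Omega>. dist y x < d \<longrightarrow> dist (g y) (g x) < e"
      using e unfolding uniformly_continuous_on_def by blast
    have "\<bar>h x - h y\<bar> < e" if "dist x y < d" for x y
    proof -
      have "dist (P x) (P y) < d" using P_lip[of x y] that by simp
      then have "dist (g (P x)) (g (P y)) < e" using d(2) P by blast
      then show ?thesis by (simp add: h_def dist_real_def)
    qed
    then show ?thesis using d(1) by blast
  qed
  define w where "w \<kappa> x = sqrt (kernel_mass \<kappa> (\<nu> \<kappa>) x) / W \<kappa>" for \<kappa> x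
  define E where "E \<kappa> = l2_defect \<kappa> (\<nu> \<kappa>)" for \<kappa>
  define Q where "Q = (L2_norm L r)\<^sup>2"
  have E_lim: "(E \<longlongrightarrow> 0) (at_right 0)"
    unfolding E_def by (rule l2_defect_minimizer_tendsto[OF min_all])
  have pos: "eventually (\<lambda>\<kappa>. \<kappa> > 0) (at_right (0::real))" by (rule eventually_at_right_less)
  have Q0: "0 \<le> Q" by (simp add: Q_def)
  have intR: "integrable lborel (\<lambda>x. h x * (R x)\<^sup>2)"
  proof (rule Bochner_Integration.integrable_bound[OF integrable_mult_right[OF integrable_R_square, of G]])
    show "AE x in lborel. norm (h x * (R x)\<^sup>2) \<le> norm (G * (R x)\<^sup>2)"
      using hG G0 by (intro AE_I2) (simp add: abs_mult mult_right_mono)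
  qed measurable
  \<comment> \<open>Young's inequality with a free weight \<eta> controls the mixed term in w^2 -
    R^2 = (w - R)^2 + 2 (w - R) R, so that only the defect and the norm of R occur.\<close>
  have bound1: "\<bar>(\<integral>x. h x * (w \<kappa> x)\<^sup>2 \<partial>lborel) - (\<integral>x. h x * (R x)\<^sup>2 \<partial>lborel)\<bar> \<le> G * ((1 + 1 / \<eta>) * E \<kappa> + \<eta> * Q)"
    if \<kappa>: "\<kappa> > 0" and \<eta>: "\<eta> > 0" for \<kappa> \<eta>
  proof -
    have \<nu>: "\<nu> \<kappa> \<in> nonneg_measures \<Omega>" using min_all[OF \<kappa>] by (simp add: primal_minimizer_def)
    note intE = l2_defect_eq(2)[OF \<nu> \<kappa>, folded w_def]
    have w2: "(w \<kappa> x)\<^sup>2 = kernel_mass \<kappa> (\<nu> \<kappa>) x / (W \<kappa>)\<^sup>2" for x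
      by (simp add: w_def power_divide kernel_mass_nonneg)
    have intw: "integrable lborel (\<lambda>x. h x * (w \<kappa> x)\<^sup>2)"
      unfolding w2 times_divide_eq_right
      by (intro integrable_divide_zero integral_mult_kernel_mass(1)[OF \<kappa> \<nu> h_meas hG])
    have "(\<integral>x. h x * (w \<kappa> x)\<^sup>2 \<partial>lborel) - (\<integral>x. h x * (R x)\<^sup>2 \<partial>lborel) = (\<integral>x. h x * (w \<kappa> x)\<^sup>2 - h x * (R x)\<^sup>2 \<partial>lborel)"
      using intw intR by simp
    also have "\<bar>\<dots>\<bar> \<le> (\<integral>x. \<bar>h x * (w \<kappa> x)\<^sup>2 - h x * (R x)\<^sup>2\<bar> \<partial>lborel)" by (rule integral_abs_bound)
    also have "\<dots> \<le> (\<integral>x. G * ((1 + 1 / \<eta>) * (w \<kappa> x - R x)\<^sup>2 + \<eta> * (R x)\<^sup>2) \<partial>lborel)"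
    proof (rule integral_mono)
      show "integrable lborel (\<lambda>x. \<bar>h x * (w \<kappa> x)\<^sup>2 - h x * (R x)\<^sup>2\<bar>)" using intw intR by simp
      show "integrable lborel (\<lambda>x. G * ((1 + 1 / \<eta>) * (w \<kappa> x - R x)\<^sup>2 + \<eta> * (R x)\<^sup>2))"
        by (intro integrable_mult_right Bochner_Integration.integrable_add intE integrable_R_square)
      fix x
      define p where "p = w \<kappa> x - R x"
      define q where "q = R x"
      have "\<bar>2 * p * q\<bar> \<le> p\<^sup>2 / \<eta> + \<eta> * q\<^sup>2"
      proof -
        have s: "(sqrt \<eta>)\<^sup>2 = \<eta>" "sqrt \<eta> > 0" using \<eta> by auto
        have "0 \<le> (p / sqrt \<eta> - sqrt \<eta> * q)\<^sup>2" "0 \<le> (p / sqrt \<eta> + sqrt \<eta> * q)\<^sup>2" by simp_all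
        then show ?thesis
          using s by (simp add: power2_diff power2_sum power_divide power_mult_distrib abs_le_iff)
      qed
      moreover have "(w \<kappa> x)\<^sup>2 - (R x)\<^sup>2 = p\<^sup>2 + 2 * p * q"
        by (simp add: p_def q_def power2_eq_square algebra_simps)
      moreover have "\<bar>p\<^sup>2 + 2 * p * q\<bar> \<le> p\<^sup>2 + \<bar>2 * p * q\<bar>"
        using abs_triangle_ineq[of "p\<^sup>2" "2 * p * q"] by simp
      ultimately have "\<bar>(w \<kappa> x)\<^sup>2 - (R x)\<^sup>2\<bar> \<le> p\<^sup>2 + (p\<^sup>2 / \<eta> + \<eta> * q\<^sup>2)" by linarith
      also have "\<dots> = (1 + 1 / \<eta>) * p\<^sup>2 + \<eta> * q\<^sup>2" by (simp add: distrib_right)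
      finally have "\<bar>h x\<bar> * \<bar>(w \<kappa> x)\<^sup>2 - (R x)\<^sup>2\<bar> \<le> G * ((1 + 1 / \<eta>) * p\<^sup>2 + \<eta> * q\<^sup>2)"
        using hG G0 by (intro mult_mono) auto
      then show "\<bar>h x * (w \<kappa> x)\<^sup>2 - h x * (R x)\<^sup>2\<bar> \<le> G * ((1 + 1 / \<eta>) * (w \<kappa> x - R x)\<^sup>2 + \<eta> * (R x)\<^sup>2)"
        by (simp only: p_def q_def abs_mult[symmetric] right_diff_distrib)
    qed
    also have "\<dots> = G * ((1 + 1 / \<eta>) * (\<integral>x. (w \<kappa> x - R x)\<^sup>2 \<partial>lborel) + \<eta> * (\<integral>x. (R x)\<^sup>2 \<partial>lborel))"
      by (simp only: integral_mult_right_zero Bochner_Integration.integral_add[OF integrable_mult_right[OF intE] integrable_mult_right[OF integrable_R_square]])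
    also have "\<dots> = G * ((1 + 1 / \<eta>) * E \<kappa> + \<eta> * Q)"
      by (simp only: E_def l2_defect_def w_def Q_def integral_R_square)
    finally show ?thesis .
  qed
  have lim1: "((\<lambda>\<kappa>. (\<integral>x. h x * (w \<kappa> x)\<^sup>2 \<partial>lborel) - (\<integral>x. h x * (R x)\<^sup>2 \<partial>lborel)) \<longlongrightarrow> 0) (at_right 0)"
  proof (rule tendstoI)
    fix e :: real assume e: "e > 0"
    \<comment> \<open>This makes the part of the bound that does not vanish with \<kappa> smaller
      than e; the added 1 covers the case G Q = 0.\<close>
    define \<eta> where "\<eta> = e / (2 * (G * Q + 1))"
    have GQ: "0 \<le> G * Q" using G0 Q0 by simp
    then have \<eta>: "\<eta> > 0" using e by (simp add: \<eta>_def)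
    have "G * (\<eta> * Q) < e"
    proof -
      have "G * (\<eta> * Q) = e * (G * Q) / (2 * (G * Q + 1))" by (simp add: \<eta>_def)
      also have "\<dots> < e"
      proof (subst pos_divide_less_eq)
        show "0 < 2 * (G * Q + 1)" using GQ by simp
        show "e * (G * Q) < e * (2 * (G * Q + 1))"
          using e GQ by (intro mult_strict_left_mono) (simp_all add: distrib_left)
      qed
      finally show ?thesis .
    qed
    moreover have "((\<lambda>\<kappa>. G * ((1 + 1 / \<eta>) * E \<kappa> + \<eta> * Q)) \<longlongrightarrow> G * ((1 + 1 / \<eta>) * 0 + \<eta> * Q)) (at_right 0)"
      by (intro tendsto_intros E_lim)
    ultimately have "eventually (\<lambda>\<kappa>. G * ((1 + 1 / \<eta>) * E \<kappa> + \<eta> * Q) < e) (at_right 0)"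
      by (intro order_tendstoD(2)) auto
    then show "eventually (\<lambda>\<kappa>. dist ((\<integral>x. h x * (w \<kappa> x)\<^sup>2 \<partial>lborel) - (\<integral>x. h x * (R x)\<^sup>2 \<partial>lborel)) 0 < e) (at_right 0)"
      using pos
    proof eventually_elim
      case (elim \<kappa>)
      show ?case using bound1[OF elim(2) \<eta>] elim(1) by (simp only: dist_real_def diff_0_right)
    qed
  qed
  have lim2: "((\<lambda>\<kappa>. (\<integral>x. h x * (w \<kappa> x)\<^sup>2 \<partial>lborel) - (\<integral>y. g y \<partial>\<nu> \<kappa>) / W \<kappa>) \<longlongrightarrow> 0) (at_right 0)"
  proof (rule tendstoI)
    fix e :: real assume e: "e > 0"
    \<comment> \<open>The tolerance is divided by a bound for the mass of \<nu> / W, enlarged by 1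
      so that it is positive.\<close>
    define e' where "e' = e / (Q + 1)"
    have e': "e' > 0" using e Q0 by (simp add: e'_def)
    have e'Q: "e' * Q < e"
    proof -
      have "e' * Q = e * Q / (Q + 1)" by (simp add: e'_def)
      also have "\<dots> < e" using e Q0 by (subst pos_divide_less_eq) (auto simp: algebra_simps)
      finally show ?thesis .
    qed
    obtain d where d: "d > 0" "\<And>x y. dist x y < d \<Longrightarrow> \<bar>h x - h y\<bar> < e'"
      using unif[OF e'] by blast
    have "eventually (\<lambda>\<kappa>. \<kappa> * pi / 2 < d) (at_right 0)"
      by (rule order_tendstoD(2)[of _ 0]) (use d in \<open>auto intro!: tendsto_eq_intros\<close>)
    then show "eventually (\<lambda>\<kappa>. dist ((\<integral>x. h x * (w \<kappa> x)\<^sup>2 \<partial>lborel) - (\<integral>y. g y \<partial>\<nu> \<kappa>) / W \<kappa>) 0 < e) (at_right 0)"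
      using pos
    proof eventually_elim
      case (elim \<kappa>)
      note \<kappa> = elim(2)
      have Wp: "W \<kappa> > 0" by (rule W_pos[OF \<kappa>])
      have \<nu>: "\<nu> \<kappa> \<in> nonneg_measures \<Omega>" using min_all[OF \<kappa>] by (simp add: primal_minimizer_def)
      interpret N: finite_measure "\<nu> \<kappa>" by (rule finite_measure_of_nonneg_measures[OF \<nu>])
      note sp = space_eq_of_nonneg_measures[OF \<nu>]
      define F where "F y = (\<integral>x. h x * hk_kernel \<kappa> x y \<partial>lborel)" for y
      have intF: "integrable (\<nu> \<kappa>) F"
        unfolding F_def by (rule integral_mult_kernel_mass(2)[OF \<kappa> \<nu> h_meas hG])
      have intg: "integrable (\<nu> \<kappa>) g" by (rule integrable_continuous_on_nonneg_measures[OF \<nu> g compact])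
      have "(\<integral>x. h x * (w \<kappa> x)\<^sup>2 \<partial>lborel) = (\<integral>x. h x * kernel_mass \<kappa> (\<nu> \<kappa>) x / (W \<kappa>)\<^sup>2 \<partial>lborel)"
        by (simp add: w_def power_divide kernel_mass_nonneg)
      also have "\<dots> = (\<integral>y. F y \<partial>\<nu> \<kappa>) / (W \<kappa>)\<^sup>2"
        unfolding integral_divide_zero integral_mult_kernel_mass(3)[OF \<kappa> \<nu> h_meas hG] F_def ..
      finally have "(\<integral>x. h x * (w \<kappa> x)\<^sup>2 \<partial>lborel) - (\<integral>y. g y \<partial>\<nu> \<kappa>) / W \<kappa>
          = ((\<integral>y. F y \<partial>\<nu> \<kappa>) - (\<integral>y. g y \<partial>\<nu> \<kappa>) * W \<kappa>) / (W \<kappa>)\<^sup>2"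
        using Wp by (simp add: diff_divide_distrib power2_eq_square)
      also have "(\<integral>y. F y \<partial>\<nu> \<kappa>) - (\<integral>y. g y \<partial>\<nu> \<kappa>) * W \<kappa> = (\<integral>y. F y - g y * W \<kappa> \<partial>\<nu> \<kappa>)"
        using intF intg by simp
      finally have eq: "(\<integral>x. h x * (w \<kappa> x)\<^sup>2 \<partial>lborel) - (\<integral>y. g y \<partial>\<nu> \<kappa>) / W \<kappa> = (\<integral>y. F y - g y * W \<kappa> \<partial>\<nu> \<kappa>) / (W \<kappa>)\<^sup>2" .
      have "\<bar>\<integral>y. F y - g y * W \<kappa> \<partial>\<nu> \<kappa>\<bar> \<le> (\<integral>y. \<bar>F y - g y * W \<kappa>\<bar> \<partial>\<nu> \<kappa>)"
        by (rule integral_abs_bound)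
      also have "\<dots> \<le> (\<integral>y. e' * W \<kappa> \<partial>\<nu> \<kappa>)"
      proof (rule integral_mono)
        show "integrable (\<nu> \<kappa>) (\<lambda>y. \<bar>F y - g y * W \<kappa>\<bar>)" using intF intg by simp
        fix y assume "y \<in> space (\<nu> \<kappa>)"
        then have "h y = g y" by (simp add: sp h_eq)
        moreover have "\<bar>F y - h y * W \<kappa>\<bar> \<le> e' * W \<kappa>"
          unfolding F_def
        proof (rule integral_mult_hk_kernel_approx_W[OF \<kappa> h_meas hG])
          fix x assume "dist x y < \<kappa> * pi / 2"
          then show "\<bar>h x - h y\<bar> \<le> e'" using d(2)[of x y] elim(1) by linarith
        qed
        ultimately show "\<bar>F y - g y * W \<kappa>\<bar> \<le> e' * W \<kappa>" by simp
      qed simp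
      also have "\<dots> = e' * W \<kappa> * measure (\<nu> \<kappa>) \<Omega>" by (simp add: sp)
      \<comment> \<open>The mass bound supplies the second factor W, which is what matches the
        square of W in the denominator.\<close>
      also have "\<dots> \<le> e' * W \<kappa> * (W \<kappa> * Q)"
        unfolding Q_def using minimizer_mass_le[OF min_all[OF \<kappa>] \<kappa>] e' Wp by (intro mult_left_mono) auto
      also have "\<dots> = e' * Q * (W \<kappa>)\<^sup>2" by (simp add: power2_eq_square)
      finally have "\<bar>\<integral>y. F y - g y * W \<kappa> \<partial>\<nu> \<kappa>\<bar> / (W \<kappa>)\<^sup>2 \<le> e' * Q"
        using Wp by (subst pos_divide_le_eq) auto
      then have "\<bar>(\<integral>y. F y - g y * W \<kappa> \<partial>\<nu> \<kappa>) / (W \<kappa>)\<^sup>2\<bar> \<le> e' * Q"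
        by (simp only: abs_divide abs_power2)
      with e'Q show ?case unfolding eq by (simp only: dist_real_def diff_0_right)
    qed
  qed
  have "((\<lambda>\<kappa>. (\<integral>x. h x * (R x)\<^sup>2 \<partial>lborel) + ((\<integral>x. h x * (w \<kappa> x)\<^sup>2 \<partial>lborel) - (\<integral>x. h x * (R x)\<^sup>2 \<partial>lborel))
      - ((\<integral>x. h x * (w \<kappa> x)\<^sup>2 \<partial>lborel) - (\<integral>y. g y \<partial>\<nu> \<kappa>) / W \<kappa>)) \<longlongrightarrow> (\<integral>x. h x * (R x)\<^sup>2 \<partial>lborel) + 0 - 0) (at_right 0)"
    by (intro tendsto_intros lim1 lim2)
  moreover have "(\<integral>x. h x * (R x)\<^sup>2 \<partial>lborel) = (\<integral>x. (r x)\<^sup>2 * g x \<partial>L)"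
    unfolding R_square integral_L
    by (rule Bochner_Integration.integral_cong[OF refl]) (auto simp: indicator_def h_eq)
  ultimately show ?thesis by simp
qed

text \<open>The rescaled integrals have a finite limit and W tends to 0, so their product with W
  vanishes.\<close>

lemma weak_star_null:
  fixes g :: "'a \<Rightarrow> real"
  assumes min_all: "\<And>\<kappa>. \<kappa> > 0 \<Longrightarrow> primal_minimizer \<Omega> \<rho> \<kappa> (\<nu> \<kappa>)" and g: "continuous_on \<Omega> g"
  shows "((\<lambda>\<kappa>. \<integral>y. g y \<partial>\<nu> \<kappa>) \<longlongrightarrow> 0) (at_right 0)"
proof -
  have "((\<lambda>\<kappa>. W \<kappa> * ((\<integral>y. g y \<partial>\<nu> \<kappa>) / W \<kappa>)) \<longlongrightarrow> 0 * (\<integral>x. (r x)\<^sup>2 * g x \<partial>L)) (at_right 0)"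
    by (intro tendsto_intros W_tendsto weak_star_rescaled[OF min_all g])
  moreover have "eventually (\<lambda>\<kappa>. W \<kappa> * ((\<integral>y. g y \<partial>\<nu> \<kappa>) / W \<kappa>) = (\<integral>y. g y \<partial>\<nu> \<kappa>)) (at_right 0)"
    using eventually_at_right_less[of "0::real"] by eventually_elim (use W_pos in force)
  ultimately show ?thesis by (simp add: tendsto_cong)
qed

end

section \<open>Supremum-norm estimates and the conclusion\<close>

lemma sup_norm_on_le:
  assumes "A \<noteq> {}" "\<And>x. x \<in> A \<Longrightarrow> \<bar>g x\<bar> \<le> B"
  shows "\<bar>sup_norm_on A g\<bar> \<le> B"
proof -
  obtain x where x: "x \<in> A" using assms(1) by blast
  have "sup_norm_on A g \<le> B" unfolding sup_norm_on_def using assms by (rule cSUP_least)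
  moreover have "\<bar>g x\<bar> \<le> sup_norm_on A g"
    unfolding sup_norm_on_def using assms(2) by (intro cSUP_upper x bdd_aboveI2) auto
  ultimately show ?thesis by linarith
qed

text \<open>On the support of \<rho>, 1 - \<psi> equals m, and m is at most the root of the mass of
  \<nu>, hence of order \<kappa>^(d/2). Off the support optimality leaves \<psi> free; the estimate
  on all of \<Omega> is therefore stated for an optimal \<psi>' that agrees with \<psi> on the
  support.\<close>

theorem proposition4p13:
  fixes \<Omega> :: "'a::euclidean_space set"
    and \<rho> :: "'a measure"
    and \<nu> :: "real \<Rightarrow> 'a measure"
    and \<psi> :: "real \<Rightarrow> 'a \<Rightarrow> real"
  assumes "compact \<Omega>" and "convex \<Omega>" and "interior \<Omega> \<noteq> {}"
    and "\<rho> \<in> prob_measures \<Omega>"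
    and "absolutely_continuous (leb_on \<Omega>) \<rho>"
    and "square_integrable (leb_on \<Omega>) (rn_density (leb_on \<Omega>) \<rho>)"
    and "\<And>\<kappa>. \<kappa> > 0 \<Longrightarrow> optimal_pair \<Omega> \<rho> \<kappa> (\<nu> \<kappa>) (\<psi> \<kappa>)"
  shows "weak_star_tendsto \<Omega> \<nu> (null_measure (restrict_space borel \<Omega>)) (at_right 0)
    \<and> (\<forall>\<kappa>>0. measure (\<nu> \<kappa>) \<Omega>
          \<le> 4 * Cos_const TYPE('a) * (L2_norm (leb_on \<Omega>) (rn_density (leb_on \<Omega>) \<rho>))\<^sup>2 * \<kappa> ^ DIM('a))
    \<and> weak_star_tendsto \<Omega>
          (\<lambda>\<kappa>. scale_measure (ennreal (1 / (Cos_const TYPE('a) * \<kappa> ^ DIM('a)))) (\<nu> \<kappa>))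
          (density (leb_on \<Omega>) (\<lambda>x. ennreal ((rn_density (leb_on \<Omega>) \<rho> x)\<^sup>2)))
          (at_right 0)
    \<and> (\<lambda>\<kappa>. sup_norm_on (measure_support \<Omega> \<rho>) (\<lambda>x. 1 - \<psi> \<kappa> x))
          \<in> O[at_right 0](\<lambda>\<kappa>. \<kappa> powr (real DIM('a) / 2))
    \<and> (\<exists>\<psi>'. (\<forall>\<kappa>>0. optimal_pair \<Omega> \<rho> \<kappa> (\<nu> \<kappa>) (\<psi>' \<kappa>)
                    \<and> (\<forall>x\<in>measure_support \<Omega> \<rho>. \<psi>' \<kappa> x = \<psi> \<kappa> x))
          \<and> (\<lambda>\<kappa>. sup_norm_on \<Omega> (\<lambda>x. 1 - \<psi>' \<kappa> x))
              \<in> O[at_right 0](\<lambda>\<kappa>. \<kappa> powr (real DIM('a) / 2)))"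
proof -
  define W where W_eq: "W = (\<lambda>\<kappa>. Cos_const TYPE('a) * \<kappa> ^ DIM('a))"
  interpret square_integrable_density \<Omega> \<rho> W
    by unfold_locales (fact assms eq_reflection[OF W_eq])+
  define Q where "Q = (L2_norm L r)\<^sup>2"
  \<comment> \<open>This constant comes from m^2 \<le>
    \<open>measure (\<nu> \<kappa>) \<Omega>\<close> \<le> W Q, after taking roots.\<close>
  define K where "K = sqrt (Cos_const TYPE('a) * Q)"
  have opt: "optimal_pair \<Omega> \<rho> \<kappa> (\<nu> \<kappa>) (\<psi> \<kappa>)" if "\<kappa> > 0" for \<kappa> using assms(7) that .
  have min: "primal_minimizer \<Omega> \<rho> \<kappa> (\<nu> \<kappa>)" and dual: "dual_maximizer \<Omega> \<rho> \<kappa> (\<psi> \<kappa>)"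
    and \<nu>: "\<nu> \<kappa> \<in> nonneg_measures \<Omega>" and feas: "dual_feasible \<Omega> \<rho> \<kappa> (\<psi> \<kappa>)" if "\<kappa> > 0" for \<kappa>
    using opt[OF that] by (auto simp: optimal_pair_def primal_minimizer_def dual_maximizer_def)
  have mass: "measure (\<nu> \<kappa>) \<Omega> \<le> W \<kappa> * Q" if "\<kappa> > 0" for \<kappa>
    unfolding Q_def by (rule minimizer_mass_le[OF min[OF that] that])
  have m_le: "sqrt (kernel_mass \<kappa> (\<nu> \<kappa>) x) \<le> K * \<kappa> powr (real DIM('a) / 2)" if \<kappa>: "\<kappa> > 0" for \<kappa> x
  proof -
    have "sqrt (kernel_mass \<kappa> (\<nu> \<kappa>) x) \<le> sqrt (W \<kappa> * Q)"
      using kernel_mass_le[OF \<nu>[OF \<kappa>], of \<kappa> x] mass[OF \<kappa>] by simp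
    also have "W \<kappa> * Q = (Cos_const TYPE('a) * Q) * \<kappa> powr real DIM('a)"
      using \<kappa> by (simp add: W_eq powr_realpow)
    also have "sqrt \<dots> = K * \<kappa> powr (real DIM('a) / 2)"
    proof -
      have "sqrt (\<kappa> powr real DIM('a)) = (\<kappa> powr real DIM('a)) powr (1 / 2)"
        by (simp add: powr_half_sqrt)
      also have "\<dots> = \<kappa> powr (real DIM('a) / 2)" by (simp add: powr_powr)
      finally show ?thesis by (simp only: K_def real_sqrt_mult)
    qed
    finally show ?thesis .
  qed
  have ae: "AE x in \<rho>. 1 - \<psi> \<kappa> x = sqrt (kernel_mass \<kappa> (\<nu> \<kappa>) x)" if "\<kappa> > 0" for \<kappa>
    by (rule optimal_pair_AE[OF opt[OF that] prob that compact])
  have supp: "1 - \<psi> \<kappa> x = sqrt (kernel_mass \<kappa> (\<nu> \<kappa>) x)" if "\<kappa> > 0" "x \<in> measure_support \<Omega> \<rho>" for \<kappa> x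
  proof (rule AE_eq_imp_eq_on_support[OF \<rho>_nonneg _ _ ae[OF that(1)] that(2)])
    show "continuous_on \<Omega> (\<lambda>x. 1 - \<psi> \<kappa> x)"
      using feas[OF that(1)] by (auto simp: dual_feasible_def intro!: continuous_intros)
    show "continuous_on \<Omega> (\<lambda>x. sqrt (kernel_mass \<kappa> (\<nu> \<kappa>) x))"
      by (intro continuous_intros continuous_on_kernel_mass[OF \<nu>[OF that(1)]])
  qed
  have ne: "measure_support \<Omega> \<rho> \<noteq> {}" by (rule measure_support_nonempty[OF prob compact])
  have sub: "measure_support \<Omega> \<rho> \<subseteq> \<Omega>" by (auto simp: measure_support_def)
  obtain x0 where x0: "x0 \<in> measure_support \<Omega> \<rho>" using ne by blast
  \<comment> \<open>The strict dual bound \<psi> < 1 at one support point, for \<kappa> = 1, is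
    enough. Positivity is needed below, where a multiple of K becomes the truncation level.\<close>
  have K: "K > 0"
  proof -
    have "0 < 1 - \<psi> 1 x0" using feas[of 1] x0 sub by (auto simp: dual_feasible_def)
    also have "\<dots> \<le> K" using supp[of 1 x0] x0 m_le[of 1 x0] by simp
    finally show ?thesis .
  qed
  have big: "(\<lambda>\<kappa>. sup_norm_on A (\<lambda>x. 1 - \<phi> \<kappa> x)) \<in> O[at_right 0](\<lambda>\<kappa>. \<kappa> powr (real DIM('a) / 2))"
    if "A \<noteq> {}" "\<And>\<kappa> x. \<kappa> > 0 \<Longrightarrow> x \<in> A \<Longrightarrow> \<bar>1 - \<phi> \<kappa> x\<bar> \<le> K * \<kappa> powr (real DIM('a) / 2)"
    for A and \<phi> :: "real \<Rightarrow> 'a \<Rightarrow> real"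
  proof (rule bigoI[of _ K])
    show "eventually (\<lambda>\<kappa>. norm (sup_norm_on A (\<lambda>x. 1 - \<phi> \<kappa> x)) \<le> K * norm (\<kappa> powr (real DIM('a) / 2))) (at_right 0)"
      using eventually_at_right_less[of "0::real"]
    proof eventually_elim
      case (elim \<kappa>)
      have "\<bar>sup_norm_on A (\<lambda>x. 1 - \<phi> \<kappa> x)\<bar> \<le> K * \<kappa> powr (real DIM('a) / 2)"
        by (rule sup_norm_on_le[OF that(1) that(2)[OF elim]])
      then show ?case by simp
    qed
  qed
  \<comment> \<open>Off the support \<open>1 - \<psi> \<kappa>\<close> may be large; truncating it there keeps feasibility and optimality.\<close>
  define \<psi>' where "\<psi>' \<kappa> x = 1 - min (1 - \<psi> \<kappa> x) (K * \<kappa> powr (real DIM('a) / 2))" for \<kappa> x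
  have \<psi>'_supp: "\<psi>' \<kappa> x = \<psi> \<kappa> x" if "\<kappa> > 0" "x \<in> measure_support \<Omega> \<rho>" for \<kappa> x
    using supp[OF that] m_le[OF that(1), of x] by (simp add: \<psi>'_def)
  have \<psi>'_opt: "optimal_pair \<Omega> \<rho> \<kappa> (\<nu> \<kappa>) (\<psi>' \<kappa>)" if \<kappa>: "\<kappa> > 0" for \<kappa>
  proof -
    have eq: "AE x in \<rho>. \<psi>' \<kappa> x = \<psi> \<kappa> x"
      using ae[OF \<kappa>]
    proof eventually_elim
      case (elim x)
      then show ?case using m_le[OF \<kappa>, of x] by (simp add: \<psi>'_def)
    qed
    have c: "continuous_on \<Omega> (\<psi> \<kappa>)" "continuous_on \<Omega> (\<psi>' \<kappa>)"
      using feas[OF \<kappa>] unfolding \<psi>'_def by (auto simp: dual_feasible_def intro!: continuous_intros)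
    note [measurable] = measurable_continuous_on_nonneg_measures[OF \<rho>_nonneg c(1)]
      measurable_continuous_on_nonneg_measures[OF \<rho>_nonneg c(2)] nonneg_measures_measurable_id[OF \<rho>_nonneg]
    \<comment> \<open>The dual objective and the integral constraint see \<psi> only up to
      \<rho>-null sets. The strict bound by 1 is pointwise and survives because the truncation level
      is positive.\<close>
    have int: "(\<integral>x. \<psi>' \<kappa> x \<partial>\<rho>) = (\<integral>x. \<psi> \<kappa> x \<partial>\<rho>)"
      by (rule integral_cong_AE) (use eq in auto)
    have quot: "(\<integral>x. (Cos (dist x y / \<kappa>))\<^sup>2 / (1 - \<psi>' \<kappa> x) \<partial>\<rho>) = (\<integral>x. (Cos (dist x y / \<kappa>))\<^sup>2 / (1 - \<psi> \<kappa> x) \<partial>\<rho>)" for y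
      by (rule integral_cong_AE) (measurable, use eq in \<open>eventually_elim, simp\<close>)
    have "\<psi>' \<kappa> x < 1" if "x \<in> \<Omega>" for x
      using feas[OF \<kappa>] that K \<kappa> by (simp add: \<psi>'_def dual_feasible_def)
    then have "dual_feasible \<Omega> \<rho> \<kappa> (\<psi>' \<kappa>)"
      using feas[OF \<kappa>] c(2) by (simp add: dual_feasible_def quot)
    then show ?thesis
      using min[OF \<kappa>] dual[OF \<kappa>] by (simp add: optimal_pair_def dual_maximizer_def int)
  qed
  show ?thesis
  proof (intro conjI exI[of _ \<psi>'] allI impI)
    show "weak_star_tendsto \<Omega> \<nu> (null_measure (restrict_space borel \<Omega>)) (at_right 0)"
    proof -
      have "AE x in null_measure (restrict_space borel \<Omega>). g x = 0" for g :: "'a \<Rightarrow> real"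
        by (rule AE_I'[of \<Omega>]) (auto simp: null_sets_def space_restrict_space sets_restrict_space)
      then have "(\<integral>x. g x \<partial>null_measure (restrict_space borel \<Omega>)) = 0" for g :: "'a \<Rightarrow> real"
        by (rule integral_eq_zero_AE)
      then show ?thesis
        unfolding weak_star_tendsto_def using weak_star_null[OF min] by simp
    qed
    show "measure (\<nu> \<kappa>) \<Omega> \<le> 4 * Cos_const TYPE('a) * (L2_norm L r)\<^sup>2 * \<kappa> ^ DIM('a)" if "\<kappa> > 0" for \<kappa>
    proof -
      \<comment> \<open>The bound has already been obtained with constant 1; nonnegativity allows
        the factor 4.\<close>
      have "0 \<le> W \<kappa> * Q" using W_pos[OF that] by (simp add: Q_def)
      then have "W \<kappa> * Q \<le> 4 * (W \<kappa> * Q)" by linarith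
      with mass[OF that] show ?thesis by (simp add: W_eq Q_def mult_ac)
    qed
    show "weak_star_tendsto \<Omega>
          (\<lambda>\<kappa>. scale_measure (ennreal (1 / (Cos_const TYPE('a) * \<kappa> ^ DIM('a)))) (\<nu> \<kappa>))
          (density L (\<lambda>x. ennreal ((r x)\<^sup>2))) (at_right 0)"
      unfolding weak_star_tendsto_def
    proof (intro allI impI)
      fix g :: "'a \<Rightarrow> real" assume g: "continuous_on \<Omega> g"
      have "eventually (\<lambda>\<kappa>. (\<integral>y. g y \<partial>\<nu> \<kappa>) / W \<kappa>
          = (\<integral>x. g x \<partial>scale_measure (ennreal (1 / (Cos_const TYPE('a) * \<kappa> ^ DIM('a)))) (\<nu> \<kappa>))) (at_right 0)"
        using eventually_at_right_less[of "0::real"]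
      proof eventually_elim
        case (elim \<kappa>)
        have "(\<integral>x. g x \<partial>scale_measure (ennreal (1 / W \<kappa>)) (\<nu> \<kappa>)) = 1 / W \<kappa> * (\<integral>y. g y \<partial>\<nu> \<kappa>)"
          using W_pos[OF elim] measurable_continuous_on_nonneg_measures[OF \<nu>[OF elim] g]
          by (intro integral_scale_measure) auto
        then show ?case by (simp add: W_eq)
      qed
      moreover have "(\<integral>x. g x \<partial>density L (\<lambda>x. ennreal ((r x)\<^sup>2))) = (\<integral>x. (r x)\<^sup>2 * g x \<partial>L)"
        using measurable_continuous_on_nonneg_measures[OF L_nonneg g] by (simp add: integral_density)
      ultimately show "((\<lambda>\<kappa>. \<integral>x. g x \<partial>scale_measure (ennreal (1 / (Cos_const TYPE('a) * \<kappa> ^ DIM('a)))) (\<nu> \<kappa>))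
          \<longlongrightarrow> (\<integral>x. g x \<partial>density L (\<lambda>x. ennreal ((r x)\<^sup>2)))) (at_right 0)"
        using weak_star_rescaled[OF min g] by (simp only: tendsto_cong)
    qed
    show "(\<lambda>\<kappa>. sup_norm_on (measure_support \<Omega> \<rho>) (\<lambda>x. 1 - \<psi> \<kappa> x)) \<in> O[at_right 0](\<lambda>\<kappa>. \<kappa> powr (real DIM('a) / 2))"
    proof (rule big[OF ne])
      show "\<bar>1 - \<psi> \<kappa> x\<bar> \<le> K * \<kappa> powr (real DIM('a) / 2)" if "\<kappa> > 0" "x \<in> measure_support \<Omega> \<rho>" for \<kappa> x
        using m_le[OF that(1), of x] by (simp add: supp[OF that] kernel_mass_nonneg)
    qed
    show "optimal_pair \<Omega> \<rho> \<kappa> (\<nu> \<kappa>) (\<psi>' \<kappa>)" if "\<kappa> > 0" for \<kappa> by (rule \<psi>'_opt[OF that])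
    show "\<forall>x\<in>measure_support \<Omega> \<rho>. \<psi>' \<kappa> x = \<psi> \<kappa> x" if "\<kappa> > 0" for \<kappa> using \<psi>'_supp[OF that] by blast
    show "(\<lambda>\<kappa>. sup_norm_on \<Omega> (\<lambda>x. 1 - \<psi>' \<kappa> x)) \<in> O[at_right 0](\<lambda>\<kappa>. \<kappa> powr (real DIM('a) / 2))"
    proof (rule big)
      show "\<Omega> \<noteq> {}" using ne sub by blast
      show "\<bar>1 - \<psi>' \<kappa> x\<bar> \<le> K * \<kappa> powr (real DIM('a) / 2)" if "\<kappa> > 0" "x \<in> \<Omega>" for \<kappa> x
      proof -
        have "0 \<le> 1 - \<psi> \<kappa> x" using feas[OF that(1)] that(2) by (auto simp: dual_feasible_def intro: less_imp_le)
        then show ?thesis using K by (simp add: \<psi>'_def)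
      qed
    qed
  qed
qed

end
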